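(* Let $\phi:(\mathbb{P}^1)^3\dashrightarrow\mathbb{P}^3$ be a scaffold trilinear rational map (with $\Sigma_0,\Sigma_1$ the planar boundary surfaces). The following are equivalent: 1. $\phi$ is birational of type $(1,2,2)$; 2. one of the four tensors $$W(l,y)=\left(\frac{w_{ijk}}{\Delta_{ijk}(l,y)}\right)_{0\le i,j,k\le1},\qquad W(l,z)=\left(\frac{w_{ijk}}{\Delta_{ijk}(l,z)}\right)_{0\le i,j,k\le1},\qquad l=0,1,$$ has rank one; 3. the four tensors above have rank one.
   Context: Setting. $\mathbb{P}^n$ is complex projective $n$-space. $\phi:\mathbb{P}^1\times\mathbb{P}^1\times\mathbb{P}^1\dashrightarrow\mathbb{P}^3$ is the trilinear rational map given by $$\mathbf{f}=(f_0,f_1,f_2,f_3)=\sum_{0\le i,j,k\le 1} w_{ijk}\,\mathbf{P}_{ijk}\,s_it_ju_k,$$ with control points $\mathbf{P}_{ijk}=(1,x_{ijk},y_{ijk},z_{ijk})\in\mathbb{R}^4$ (identified with points of $\mathbb{P}^3$) and weights $w_{ijk}\in\mathbb{R}$. Boundary surfaces. $\Sigma_0$ (resp. $\Sigma_1$) is the closure of the image of $\phi$ restricted to $(s_0:s_1)=(1:0)$ (resp. $(0:1)$). $T_0,T_1$ and $Y_0,Y_1$ are defined in the same way using $(t_0:t_1)$ and $(u_0:u_1)$. So $\mathbf{P}_{ijk}\in\Sigma_i\cap T_j\cap Y_k$. Boundary lines: $s_{jk}$ joins $\mathbf{P}_{0jk},\mathbf{P}_{1jk}$; $t_{ik}$ joins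 $\mathbf{P}_{i0k},\mathbf{P}_{i1k}$; $u_{ij}$ joins $\mathbf{P}_{ij0},\mathbf{P}_{ij1}$ (images of the corresponding coordinate lines). Each boundary surface is a plane or a quadric. Standing nondegeneracy assumption: the surfaces $\Sigma_i,T_j,Y_k$ are smooth surfaces, pairwise distinct, and $s_{jk},t_{ik},u_{ij}$ are lines, pairwise distinct. $\phi$ is scaffold if all the boundary surfaces are quadrics except for one of the three parameters, for which (1) the two boundary surfaces are planes, that intersect at a line $\ell$, and (2) the four boundary lines intersect two lines $r_0,r_1$, and these two intersect $\ell$. Convention: this parameter is $s$, so $\Sigma_0,\Sigma_1$ are planes, $\ell=s:=\Sigma_0\cap\Sigma_1$, and $r_0,r_1$ meet $s_{jk}$ for all $0\le j,k\le1$. Let $y$ be the line through the points $u_{00}\cap u_{01}$ and $u_{10}\cap u_{11}$, and $z$ the line through the points $t_{00}\cap t_{01}$ and $t_{10}\cap t_{11}$. For $j,k\in\{0,1\}$ let $\Theta_j$ be the plane containing $y$ and $r_j$, defined by $\boldsymbol{\theta}_j\cdot\mathbf{x}^T=0$, and $P_k$ the plane containing $z$ and $r_k$, defined by $\boldsymbol{\rho}_k\cdot\mathbf{x}^T=0$, with $\boldsymbol{\theta}_j,\boldsymbol{\rho}_k\in\mathbb{R}^4$. For $l=0,1$ set $$\Delta_{ijk}(l,y)=\frac{1}{\langle\boldsymbol{\theta}_l,\mathbf{P}_{ijk}\rangle},\qquad \Delta_{ijk}(l,z)=\frac{1}{\langle\boldsymbol{\rho}_l,\mathbf{P}_{ijk}\rangle}$$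 (well defined under the standing assumption), where $\langle\cdot,\cdot\rangle$ is the usual scalar product. Type. If $\phi$ is birational, its inverse is $\mathbf{x}\mapsto(A_0:A_1)\times(B_0:B_1)\times(C_0:C_1)$ with $A_0,A_1$ (resp. $B_0,B_1$; $C_0,C_1$) homogeneous of the same degree in $\mathbf{x}=(x_0,\dots,x_3)$ without common factor; the type of $\phi$ is $(\deg A_i,\deg B_j,\deg C_k)$. A tensor has rank one if it equals $\boldsymbol{\alpha}\otimes\boldsymbol{\beta}\otimes\boldsymbol{\gamma}$ with nonzero vectors. *)

theory Defs
  imports
    "HOL-Analysis.Analysis"
    "HOL-Library.Poly_Mapping"
    "HOL-Computational_Algebra.Factorial_Ring"
begin

section \<open>Complex projective space\<close>

text \<open>
  The points of the projective space with homogeneous coordinates indexed by \<open>'n\<close> are the nonzero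
  vectors up to scaling, so \<open>2 proj\<close> is the projective line and \<open>4 proj\<close> is projective 3-space.
  The numeral types \<open>2\<close> and \<open>4\<close> are the index sets \<open>{0, 1}\<close> and \<open>{0, 1, 2, 3}\<close>.
\<close>

definition proj_rel :: "complex ^ 'n \<Rightarrow> complex ^ 'n \<Rightarrow> bool" where
  "proj_rel x y \<longleftrightarrow> x \<noteq> 0 \<and> y \<noteq> 0 \<and> (\<exists>c. y = c *s x)"

lemma part_equivp_proj_rel: "part_equivp (proj_rel :: complex ^ 'n \<Rightarrow> complex ^ 'n \<Rightarrow> bool)"
proof (rule part_equivpI)
  have "proj_rel ((\<chi> i. 1) :: complex ^ 'n) (\<chi> i. 1)"
    unfolding proj_rel_def by (auto simp: vec_eq_iff intro!: exI[of _ 1])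
  then show "\<exists>x :: complex ^ 'n. proj_rel x x" by blast
  show "symp (proj_rel :: complex ^ 'n \<Rightarrow> complex ^ 'n \<Rightarrow> bool)"
  proof (rule sympI)
    fix x y :: "complex ^ 'n"
    assume "proj_rel x y"
    then obtain c where c: "x \<noteq> 0" "y \<noteq> 0" "y = c *s x" unfolding proj_rel_def by blast
    then have "c \<noteq> 0" by auto
    then have "x = inverse c *s y" using c(3) by (simp add: vec_eq_iff)
    then show "proj_rel y x" using c unfolding proj_rel_def by blast
  qed
  show "transp (proj_rel :: complex ^ 'n \<Rightarrow> complex ^ 'n \<Rightarrow> bool)"
    unfolding transp_def proj_rel_def by (metis vector_smult_assoc)
qed

quotient_type 'n proj = "complex ^ ('n::finite)" / partial: proj_rel
  by (rule part_equivp_proj_rel)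

text \<open>\<open>pt x\<close> is the point with homogeneous coordinates \<open>x\<close>; it is only meaningful for \<open>x \<noteq> 0\<close>.\<close>

definition pt :: "complex ^ 'n \<Rightarrow> ('n::finite) proj" where
  "pt x = abs_proj x"

lemma pt_eq_iff:
  assumes "x \<noteq> 0" "y \<noteq> 0"
  shows "pt x = pt y \<longleftrightarrow> (\<exists>c. y = c *s x)"
proof -
  have self: "proj_rel v v" if "v \<noteq> 0" for v :: "complex ^ 'n"
    using that unfolding proj_rel_def by (auto intro!: exI[of _ 1])
  have "pt x = pt y \<longleftrightarrow> proj_rel x y"
    unfolding pt_def using Quotient3_proj self[OF assms(1)] self[OF assms(2)]
    by (metis Quotient3_rel)
  then show ?thesis using assms by (simp add: proj_rel_def)
qed

definition projectivize :: "(complex ^ 'n) set \<Rightarrow> ('n::finite) proj set" where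
  "projectivize V = {pt x | x. x \<in> V \<and> x \<noteq> 0}"

definition is_line :: "('n::finite) proj set \<Rightarrow> bool" where
  "is_line L \<longleftrightarrow> (\<exists>V. vec.subspace V \<and> vec.dim V = 2 \<and> L = projectivize V)"

definition is_plane :: "('n::finite) proj set \<Rightarrow> bool" where
  "is_plane L \<longleftrightarrow> (\<exists>V. vec.subspace V \<and> vec.dim V = 3 \<and> L = projectivize V)"

text \<open>The smallest linear subspace containing a set of points: for two distinct points, the line
  joining them.\<close>

definition proj_hull :: "('n::finite) proj set \<Rightarrow> 'n proj set" where
  "proj_hull S = projectivize (vec.span {x. x \<noteq> 0 \<and> pt x \<in> S})"

definition cvec :: "real ^ 'n \<Rightarrow> complex ^ 'n" where
  "cvec v = (\<chi> i. complex_of_real (v $ i))"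

definition plane_of :: "real ^ ('n::finite) \<Rightarrow> 'n proj set" where
  "plane_of a = projectivize {x. (\<Sum>i\<in>UNIV. cvec a $ i * x $ i) = 0}"


section \<open>Polynomials, surfaces and Zariski closure\<close>

text \<open>A polynomial over the complex numbers in variables indexed by \<open>'n\<close> is a finitely supported
  map from exponent vectors to coefficients; multiplication is convolution.\<close>

type_synonym 'n cpoly = "('n \<Rightarrow>\<^sub>0 nat) \<Rightarrow>\<^sub>0 complex"

definition cpoly_eval :: "('n::finite) cpoly \<Rightarrow> complex ^ 'n \<Rightarrow> complex" where
  "cpoly_eval F x =
     (\<Sum>m\<in>Poly_Mapping.keys F. Poly_Mapping.lookup F m * (\<Prod>i\<in>UNIV. x $ i ^ Poly_Mapping.lookup m i))"

text \<open>The zero polynomial is homogeneous of every degree.\<close>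

definition homogeneous :: "nat \<Rightarrow> ('n::finite) cpoly \<Rightarrow> bool" where
  "homogeneous d F \<longleftrightarrow>
     (\<forall>m\<in>Poly_Mapping.keys F. (\<Sum>i\<in>UNIV. Poly_Mapping.lookup m i) = d)"

definition no_common_factor :: "('n::finite) cpoly \<Rightarrow> 'n cpoly \<Rightarrow> bool" where
  "no_common_factor F G \<longleftrightarrow> (\<forall>H. H dvd F \<longrightarrow> H dvd G \<longrightarrow> H dvd 1)"

definition zeros :: "('n::finite) cpoly \<Rightarrow> 'n proj set" where
  "zeros F = projectivize {x. cpoly_eval F x = 0}"

definition zariski_closure :: "('n::finite) proj set \<Rightarrow> 'n proj set" where
  "zariski_closure S = {p. \<forall>F d. homogeneous d F \<longrightarrow> S \<subseteq> zeros F \<longrightarrow> p \<in> zeros F}"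

definition partial_deriv :: "'n \<Rightarrow> ('n::finite) cpoly \<Rightarrow> complex ^ 'n \<Rightarrow> complex" where
  "partial_deriv i F x = deriv (\<lambda>z. cpoly_eval F (\<chi> j. if j = i then z else x $ j)) (x $ i)"

text \<open>The Jacobian criterion.  A polynomial \<open>F\<close> as below is automatically squarefree, and irreducible,
  since two components of a surface in 3-space always meet.\<close>

definition smooth_surface :: "4 proj set \<Rightarrow> bool" where
  "smooth_surface S \<longleftrightarrow>
     (\<exists>F d. 0 < d \<and> homogeneous d F \<and> S = zeros F \<and>
        (\<forall>x. x \<noteq> 0 \<longrightarrow> cpoly_eval F x = 0 \<longrightarrow> (\<exists>i. partial_deriv i F x \<noteq> 0)))"

text \<open>Irreducibility keeps a plane, which is the zero set of a squared linear form, from counting as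
  a quadric.\<close>

definition is_quadric :: "4 proj set \<Rightarrow> bool" where
  "is_quadric S \<longleftrightarrow> (\<exists>F. homogeneous 2 F \<and> irreducible F \<and> S = zeros F)"


section \<open>Trilinear rational maps\<close>

text \<open>Weights and control points are indexed by \<open>i, j, k \<in> {0, 1}\<close>.\<close>

type_synonym tensor = "2 \<Rightarrow> 2 \<Rightarrow> 2 \<Rightarrow> real"
type_synonym points = "2 \<Rightarrow> 2 \<Rightarrow> 2 \<Rightarrow> real ^ 4"

definition trilin ::
  "tensor \<Rightarrow> points \<Rightarrow> complex ^ 2 \<Rightarrow> complex ^ 2 \<Rightarrow> complex ^ 2 \<Rightarrow> complex ^ 4" where
  "trilin w P s t u =
     (\<Sum>i\<in>UNIV. \<Sum>j\<in>UNIV. \<Sum>k\<in>UNIV.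
        (complex_of_real (w i j k) * s $ i * t $ j * u $ k) *s cvec (P i j k))"

text \<open>The boundary surfaces.  Note that \<open>axis 0 1 = (1, 0)\<close> and \<open>axis 1 1 = (0, 1)\<close>, and that
  \<^const>\<open>projectivize\<close> discards the parameters where the map is undefined.\<close>

definition Sigma_surf :: "tensor \<Rightarrow> points \<Rightarrow> 2 \<Rightarrow> 4 proj set" where
  "Sigma_surf w P i = zariski_closure (projectivize
     {trilin w P (axis i 1) t u | t u. t \<noteq> 0 \<and> u \<noteq> 0})"

definition T_surf :: "tensor \<Rightarrow> points \<Rightarrow> 2 \<Rightarrow> 4 proj set" where
  "T_surf w P j = zariski_closure (projectivize
     {trilin w P s (axis j 1) u | s u. s \<noteq> 0 \<and> u \<noteq> 0})"

definition Y_surf :: "tensor \<Rightarrow> points \<Rightarrow> 2 \<Rightarrow> 4 proj set" where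
  "Y_surf w P k = zariski_closure (projectivize
     {trilin w P s t (axis k 1) | s t. s \<noteq> 0 \<and> t \<noteq> 0})"

definition s_line :: "points \<Rightarrow> 2 \<Rightarrow> 2 \<Rightarrow> 4 proj set" where
  "s_line P j k = proj_hull {pt (cvec (P 0 j k)), pt (cvec (P 1 j k))}"

definition t_line :: "points \<Rightarrow> 2 \<Rightarrow> 2 \<Rightarrow> 4 proj set" where
  "t_line P i k = proj_hull {pt (cvec (P i 0 k)), pt (cvec (P i 1 k))}"

definition u_line :: "points \<Rightarrow> 2 \<Rightarrow> 2 \<Rightarrow> 4 proj set" where
  "u_line P i j = proj_hull {pt (cvec (P i j 0)), pt (cvec (P i j 1))}"

definition nondegenerate :: "tensor \<Rightarrow> points \<Rightarrow> bool" where
  "nondegenerate w P \<longleftrightarrow>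
     (\<forall>i. smooth_surface (Sigma_surf w P i)) \<and>
     (\<forall>j. smooth_surface (T_surf w P j)) \<and>
     (\<forall>k. smooth_surface (Y_surf w P k)) \<and>
     distinct [Sigma_surf w P 0, Sigma_surf w P 1, T_surf w P 0, T_surf w P 1,
               Y_surf w P 0, Y_surf w P 1] \<and>
     (\<forall>j k. is_line (s_line P j k)) \<and>
     (\<forall>i k. is_line (t_line P i k)) \<and>
     (\<forall>i j. is_line (u_line P i j)) \<and>
     distinct [s_line P 0 0, s_line P 0 1, s_line P 1 0, s_line P 1 1,
               t_line P 0 0, t_line P 0 1, t_line P 1 0, t_line P 1 1,
               u_line P 0 0, u_line P 0 1, u_line P 1 0, u_line P 1 1]"

text \<open>Scaffold maps whose planar boundary surfaces are those of the parameter \<open>s\<close>, with transversal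
  lines \<open>r 0\<close> and \<open>r 1\<close>.\<close>

definition scaffold :: "tensor \<Rightarrow> points \<Rightarrow> (2 \<Rightarrow> 4 proj set) \<Rightarrow> bool" where
  "scaffold w P r \<longleftrightarrow>
     (\<forall>j. is_quadric (T_surf w P j)) \<and> (\<forall>k. is_quadric (Y_surf w P k)) \<and>
     (\<forall>i. is_plane (Sigma_surf w P i)) \<and>
     is_line (Sigma_surf w P 0 \<inter> Sigma_surf w P 1) \<and>
     (\<forall>l. is_line (r l)) \<and> r 0 \<noteq> r 1 \<and>
     (\<forall>l j k. r l \<inter> s_line P j k \<noteq> {}) \<and>
     (\<forall>l. r l \<inter> (Sigma_surf w P 0 \<inter> Sigma_surf w P 1) \<noteq> {})"

text \<open>For scaffold maps, \<open>y_line P\<close> is the line through the points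
  \<open>u_line P 0 0 \<inter> u_line P 0 1\<close> and \<open>u_line P 1 0 \<inter> u_line P 1 1\<close>; similarly for \<open>z_line\<close>.\<close>

definition y_line :: "points \<Rightarrow> 4 proj set" where
  "y_line P = proj_hull ((u_line P 0 0 \<inter> u_line P 0 1) \<union> (u_line P 1 0 \<inter> u_line P 1 1))"

definition z_line :: "points \<Rightarrow> 4 proj set" where
  "z_line P = proj_hull ((t_line P 0 0 \<inter> t_line P 0 1) \<union> (t_line P 1 0 \<inter> t_line P 1 1))"


section \<open>Birationality and type\<close>

definition eval_pair :: "(2 \<Rightarrow> 4 cpoly) \<Rightarrow> complex ^ 4 \<Rightarrow> complex ^ 2" where
  "eval_pair A x = (\<chi> i. cpoly_eval (A i) x)"

text \<open>The rational map \<open>x \<mapsto> (A 0 : A 1) \<times> (B 0 : B 1) \<times> (C 0 : C 1)\<close> is a rational inverse: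
  both composites are defined somewhere (hence on a dense open set) and are the identity wherever
  they are defined.\<close>

definition rational_inverse ::
  "tensor \<Rightarrow> points \<Rightarrow> (2 \<Rightarrow> 4 cpoly) \<Rightarrow> (2 \<Rightarrow> 4 cpoly) \<Rightarrow> (2 \<Rightarrow> 4 cpoly) \<Rightarrow> bool" where
  "rational_inverse w P A B C \<longleftrightarrow>
     (let D = {(s, t, u). s \<noteq> 0 \<and> t \<noteq> 0 \<and> u \<noteq> 0 \<and> trilin w P s t u \<noteq> 0 \<and>
                 eval_pair A (trilin w P s t u) \<noteq> 0 \<and>
                 eval_pair B (trilin w P s t u) \<noteq> 0 \<and>
                 eval_pair C (trilin w P s t u) \<noteq> 0};
          E = {x. x \<noteq> 0 \<and> eval_pair A x \<noteq> 0 \<and> eval_pair B x \<noteq> 0 \<and> eval_pair C x \<noteq> 0 \<and>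
                 trilin w P (eval_pair A x) (eval_pair B x) (eval_pair C x) \<noteq> 0}
      in D \<noteq> {} \<and>
         (\<forall>(s, t, u) \<in> D. pt (eval_pair A (trilin w P s t u)) = pt s \<and>
                           pt (eval_pair B (trilin w P s t u)) = pt t \<and>
                           pt (eval_pair C (trilin w P s t u)) = pt u) \<and>
         E \<noteq> {} \<and>
         (\<forall>x \<in> E. pt (trilin w P (eval_pair A x) (eval_pair B x) (eval_pair C x)) = pt x))"

definition birational_of_type :: "tensor \<Rightarrow> points \<Rightarrow> nat \<times> nat \<times> nat \<Rightarrow> bool" where
  "birational_of_type w P = (\<lambda>(a, b, c). \<exists>A B C.
     (\<forall>i. homogeneous a (A i)) \<and> no_common_factor (A 0) (A 1) \<and>
     (\<forall>i. homogeneous b (B i)) \<and> no_common_factor (B 0) (B 1) \<and>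
     (\<forall>i. homogeneous c (C i)) \<and> no_common_factor (C 0) (C 1) \<and>
     rational_inverse w P A B C)"


section \<open>Tensors\<close>

definition rank_one :: "tensor \<Rightarrow> bool" where
  "rank_one W \<longleftrightarrow>
     (\<exists>\<alpha> \<beta> \<gamma> :: real ^ 2. \<alpha> \<noteq> 0 \<and> \<beta> \<noteq> 0 \<and> \<gamma> \<noteq> 0 \<and>
        (\<forall>i j k. W i j k = \<alpha> $ i * \<beta> $ j * \<gamma> $ k))"

definition Delta :: "points \<Rightarrow> real ^ 4 \<Rightarrow> tensor" where
  "Delta P a i j k = 1 / (a \<bullet> P i j k)"

definition W_tensor :: "tensor \<Rightarrow> points \<Rightarrow> real ^ 4 \<Rightarrow> tensor" where
  "W_tensor w P a i j k = w i j k / Delta P a i j k"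

end

(*
  Rescale the control points to p_ijk = c_ijk P_ijk so that the four points in each plane Sigma_i sum to
  zero; then phi = sum om_ijk p_ijk s_i t_j u_k with om = w / c. The plane theta_l contains the diagonal
  point p_i00 + p_i01 of Sigma_i and the points of r_l on the lines s_jk. This forces the values
  theta_l(p_ijk) to be products of a factor in i, one in j and one in k, and never zero; likewise for
  rho_l. Hence each of the four tensors has rank one exactly when om has.
  The same argument gives one ratio m_l for all j, k with p_0jk - m_l p_1jk on r_l. So the linear map Phi
  with eigenspaces r_0, r_1 and eigenvalues m_1, m_0 maps p_1jk to p_0jk for all j, k.
  If om has rank one, then after rescaling the parameters phi(s,t,u) = (s_0 Phi + s_1) v(t,u), where v is
  a bilinear parametrisation of the plane Sigma_1 with one base point. The pencil of planes through
  Sigma_0 and Sigma_1 recovers s; multiplying by the conjugate of s_0 Phi + s_1 recovers v, so t and u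
  are ratios of quadrics.
  Conversely, an inverse of type (1,2,2) forces each slice om_i to have rank one, because otherwise phi
  is two-to-one on Sigma_i with different values of t on a fibre; and its linear components are the
  equations of Sigma_0, Sigma_1, so the two slices are proportional.
*)
theory Submission
  imports Defs "HOL-Computational_Algebra.Fundamental_Theorem_Algebra"
begin

section \<open>Evaluation of polynomials\<close>

text \<open>The rescaling constants are complex while the tensors are real. Rank one is therefore
  tested by polynomial identities between entries (\<open>minors_vanish\<close>), which read the
  same over both fields. After rescaling, the diagonal point of Sigma_i on the line \<open>y\<close>
  is also \<open>- (p i 1 0 + p i 1 1)\<close>, so a plane \<theta> through \<open>y\<close> takes
  opposite values at the two ends of each \<open>u\<close> line; a plane \<rho> through
  \<open>z\<close> does the same on the \<open>t\<close> lines. Exchanging the last two indices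
  turns one situation into the other, so whatever is proved for \<theta> and the \<open>t\<close>
  component of the inverse is reused for \<rho> and the \<open>u\<close> component. Two obstacles
  shape the rest. The inverse must have components without common factor, which is hard to see from
  a formula; the quadratic components are therefore identified with the equations of the boundary
  quadrics, which are irreducible. And the rational inverse speaks only about points where
  everything is defined; its conditions are first extended to all parameters, one line at a time, so
  that they may be evaluated at the corners.\<close>

definition mon_eval :: "(('n::finite) \<Rightarrow>\<^sub>0 nat) \<Rightarrow> complex ^ 'n \<Rightarrow> complex" where
  "mon_eval m x = (\<Prod>i\<in>UNIV. x $ i ^ Poly_Mapping.lookup m i)"

lemma mon_eval_add: "mon_eval (m + n) x = mon_eval m x * mon_eval n x"
  by (simp add: mon_eval_def lookup_add power_add prod.distrib)

lemma cpoly_eval_superset: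
  assumes "finite S" "Poly_Mapping.keys F \<subseteq> S"
  shows "cpoly_eval F x = (\<Sum>m\<in>S. Poly_Mapping.lookup F m * mon_eval m x)"
  unfolding cpoly_eval_def mon_eval_def
  by (rule sum.mono_neutral_left) (use assms in \<open>auto simp: in_keys_iff\<close>)

lemma cpoly_eval_add: "cpoly_eval (F + G) x = cpoly_eval F x + cpoly_eval G x"
proof -
  let ?S = "Poly_Mapping.keys F \<union> Poly_Mapping.keys G"
  have "Poly_Mapping.keys (F + G) \<subseteq> ?S" by (rule Poly_Mapping.keys_add)
  then show ?thesis
    by (simp add: cpoly_eval_superset[of ?S] lookup_add algebra_simps sum.distrib)
qed

lemma cpoly_eval_zero [simp]: "cpoly_eval 0 x = 0"
  by (simp add: cpoly_eval_def)

lemma cpoly_eval_single: "cpoly_eval (Poly_Mapping.single m c) x = c * mon_eval m x"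
  by (subst cpoly_eval_superset[of "{m}"]) auto

lemma cpoly_eval_const [simp]: "cpoly_eval (Poly_Mapping.single 0 c) x = c"
  by (simp add: cpoly_eval_single mon_eval_def)

lemma cpoly_eval_one [simp]: "cpoly_eval 1 x = 1"
  by (metis cpoly_eval_const single_one)

lemma cpoly_eval_sum: "cpoly_eval (\<Sum>a\<in>A. F a) x = (\<Sum>a\<in>A. cpoly_eval (F a) x)"
  by (induction A rule: infinite_finite_induct) (auto simp: cpoly_eval_add)

lemma cpoly_eval_diff: "cpoly_eval (F - G) x = cpoly_eval F x - cpoly_eval G x"
  using cpoly_eval_add[of "F - G" G x] by simp

lemma cpoly_sum_single:
  "F = (\<Sum>m\<in>Poly_Mapping.keys F. Poly_Mapping.single m (Poly_Mapping.lookup F m))"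
  for F :: "('n::finite) cpoly"
proof (rule poly_mapping_eqI)
  fix k
  have "Poly_Mapping.lookup
          (\<Sum>m\<in>Poly_Mapping.keys F. Poly_Mapping.single m (Poly_Mapping.lookup F m)) k
        = (\<Sum>m\<in>Poly_Mapping.keys F. if m = k then Poly_Mapping.lookup F m else 0)"
    by (simp add: lookup_sum lookup_single when_def)
  then show "Poly_Mapping.lookup F k = Poly_Mapping.lookup
          (\<Sum>m\<in>Poly_Mapping.keys F. Poly_Mapping.single m (Poly_Mapping.lookup F m)) k"
    by (auto simp: in_keys_iff)
qed

lemma cpoly_eval_mult: "cpoly_eval (F * G) x = cpoly_eval F x * cpoly_eval G x"
proof -
  let ?s = "\<lambda>F m. Poly_Mapping.single m (Poly_Mapping.lookup F m)"
  have "F * G = (\<Sum>m\<in>Poly_Mapping.keys F. ?s F m) * (\<Sum>n\<in>Poly_Mapping.keys G. ?s G n)"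
    using cpoly_sum_single[of F] cpoly_sum_single[of G] by simp
  also have "cpoly_eval \<dots> x
      = (\<Sum>m\<in>Poly_Mapping.keys F. \<Sum>n\<in>Poly_Mapping.keys G.
           (Poly_Mapping.lookup F m * mon_eval m x) * (Poly_Mapping.lookup G n * mon_eval n x))"
    by (simp add: sum_product cpoly_eval_sum mult_single cpoly_eval_single mon_eval_add ac_simps)
  also have "\<dots> = cpoly_eval F x * cpoly_eval G x"
    by (simp add: sum_product cpoly_eval_def mon_eval_def)
  finally show ?thesis .
qed

text \<open>The lowest digit is the value modulo \<open>N\<close>; once it is removed, the rest can
  be divided by \<open>N\<close>.\<close>

lemma base_digits_unique:
  fixes f g :: "nat \<Rightarrow> nat"
  assumes "(\<Sum>k<n. f k * N ^ k) = (\<Sum>k<n. g k * N ^ k)"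
    and "\<And>k. f k < N" "\<And>k. g k < N" and "k < n"
  shows "f k = g k"
  using assms
proof (induction n arbitrary: f g k)
  case (Suc n)
  have split: "(\<Sum>k<Suc n. h k * N ^ k) = h 0 + N * (\<Sum>k<n. h (Suc k) * N ^ k)" for h :: "nat \<Rightarrow> nat"
    by (subst sum.lessThan_Suc_shift) (simp add: sum_distrib_left ac_simps)
  have eq: "f 0 + N * (\<Sum>k<n. f (Suc k) * N ^ k) = g 0 + N * (\<Sum>k<n. g (Suc k) * N ^ k)"
    using Suc.prems(1) by (simp only: split)
  have "f 0 = (f 0 + N * (\<Sum>k<n. f (Suc k) * N ^ k)) mod N"
    using Suc.prems(2)[of 0] by simp
  also have "\<dots> = g 0"
    unfolding eq using Suc.prems(3)[of 0] by simp
  finally have 0: "f 0 = g 0" .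
  have "N > 0" using Suc.prems(2)[of 0] by simp
  then have "(\<Sum>k<n. f (Suc k) * N ^ k) = (\<Sum>k<n. g (Suc k) * N ^ k)"
    using eq 0 by simp
  then have "f (Suc j) = g (Suc j)" if "j < n" for j
    using Suc.IH[of "\<lambda>k. f (Suc k)" "\<lambda>k. g (Suc k)" j] Suc.prems(2,3) that by blast
  with 0 Suc.prems(4) show ?case by (cases k) auto
qed simp

text \<open>Kronecker substitution: for \<open>N\<close> above all exponents, \<open>x\<^sub>i = z ^ N ^ i\<close> sends distinct monomials to
  distinct powers of \<open>z\<close>.\<close>

lemma cpoly_eq_zero:
  fixes F :: "('n::finite) cpoly"
  assumes zero: "\<And>x. cpoly_eval F x = 0"
  shows "F = 0"
proof -
  let ?c = "CARD('n)"
  obtain e :: "'n \<Rightarrow> nat" where e: "bij_betw e UNIV {0..<?c}"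
    using ex_bij_betw_finite_nat[of "UNIV :: 'n set"] by auto
  \<comment> \<open>A crude bound: one more than the sum of all exponents in \<open>F\<close>, hence
    above each of them.\<close>
  define N where "N = Suc (\<Sum>m\<in>Poly_Mapping.keys F. \<Sum>i\<in>UNIV. Poly_Mapping.lookup m i)"
  have N: "Poly_Mapping.lookup m i < N" if "m \<in> Poly_Mapping.keys F" for m i
  proof -
    have "Poly_Mapping.lookup m i \<le> (\<Sum>i\<in>UNIV. Poly_Mapping.lookup m i)"
      by (rule member_le_sum) auto
    also have "\<dots> \<le> (\<Sum>m\<in>Poly_Mapping.keys F. \<Sum>i\<in>UNIV. Poly_Mapping.lookup m i)"
      using that by (intro member_le_sum[of m]) auto
    finally show ?thesis by (simp add: N_def)
  qed
  define K where "K m = (\<Sum>i\<in>UNIV. Poly_Mapping.lookup m i * N ^ e i)" for m :: "'n \<Rightarrow>\<^sub>0 nat"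
  have K_alt: "K m = (\<Sum>k<?c. Poly_Mapping.lookup m (inv_into UNIV e k) * N ^ k)" for m
  proof -
    have "K m = (\<Sum>i\<in>UNIV. Poly_Mapping.lookup m (inv_into UNIV e (e i)) * N ^ e i)"
      unfolding K_def using e by (simp add: bij_betw_def inv_into_f_f)
    also have "\<dots> = (\<Sum>k\<in>{0..<?c}. Poly_Mapping.lookup m (inv_into UNIV e k) * N ^ k)"
      using sum.reindex_bij_betw[OF e, of "\<lambda>k. Poly_Mapping.lookup m (inv_into UNIV e k) * N ^ k"] .
    finally show ?thesis by (simp add: atLeast0LessThan)
  qed
  have inj: "m = m'" if "m \<in> Poly_Mapping.keys F" "m' \<in> Poly_Mapping.keys F" "K m = K m'" for m m'
  proof (rule poly_mapping_eqI)
    fix i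
    have "e i < ?c" using e by (auto simp: bij_betw_def)
    then have "Poly_Mapping.lookup m (inv_into UNIV e (e i))
        = Poly_Mapping.lookup m' (inv_into UNIV e (e i))"
      by (intro base_digits_unique[OF that(3)[unfolded K_alt]] N that)
    then show "Poly_Mapping.lookup m i = Poly_Mapping.lookup m' i"
      using e by (simp add: bij_betw_def inv_into_f_f)
  qed
  define p where "p = (\<Sum>m\<in>Poly_Mapping.keys F. monom (Poly_Mapping.lookup F m) (K m))"
  have "poly p z = 0" for z
  proof -
    have "poly p z = cpoly_eval F (\<chi> i. z ^ N ^ e i)"
      unfolding p_def cpoly_eval_def K_def
      by (simp add: poly_sum poly_monom power_sum power_mult[symmetric] mult.commute)
    then show ?thesis using zero by simp
  qed
  then have p0: "p = 0" by (simp add: poly_all_0_iff_0[symmetric])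
  have "Poly_Mapping.lookup F m = 0" if m: "m \<in> Poly_Mapping.keys F" for m
  proof -
    have "0 = (\<Sum>n\<in>Poly_Mapping.keys F. if K n = K m then Poly_Mapping.lookup F n else 0)"
      using arg_cong[OF p0, of "\<lambda>q. coeff q (K m)"] by (simp add: p_def coeff_sum)
    also have "\<dots> = (\<Sum>n\<in>Poly_Mapping.keys F. if n = m then Poly_Mapping.lookup F n else 0)"
      by (rule sum.cong) (use inj m in auto)
    also have "\<dots> = Poly_Mapping.lookup F m"
      using m by simp
    finally show ?thesis by simp
  qed
  then show ?thesis
    by (metis in_keys_iff lookup_zero poly_mapping_eqI)
qed

lemma cpoly_eqI:
  assumes "\<And>x. cpoly_eval F x = cpoly_eval G x"
  shows "F = G"
  using cpoly_eq_zero[of "F - G"] assms by (simp add: cpoly_eval_diff)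

lemma cpoly_dvd_one_eval:
  assumes "H dvd 1"
  shows "cpoly_eval H x \<noteq> 0"
proof
  obtain K where "1 = H * K" using assms by (elim dvdE)
  then have "1 = cpoly_eval H x * cpoly_eval K x" by (metis cpoly_eval_mult cpoly_eval_one)
  moreover assume "cpoly_eval H x = 0"
  ultimately show False by simp
qed

section \<open>Homogeneous polynomials of degree one and two as linear and quadratic forms\<close>

lemma mon_eval_scale:
  "mon_eval m (c *s x) = c ^ (\<Sum>i\<in>UNIV. Poly_Mapping.lookup m i) * mon_eval m x"
  by (simp add: mon_eval_def power_mult_distrib prod.distrib power_sum)

lemma homogeneous_eval_scale:
  assumes "homogeneous d F"
  shows "cpoly_eval F (c *s x) = c ^ d * cpoly_eval F x"
  using assms
  unfolding cpoly_eval_superset[OF finite_keys subset_refl] sum_distrib_left homogeneous_def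
  by (intro sum.cong) (auto simp: mon_eval_scale)

lemma homogeneous_add:
  assumes "homogeneous d F" "homogeneous d G"
  shows "homogeneous d (F + G)"
  using assms Poly_Mapping.keys_add[of F G] unfolding homogeneous_def by blast

lemma homogeneous_sum:
  assumes "\<And>a. a \<in> A \<Longrightarrow> homogeneous d (F a)"
  shows "homogeneous d (\<Sum>a\<in>A. F a)"
  using assms
  by (induction A rule: infinite_finite_induct)
     (auto intro: homogeneous_add simp: homogeneous_def[of _ 0])

lemma homogeneous_const_mult:
  assumes "homogeneous d F"
  shows "homogeneous d (Poly_Mapping.single 0 c * F)"
  unfolding homogeneous_def
proof
  fix m assume "m \<in> Poly_Mapping.keys (Poly_Mapping.single 0 c * F)"
  then have "m \<in> Poly_Mapping.keys F"
    using keys_mult[of "Poly_Mapping.single 0 c" F] by (auto split: if_splits)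
  then show "(\<Sum>i\<in>UNIV. Poly_Mapping.lookup m i) = d"
    using assms by (auto simp: homogeneous_def)
qed

lemma homogeneous_single:
  assumes "(\<Sum>i\<in>UNIV. Poly_Mapping.lookup m i) = d"
  shows "homogeneous d (Poly_Mapping.single m c)"
  using assms by (auto simp: homogeneous_def split: if_splits)

definition dot :: "complex ^ 'n \<Rightarrow> complex ^ ('n::finite) \<Rightarrow> complex" where
  "dot h x = (\<Sum>i\<in>UNIV. h $ i * x $ i)"

definition linear_poly :: "complex ^ ('n::finite) \<Rightarrow> 'n cpoly" where
  "linear_poly h = (\<Sum>i\<in>UNIV. Poly_Mapping.single (Poly_Mapping.single i 1) (h $ i))"

lemma sum_lookup_single: "(\<Sum>i\<in>UNIV. Poly_Mapping.lookup (Poly_Mapping.single (j::'n::finite) (n::nat)) i) = n"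
  by (simp add: lookup_single when_def)

lemma mon_eval_single: "mon_eval (Poly_Mapping.single i 1) x = x $ i"
proof -
  have "mon_eval (Poly_Mapping.single i 1) x = (\<Prod>j\<in>UNIV. if j = i then x $ i else 1)"
    unfolding mon_eval_def by (rule prod.cong) (auto simp: lookup_single when_def)
  then show ?thesis by simp
qed

lemma cpoly_eval_linear_poly [simp]: "cpoly_eval (linear_poly h) x = dot h x"
  by (simp add: linear_poly_def dot_def cpoly_eval_sum cpoly_eval_single mon_eval_single del: One_nat_def)

lemma homogeneous_linear_poly: "homogeneous 1 (linear_poly h)"
  unfolding linear_poly_def
  by (intro homogeneous_sum homogeneous_single) (rule sum_lookup_single)

text \<open>Splits one variable off a monomial. One or two applications show that monomials of
  degree one are coordinates and those of degree two are products of two coordinates.\<close>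

lemma exponent_degree_Suc:
  fixes m :: "('n::finite) \<Rightarrow>\<^sub>0 nat"
  assumes "(\<Sum>i\<in>UNIV. Poly_Mapping.lookup m i) = Suc d"
  obtains i n where "m = Poly_Mapping.single i 1 + n" "(\<Sum>i\<in>UNIV. Poly_Mapping.lookup n i) = d"
proof -
  have "\<exists>i. Poly_Mapping.lookup m i \<noteq> 0"
    using assms by (metis sum.neutral nat.distinct(1))
  then obtain i where i: "Poly_Mapping.lookup m i \<noteq> 0" by blast
  define n where "n = m - Poly_Mapping.single i 1"
  have m: "m = Poly_Mapping.single i 1 + n"
  proof (rule poly_mapping_eqI)
    fix k
    show "Poly_Mapping.lookup m k = Poly_Mapping.lookup (Poly_Mapping.single i 1 + n) k"
      using i by (cases "k = i") (simp_all add: n_def lookup_add lookup_minus lookup_single)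
  qed
  have "Suc d = 1 + (\<Sum>i\<in>UNIV. Poly_Mapping.lookup n i)"
    using assms unfolding m by (simp add: lookup_add sum.distrib sum_lookup_single del: One_nat_def)
  then show ?thesis using that m by simp
qed

lemma mon_eval_degree_0:
  fixes m :: "('n::finite) \<Rightarrow>\<^sub>0 nat"
  assumes "(\<Sum>i\<in>UNIV. Poly_Mapping.lookup m i) = 0"
  shows "mon_eval m x = 1"
  using assms by (simp add: mon_eval_def)

lemma homogeneous_1_eval:
  fixes F :: "('n::finite) cpoly"
  assumes "homogeneous 1 F"
  obtains h where "\<And>x. cpoly_eval F x = dot h x"
proof -
  have "\<exists>i. \<forall>x. mon_eval m x = x $ i" if m: "m \<in> Poly_Mapping.keys F" for m
  proof -
    have "(\<Sum>i\<in>UNIV. Poly_Mapping.lookup m i) = Suc 0"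
      using assms m by (auto simp: homogeneous_def)
    then obtain i n where "m = Poly_Mapping.single i 1 + n" "(\<Sum>i\<in>UNIV. Poly_Mapping.lookup n i) = 0"
      by (rule exponent_degree_Suc)
    then show ?thesis
      by (intro exI[of _ i]) (simp add: mon_eval_add mon_eval_single mon_eval_degree_0 del: One_nat_def)
  qed
  then obtain i where i: "\<And>m x. m \<in> Poly_Mapping.keys F \<Longrightarrow> mon_eval m x = x $ i m" by metis
  define h :: "complex ^ 'n" where
    "h = (\<chi> k. \<Sum>m\<in>Poly_Mapping.keys F. if i m = k then Poly_Mapping.lookup F m else 0)"
  have "cpoly_eval F x = dot h x" for x
  proof -
    have "dot h x = (\<Sum>k\<in>UNIV. \<Sum>m\<in>Poly_Mapping.keys F.
                       if i m = k then Poly_Mapping.lookup F m * x $ i m else 0)"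
      unfolding dot_def h_def by (auto simp: sum_distrib_right intro!: sum.cong)
    also have "\<dots> = (\<Sum>m\<in>Poly_Mapping.keys F. Poly_Mapping.lookup F m * x $ i m)"
      by (subst sum.swap) simp
    also have "\<dots> = cpoly_eval F x"
      unfolding cpoly_eval_superset[OF finite_keys subset_refl] by (simp add: i)
    finally show ?thesis by simp
  qed
  then show ?thesis using that by blast
qed

text \<open>Without symmetry, \<open>b\<close> can be read off a polynomial by ordering the two
  variables of each monomial.\<close>

definition bilinear_form :: "(complex ^ 'n \<Rightarrow> complex ^ 'n \<Rightarrow> complex) \<Rightarrow> bool" where
  "bilinear_form b \<longleftrightarrow>
     (\<forall>x y z. b (x + y) z = b x z + b y z) \<and> (\<forall>x y z. b x (y + z) = b x y + b x z) \<and>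
     (\<forall>c x y. b (c *s x) y = c * b x y) \<and> (\<forall>c x y. b x (c *s y) = c * b x y)"

definition quadratic_form :: "(complex ^ 'n \<Rightarrow> complex) \<Rightarrow> bool" where
  "quadratic_form q \<longleftrightarrow> (\<exists>b. bilinear_form b \<and> (\<forall>x. q x = b x x))"

lemma homogeneous_2_eval:
  fixes F :: "('n::finite) cpoly"
  assumes "homogeneous 2 F"
  shows "quadratic_form (cpoly_eval F)"
proof -
  have "\<exists>i j. \<forall>x. mon_eval m x = x $ i * x $ j" if m: "m \<in> Poly_Mapping.keys F" for m
  proof -
    have "(\<Sum>i\<in>UNIV. Poly_Mapping.lookup m i) = Suc (Suc 0)"
      using assms m by (auto simp: homogeneous_def)
    then obtain i n where m: "m = Poly_Mapping.single i 1 + n"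
      and "(\<Sum>i\<in>UNIV. Poly_Mapping.lookup n i) = Suc 0"
      by (rule exponent_degree_Suc)
    from this(2) obtain j n'
      where "n = Poly_Mapping.single j 1 + n'" "(\<Sum>i\<in>UNIV. Poly_Mapping.lookup n' i) = 0"
      by (rule exponent_degree_Suc)
    then show ?thesis
      by (intro exI[of _ i] exI[of _ j])
         (simp add: m mon_eval_add mon_eval_single mon_eval_degree_0 del: One_nat_def)
  qed
  then obtain i j where ij: "\<And>m x. m \<in> Poly_Mapping.keys F \<Longrightarrow> mon_eval m x = x $ i m * x $ j m"
    by metis
  define b where "b x y = (\<Sum>m\<in>Poly_Mapping.keys F. Poly_Mapping.lookup F m * (x $ i m * y $ j m))"
    for x y :: "complex ^ 'n"
  have "bilinear_form b"
    by (auto simp: bilinear_form_def b_def algebra_simps sum.distrib sum_distrib_left)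
  moreover have "cpoly_eval F x = b x x" for x
    unfolding cpoly_eval_superset[OF finite_keys subset_refl] b_def by (simp add: ij)
  ultimately show ?thesis unfolding quadratic_form_def by blast
qed

section \<open>Linear algebra and projective points\<close>

lemma dot_add_right: "dot h (x + y) = dot h x + dot h y"
  by (simp add: dot_def algebra_simps sum.distrib)

lemma dot_scale_right: "dot h (c *s x) = c * dot h x"
  by (simp add: dot_def algebra_simps sum_distrib_left)

lemma dot_zero_right [simp]: "dot h 0 = 0"
  by (simp add: dot_def)

lemma dot_zero_left [simp]: "dot 0 x = 0"
  by (simp add: dot_def)

lemma dot_diff_right: "dot h (x - y) = dot h x - dot h y"
  by (simp add: dot_def algebra_simps sum_subtractf)

lemma dot_minus_right: "dot h (- x) = - dot h x"
  by (simp add: dot_def sum_negf)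

lemma dot_minus_left: "dot (- h) x = - dot h x"
  by (simp add: dot_def sum_negf)

lemma dot_scale_left: "dot (c *s h) x = c * dot h x"
  by (simp add: dot_def algebra_simps sum_distrib_left)

lemma dot_add_left: "dot (h + k) x = dot h x + dot k x"
  by (simp add: dot_def algebra_simps sum.distrib)

lemmas dot_simps = dot_add_right dot_scale_right dot_diff_right dot_minus_right
  dot_scale_left dot_add_left dot_minus_left

lemma dot_axis: "dot h (axis i 1) = h $ i"
proof -
  have "dot h (axis i 1) = (\<Sum>j\<in>UNIV. if j = i then h $ j else 0)"
    unfolding dot_def by (rule sum.cong) (auto simp: axis_def)
  then show ?thesis by simp
qed

lemma dot_eq_zero:
  assumes "\<And>x. dot h x = 0"
  shows "h = 0"
  using assms by (metis dot_axis vec_eq_iff zero_index)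

definition linear_map :: "(complex ^ 'n \<Rightarrow> complex ^ 'm) \<Rightarrow> bool" where
  "linear_map f \<longleftrightarrow> (\<forall>x y. f (x + y) = f x + f y) \<and> (\<forall>c x. f (c *s x) = c *s f x)"

lemma linear_functional_eq_dot:
  fixes g :: "complex ^ ('n::finite) \<Rightarrow> complex"
  assumes add: "\<And>x y. g (x + y) = g x + g y" and scale: "\<And>c x. g (c *s x) = c * g x"
  obtains h where "\<And>x. g x = dot h x"
proof -
  have g0: "g 0 = 0" using scale[of 0 0] by simp
  have sum: "g (\<Sum>i\<in>A. f i) = (\<Sum>i\<in>A. g (f i))" for f :: "'n \<Rightarrow> complex ^ 'n" and A
    by (induction A rule: infinite_finite_induct) (auto simp: add g0)
  have "g x = dot (\<chi> i. g (axis i 1)) x" for x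
  proof -
    have "g x = g (\<Sum>i\<in>UNIV. x $ i *s axis i 1)" by (simp only: basis_expansion)
    then show ?thesis by (simp add: sum scale dot_def mult.commute)
  qed
  then show ?thesis using that by blast
qed

lemma linear_map_dot:
  fixes f :: "complex ^ ('n::finite) \<Rightarrow> complex ^ ('m::finite)"
  assumes "linear_map f"
  obtains k where "\<And>x. dot h (f x) = dot k x"
  by (rule linear_functional_eq_dot[of "\<lambda>x. dot h (f x)"])
     (use assms in \<open>auto simp: linear_map_def dot_simps\<close>)

text \<open>Stated for four vectors in order and not for a set, so that a repeated vector counts as
  dependent and coefficients can be compared one by one.\<close>

definition indep4 :: "complex ^ 4 \<Rightarrow> complex ^ 4 \<Rightarrow> complex ^ 4 \<Rightarrow> complex ^ 4 \<Rightarrow> bool" where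
  "indep4 a b c d \<longleftrightarrow>
     (\<forall>x y z w. x *s a + y *s b + z *s c + w *s d = 0 \<longrightarrow> x = 0 \<and> y = 0 \<and> z = 0 \<and> w = 0)"

text \<open>The columns follow the order of \<open>sum_4\<close>, in which the index
  \<open>4\<close> is the element \<open>0\<close> of the type; it falls under the last
  branch.\<close>

definition columns4 :: "complex ^ 4 \<Rightarrow> complex ^ 4 \<Rightarrow> complex ^ 4 \<Rightarrow> complex ^ 4 \<Rightarrow> complex ^ 4 ^ 4" where
  "columns4 a b c d = (\<chi> i j. (if j = 1 then a else if j = 2 then b else if j = 3 then c else d) $ i)"

lemma columns4_mult: "columns4 a b c d *v x = x $ 1 *s a + x $ 2 *s b + x $ 3 *s c + x $ 4 *s d"
  by (simp add: columns4_def matrix_vector_mult_def vec_eq_iff sum_4 mult.commute)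

lemma vector_columns4_mult:
  "h v* columns4 a b c d = 0 \<longleftrightarrow> dot h a = 0 \<and> dot h b = 0 \<and> dot h c = 0 \<and> dot h d = 0"
proof -
  have "(h v* M) $ j = dot h (column j M)" for M :: "complex ^ 4 ^ 4" and j
    by (simp add: column_def vector_matrix_mult_def dot_def mult.commute)
  moreover have "column 1 (columns4 a b c d) = a" "column 2 (columns4 a b c d) = b"
    "column 3 (columns4 a b c d) = c" "column 4 (columns4 a b c d) = d"
    by (simp_all add: columns4_def column_def vec_eq_iff)
  ultimately show ?thesis by (simp add: vec_eq_iff[of "h v* columns4 a b c d"] forall_4)
qed

lemma indep4_iff_invertible: "indep4 a b c d \<longleftrightarrow> invertible (columns4 a b c d)"
proof -
  have "indep4 a b c d \<longleftrightarrow> (\<forall>x. columns4 a b c d *v x = 0 \<longrightarrow> x = 0)"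
  proof
    assume "indep4 a b c d"
    then have "columns4 a b c d *v x = 0 \<Longrightarrow> x $ 1 = 0 \<and> x $ 2 = 0 \<and> x $ 3 = 0 \<and> x $ 4 = 0" for x
      unfolding indep4_def columns4_mult by blast
    then show "\<forall>x. columns4 a b c d *v x = 0 \<longrightarrow> x = 0"
      by (metis exhaust_4 vec_eq_iff zero_index)
  next
    assume *: "\<forall>x. columns4 a b c d *v x = 0 \<longrightarrow> x = 0"
    show "indep4 a b c d" unfolding indep4_def
    proof (intro allI impI)
      fix x y z w assume "x *s a + y *s b + z *s c + w *s d = 0"
      then have "columns4 a b c d *v (\<chi> i. if i = 1 then x else if i = 2 then y else if i = 3 then z else w) = 0"
        by (simp add: columns4_mult)
      then have "(\<chi> i. if i = 1 then x else if i = 2 then y else if i = 3 then z else w) = (0 :: complex ^ 4)"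
        using * by blast
      then show "x = 0 \<and> y = 0 \<and> z = 0 \<and> w = 0"
        by (simp add: vec_eq_iff forall_4)
    qed
  qed
  then show ?thesis by (simp add: invertible_left_inverse matrix_left_invertible_ker)
qed

text \<open>A singular matrix also has a left kernel. The vector \<open>h\<close> is the equation of
  a plane through the four points.\<close>

lemma not_indep4_annihilator:
  assumes "\<not> indep4 a b c d"
  obtains h where "h \<noteq> 0" "dot h a = 0" "dot h b = 0" "dot h c = 0" "dot h d = 0"
proof -
  have "\<not> invertible (transpose (columns4 a b c d))"
    using assms
    by (metis indep4_iff_invertible invertible_left_inverse invertible_right_inverse left_invertible_transpose)
  then obtain h where "h v* columns4 a b c d = 0" "h \<noteq> 0"
    by (auto simp: invertible_left_inverse matrix_left_invertible_ker)
  then show ?thesis using that by (auto simp: vector_columns4_mult)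
qed

lemma indep4_coordinates:
  assumes "indep4 a b c d"
  obtains ha hb hc hd where "\<And>v. v = dot ha v *s a + dot hb v *s b + dot hc v *s c + dot hd v *s d"
proof -
  obtain B where "columns4 a b c d ** B = mat 1"
    using assms by (auto simp: indep4_iff_invertible invertible_right_inverse)
  then have "v = columns4 a b c d *v (B *v v)" for v
    by (metis matrix_vector_mul_assoc matrix_vector_mul_lid)
  then have "v = dot (B $ 1) v *s a + dot (B $ 2) v *s b + dot (B $ 3) v *s c + dot (B $ 4) v *s d" for v
    unfolding columns4_mult by (simp add: matrix_vector_mult_def dot_def)
  then show ?thesis using that by blast
qed

lemma indep4_eqD:
  assumes "indep4 a b c d"
    and "x *s a + y *s b + z *s c + w *s d = x' *s a + y' *s b + z' *s c + w' *s d"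
  shows "x = x' \<and> y = y' \<and> z = z' \<and> w = w'"
proof -
  have "(x - x') *s a + (y - y') *s b + (z - z') *s c + (w - w') *s d
     = (x *s a + y *s b + z *s c + w *s d) - (x' *s a + y' *s b + z' *s c + w' *s d)"
    by (simp add: vec_eq_iff algebra_simps)
  also have "\<dots> = 0" using assms(2) by simp
  finally have "x - x' = 0 \<and> y - y' = 0 \<and> z - z' = 0 \<and> w - w' = 0"
    using assms(1) unfolding indep4_def by blast
  then show ?thesis by simp
qed

lemma indep4_span:
  assumes "indep4 a b c d"
  obtains x y z w where "v = x *s a + y *s b + z *s c + w *s d"
  using indep4_coordinates[OF assms] by metis

lemma indep4_dual:
  assumes "indep4 a b c d"
  obtains h where "dot h a = x" "dot h b = y" "dot h c = z" "dot h d = w"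
proof -
  obtain ha hb hc hd where h: "\<And>v. v = dot ha v *s a + dot hb v *s b + dot hc v *s c + dot hd v *s d"
    using assms by (rule indep4_coordinates) blast
  have "dot ha a = 1 \<and> dot hb a = 0 \<and> dot hc a = 0 \<and> dot hd a = 0"
    using indep4_eqD[OF assms, of "dot ha a" "dot hb a" "dot hc a" "dot hd a" 1 0 0 0] h[of a] by simp
  moreover have "dot ha b = 0 \<and> dot hb b = 1 \<and> dot hc b = 0 \<and> dot hd b = 0"
    using indep4_eqD[OF assms, of "dot ha b" "dot hb b" "dot hc b" "dot hd b" 0 1 0 0] h[of b] by simp
  moreover have "dot ha c = 0 \<and> dot hb c = 0 \<and> dot hc c = 1 \<and> dot hd c = 0"
    using indep4_eqD[OF assms, of "dot ha c" "dot hb c" "dot hc c" "dot hd c" 0 0 1 0] h[of c] by simp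
  moreover have "dot ha d = 0 \<and> dot hb d = 0 \<and> dot hc d = 0 \<and> dot hd d = 1"
    using indep4_eqD[OF assms, of "dot ha d" "dot hb d" "dot hc d" "dot hd d" 0 0 0 1] h[of d] by simp
  ultimately show ?thesis
    by (intro that[of "x *s ha + y *s hb + z *s hc + w *s hd"]) (simp_all add: dot_simps)
qed

lemma indep4_annihilator:
  assumes "indep4 a b c d" "dot h a = 0" "dot h b = 0" "dot h c = 0" "dot h d = 0"
  shows "h = 0"
proof (rule dot_eq_zero)
  fix v
  obtain x y z w where "v = x *s a + y *s b + z *s c + w *s d"
    using assms(1) by (rule indep4_span)
  then show "dot h v = 0" using assms by (simp add: dot_simps)
qed

lemma indep4_scale:
  assumes "indep4 (\<alpha> *s a) (\<beta> *s b) (\<gamma> *s c) (\<delta> *s d)"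
  shows "\<alpha> \<noteq> 0" "\<beta> \<noteq> 0" "\<gamma> \<noteq> 0" "\<delta> \<noteq> 0" "indep4 a b c d"
proof -
  have *: "x *s (\<alpha> *s a) + y *s (\<beta> *s b) + z *s (\<gamma> *s c) + w *s (\<delta> *s d) = 0 \<Longrightarrow>
      x = 0 \<and> y = 0 \<and> z = 0 \<and> w = 0" for x y z w
    using assms unfolding indep4_def by blast
  show nz: "\<alpha> \<noteq> 0" "\<beta> \<noteq> 0" "\<gamma> \<noteq> 0" "\<delta> \<noteq> 0"
    using *[of 1 0 0 0] *[of 0 1 0 0] *[of 0 0 1 0] *[of 0 0 0 1] by auto
  show "indep4 a b c d"
    unfolding indep4_def
  proof (intro allI impI)
    fix x y z w assume "x *s a + y *s b + z *s c + w *s d = 0"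
    then show "x = 0 \<and> y = 0 \<and> z = 0 \<and> w = 0"
      using *[of "x / \<alpha>" "y / \<beta>" "z / \<gamma>" "w / \<delta>"] nz by (simp add: vector_smult_assoc)
  qed
qed

lemma indep4_scaleI:
  assumes "indep4 a b c d" "\<alpha> \<noteq> 0" "\<beta> \<noteq> 0" "\<gamma> \<noteq> 0" "\<delta> \<noteq> 0"
  shows "indep4 (\<alpha> *s a) (\<beta> *s b) (\<gamma> *s c) (\<delta> *s d)"
  using assms unfolding indep4_def vector_smult_assoc by (metis mult_eq_0_iff)

lemma dim_3_not_indep4:
  assumes "vec.subspace V" "vec.dim V = 3" "a \<in> V" "b \<in> V" "c \<in> V" "d \<in> V"
  shows "\<not> indep4 a b c d"
proof
  assume "indep4 a b c d"
  have "v \<in> V" for v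
  proof -
    obtain x y z w where "v = x *s a + y *s b + z *s c + w *s d"
      using \<open>indep4 a b c d\<close> by (rule indep4_span)
    then show ?thesis
      using assms by (simp add: vec.subspace_add vec.subspace_scale)
  qed
  then have "V = UNIV" by blast
  then show False using assms(2) by (simp add: vec.dim_UNIV card_cart_basis)
qed

lemma dim_2_span:
  assumes "vec.subspace L" "vec.dim L = 2" "a \<in> L" "b \<in> L"
    and indep: "\<And>x y. x *s a + y *s b = 0 \<Longrightarrow> x = 0 \<and> y = 0" and "v \<in> L"
  obtains x y where "v = x *s a + y *s b"
proof -
  have "a \<noteq> 0" using indep[of 1 0] by auto
  have "b \<noteq> k *s a" for k using indep[of k "-1"] by auto
  then have "b \<notin> vec.span {a}" by (auto simp: vec.span_singleton)
  moreover have "vec.independent {a}" using \<open>a \<noteq> 0\<close> by simp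
  ultimately have "vec.independent {b, a}" by (simp add: vec.independent_insert)
  moreover have "b \<noteq> a" using \<open>b \<noteq> 1 *s a\<close> by simp
  ultimately have "L \<subseteq> vec.span {b, a}"
    by (intro vec.card_ge_dim_independent) (use assms in auto)
  then have "v \<in> vec.span {b, a}" using \<open>v \<in> L\<close> by blast
  then obtain k l where "v - k *s b - l *s a = 0"
    by (auto simp: vec.span_breakdown_eq)
  then have "v = l *s a + k *s b" by (simp add: algebra_simps)
  then show ?thesis using that by blast
qed

text \<open>For a cone \<open>V\<close> membership does not depend on the representative; this
  covers linear subspaces and zero sets of homogeneous polynomials alike.\<close>

lemma pt_in_projectivize:
  assumes "\<And>c v. v \<in> V \<Longrightarrow> c *s v \<in> V" "x \<noteq> 0"
  shows "pt x \<in> projectivize V \<longleftrightarrow> x \<in> V"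
proof
  assume "pt x \<in> projectivize V"
  then obtain y where "pt y = pt x" "y \<in> V" "y \<noteq> 0" unfolding projectivize_def by auto
  then show "x \<in> V" using pt_eq_iff assms by metis
qed (use assms in \<open>auto simp: projectivize_def\<close>)

lemma pt_in_subspace:
  assumes "vec.subspace V" "x \<noteq> 0"
  shows "pt x \<in> projectivize V \<longleftrightarrow> x \<in> V"
  using assms by (intro pt_in_projectivize) (auto intro: vec.subspace_scale)

lemma pt_in_zeros:
  assumes "homogeneous d F" "x \<noteq> 0"
  shows "pt x \<in> zeros F \<longleftrightarrow> cpoly_eval F x = 0"
  unfolding zeros_def using assms
  by (subst pt_in_projectivize) (auto simp: homogeneous_eval_scale)

lemma pt_in_plane_of:
  assumes "x \<noteq> 0"
  shows "pt x \<in> plane_of a \<longleftrightarrow> dot (cvec a) x = 0"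
proof -
  have "plane_of a = projectivize {x. dot (cvec a) x = 0}" by (simp add: plane_of_def dot_def)
  then show ?thesis using assms by (simp only:, subst pt_in_projectivize) (auto simp: dot_simps)
qed

lemma zariski_closure_superset: "S \<subseteq> zariski_closure S"
  by (auto simp: zariski_closure_def)

lemma zariski_closure_subset_zeros:
  assumes "homogeneous d F" "S \<subseteq> zeros F"
  shows "zariski_closure S \<subseteq> zeros F"
  using assms by (auto simp: zariski_closure_def)

section \<open>Common factors and quadratic forms\<close>

text \<open>Takes the place of Zariski density: an identity known where certain quantities are
  nonzero is restricted to a line through one good point, where it concerns polynomials in one
  variable.\<close>

definition polyfun :: "(complex \<Rightarrow> complex) \<Rightarrow> bool" where
  "polyfun g \<longleftrightarrow> (\<exists>p. \<forall>z. g z = poly p z)"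

named_theorems polyfun_intros

lemma polyfun_const [polyfun_intros]: "polyfun (\<lambda>z. c)"
  unfolding polyfun_def by (rule exI[of _ "[:c:]"]) simp

lemma polyfun_id [polyfun_intros]: "polyfun (\<lambda>z. z)"
  unfolding polyfun_def by (rule exI[of _ "[:0, 1:]"]) simp

lemma polyfun_add [polyfun_intros]: "polyfun f \<Longrightarrow> polyfun g \<Longrightarrow> polyfun (\<lambda>z. f z + g z)"
  unfolding polyfun_def by (metis poly_add)

lemma polyfun_diff [polyfun_intros]: "polyfun f \<Longrightarrow> polyfun g \<Longrightarrow> polyfun (\<lambda>z. f z - g z)"
  unfolding polyfun_def by (metis poly_diff)

lemma polyfun_mult [polyfun_intros]: "polyfun f \<Longrightarrow> polyfun g \<Longrightarrow> polyfun (\<lambda>z. f z * g z)"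
  unfolding polyfun_def by (metis poly_mult)

lemma polyfun_power [polyfun_intros]: "polyfun f \<Longrightarrow> polyfun (\<lambda>z. f z ^ n)"
  by (induction n) (auto intro: polyfun_intros)

lemma polyfun_sum [polyfun_intros]: "(\<And>a. a \<in> A \<Longrightarrow> polyfun (f a)) \<Longrightarrow> polyfun (\<lambda>z. \<Sum>a\<in>A. f a z)"
  by (induction A rule: infinite_finite_induct) (auto intro: polyfun_intros)

lemma polyfun_prod [polyfun_intros]: "(\<And>a. a \<in> A \<Longrightarrow> polyfun (f a)) \<Longrightarrow> polyfun (\<lambda>z. \<Prod>a\<in>A. f a z)"
  by (induction A rule: infinite_finite_induct) (auto intro: polyfun_intros)

lemma polyfun_cpoly_eval [polyfun_intros]:
  assumes "\<And>i. polyfun (\<lambda>z. x z $ i)"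
  shows "polyfun (\<lambda>z. cpoly_eval F (x z))"
  unfolding cpoly_eval_def by (intro polyfun_intros assms)

lemma polyfun_eq_zero:
  assumes "polyfun g" "polyfun f" "\<And>z. g z \<noteq> 0 \<Longrightarrow> f z = 0" "g z0 \<noteq> 0"
  shows "f z = 0"
proof -
  obtain p q where p: "\<And>z. g z = poly p z" and q: "\<And>z. f z = poly q z"
    using assms(1,2) unfolding polyfun_def by metis
  have "poly (p * q) z = 0" for z
    using assms(3)[of z] by (auto simp: p q)
  then have "p * q = 0" using poly_all_0_iff_0 by blast
  moreover have "p \<noteq> 0" using assms(4) p by auto
  ultimately show ?thesis by (simp add: q)
qed

lemma polyfun_constant:
  assumes "polyfun g" "\<And>z. g z \<noteq> 0"
  shows "g z = g z'"
proof -
  obtain p where p: "\<And>z. g z = poly p z" using assms(1) unfolding polyfun_def by metis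
  then have "constant (poly p)"
    using assms(2) fundamental_theorem_of_algebra[of p] by metis
  then show ?thesis unfolding constant_def p by blast
qed

text \<open>A common factor has no zero on a line avoiding the common zeros of the two forms, so it is
  constant along such lines.\<close>

lemma no_common_factor_linear:
  fixes h k :: "complex ^ ('n::finite)"
  assumes y0: "dot h y0 = 1" "dot k y0 = 0" and y1: "dot h y1 = 0" "dot k y1 = 1"
  shows "no_common_factor (linear_poly h) (linear_poly k)"
  unfolding no_common_factor_def
proof (intro allI impI)
  fix H assume "H dvd linear_poly h" "H dvd linear_poly k"
  then obtain K K' where K: "linear_poly h = H * K" "linear_poly k = H * K'" by (elim dvdE) blast
  have Hz: "dot h x = 0 \<and> dot k x = 0" if "cpoly_eval H x = 0" for x
    using that arg_cong[OF K(1), of "\<lambda>F. cpoly_eval F x"] arg_cong[OF K(2), of "\<lambda>F. cpoly_eval F x"]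
    by (simp add: cpoly_eval_mult)
  have line: "polyfun (\<lambda>z. cpoly_eval H (x + z *s y))" for x y :: "complex ^ 'n"
    by (intro polyfun_intros) (simp add: polyfun_intros)
  have eq: "cpoly_eval H x = cpoly_eval H y" if "dot h x * dot k y \<noteq> dot h y * dot k x" for x y
  proof -
    have "cpoly_eval H (x + z *s (y - x)) \<noteq> 0" for z
    proof
      assume "cpoly_eval H (x + z *s (y - x)) = 0"
      then have "(1 - z) * dot h x + z * dot h y = 0" "(1 - z) * dot k x + z * dot k y = 0"
        using Hz[of "x + z *s (y - x)"] by (simp_all add: dot_simps algebra_simps)
      \<comment> \<open>Cramer's rule: if the value pairs of the two forms at \<open>x\<close> and
        \<open>y\<close> are independent, the line has no common zero.\<close>
      then have "(1 - z) * (dot h x * dot k y - dot h y * dot k x) = 0"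
        "z * (dot h x * dot k y - dot h y * dot k x) = 0"
        by algebra+
      then show False using that by auto
    qed
    from polyfun_constant[OF line this, of 0 1] show ?thesis by simp
  qed
  let ?c = "cpoly_eval H y0"
  have c1: "cpoly_eval H y1 = ?c" using eq[of y1 y0] y0 y1 by simp
  have gen: "cpoly_eval H x = ?c" if "dot h x \<noteq> 0 \<or> dot k x \<noteq> 0" for x
    using that eq[of x y0] eq[of x y1] y0 y1 c1 by auto
  have "cpoly_eval H x = ?c" for x
  proof (cases "dot h x = 0 \<and> dot k x = 0")
    case True
    \<comment> \<open>The common zero \<open>x\<close> is left in the direction \<open>y0\<close>,
      along which the value of \<open>h\<close> is \<open>z\<close>.\<close>
    have "cpoly_eval H (x + z *s y0) - ?c = 0" if "z \<noteq> 0" for z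
      using gen[of "x + z *s y0"] True y0 that by (simp add: dot_simps)
    moreover have "polyfun (\<lambda>z. cpoly_eval H (x + z *s y0) - ?c)"
      by (intro polyfun_diff line polyfun_const)
    ultimately show ?thesis
      using polyfun_eq_zero[of "\<lambda>z. z" "\<lambda>z. cpoly_eval H (x + z *s y0) - ?c" 1 0]
      by (simp add: polyfun_id)
  qed (use gen in blast)
  then have H: "H = Poly_Mapping.single 0 ?c" by (intro cpoly_eqI) simp
  have "?c \<noteq> 0" using Hz[of y0] y0 by auto
  then have "H * Poly_Mapping.single 0 (1 / ?c) = 1"
    by (subst H) (simp add: mult_single)
  then show "H dvd 1" by (metis dvd_triv_left)
qed

text \<open>A common factor that is not a unit would be associated to both irreducible polynomials,
  and associated polynomials have the same zeros.\<close>

lemma no_common_factor_irreducible: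
  fixes F G :: "('n::finite) cpoly"
  assumes F: "irreducible F" and G: "irreducible G" and ne: "zeros F \<noteq> zeros G" and "a \<noteq> 0" "b \<noteq> 0"
  shows "no_common_factor (Poly_Mapping.single 0 a * F) (Poly_Mapping.single 0 b * G)"
  unfolding no_common_factor_def
proof (intro allI impI)
  have unscale: "H dvd F" if "H dvd Poly_Mapping.single 0 a * F" "a \<noteq> 0" for H F :: "'n cpoly" and a
  proof -
    have "Poly_Mapping.single 0 (1 / a) * (Poly_Mapping.single 0 a * F) = F"
      using that(2) by (simp add: mult.assoc[symmetric] mult_single)
    then show ?thesis using that(1) by (metis dvd_mult)
  qed
  fix H assume "H dvd Poly_Mapping.single 0 a * F" "H dvd Poly_Mapping.single 0 b * G"
  then have HF: "H dvd F" and HG: "H dvd G" using unscale assms(4,5) by blast+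
  show "H dvd 1"
  proof (rule ccontr)
    assume nu: "\<not> H dvd 1"
    obtain K where K: "F = H * K" using HF by (elim dvdE)
    have "K dvd 1" using F K nu by (auto simp: irreducible_def)
    then have "F dvd H"
      by (metis K dvdE dvd_def mult.assoc mult.comm_neutral)
    then have "F dvd G" using HG dvd_trans by blast
    then obtain U where U: "G = F * U" by (elim dvdE)
    have "\<not> F dvd 1" using F by (simp add: irreducible_def)
    then have "U dvd 1" using G U by (auto simp: irreducible_def)
    then have "cpoly_eval G x = 0 \<longleftrightarrow> cpoly_eval F x = 0" for x
      using cpoly_dvd_one_eval[of U x] by (simp add: U cpoly_eval_mult)
    then show False using ne by (simp add: zeros_def)
  qed
qed

lemma quadratic_form_line:
  assumes "bilinear_form b"
  shows "b (y + z *s x) (y + z *s x) = b y y + z * (b x y + b y x) + z\<^sup>2 * b x x"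
  using assms by (simp add: bilinear_form_def algebra_simps power2_eq_square)

text \<open>If \<open>q\<close> vanishes only where the linear form does, then on every line the two roots of \<open>q\<close>
  coincide, so \<open>q\<close> is a multiple of the squared linear form.\<close>

lemma irreducible_quadric_not_in_plane:
  fixes F :: "('n::finite) cpoly"
  assumes F: "homogeneous 2 F" "irreducible F" and h: "h \<noteq> 0"
    and zero: "\<And>x. cpoly_eval F x = 0 \<Longrightarrow> dot h x = 0"
  shows False
proof -
  obtain b where b: "bilinear_form b" and q: "\<And>x. cpoly_eval F x = b x x"
    using homogeneous_2_eval[OF F(1)] unfolding quadratic_form_def by blast
  obtain x' where "dot h x' \<noteq> 0" using h dot_eq_zero by blast
  define x where "x = (1 / dot h x') *s x'"
  have hx: "dot h x = 1" using \<open>dot h x' \<noteq> 0\<close> by (simp add: x_def dot_simps)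
  define c where "c = b x x"
  have c: "c \<noteq> 0" using zero[of x] hx by (auto simp: c_def q)
  have "cpoly_eval F y = c * (dot h y * dot h y)" for y
  proof -
    \<comment> \<open>On the line through \<open>y\<close> in direction \<open>x\<close> the form is
      \<open>b y y + 2 * \<beta> * z + c * z\<^sup>2\<close>, with roots
      \<open>(- \<beta> + r) / c\<close> and \<open>(- \<beta> - r) / c\<close>. As
      \<open>dot h x = 1\<close>, both roots equal \<open>- dot h y\<close>, so
      \<open>r = 0\<close>.\<close>
    define \<beta> where "\<beta> = (b x y + b y x) / 2"
    define r where "r = csqrt (\<beta>\<^sup>2 - b y y * c)"
    have r2: "r\<^sup>2 = \<beta>\<^sup>2 - b y y * c" by (simp add: r_def)
    have root: "dot h y + z = 0" if "z * c = - \<beta> + e * r" "e * e = 1" for z e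
    proof -
      have "c * cpoly_eval F (y + z *s x) = b y y * c + 2 * \<beta> * (z * c) + (z * c)\<^sup>2"
        by (simp add: q quadratic_form_line[OF b] \<beta>_def c_def algebra_simps power2_eq_square)
      also have "\<dots> = 0" using that(2) r2 unfolding that(1) by algebra
      finally have "cpoly_eval F (y + z *s x) = 0" using c by simp
      from zero[OF this] show ?thesis using hx by (simp add: dot_simps)
    qed
    have "dot h y + (- \<beta> + r) / c = 0" using c by (intro root[of _ 1]) auto
    moreover have "dot h y + (- \<beta> - r) / c = 0" using c by (intro root[of _ "-1"]) auto
    ultimately have "dot h y * c = \<beta> - r" "dot h y * c = \<beta> + r"
      using c by (simp_all add: field_simps add_eq_0_iff)
    then have "r = 0" "\<beta> = c * dot h y" by auto
    then have "c * b y y = c * (c * (dot h y * dot h y))" using r2 by algebra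
    then show ?thesis using c by (simp add: q)
  qed
  then have "F = (Poly_Mapping.single 0 c * linear_poly h) * linear_poly h"
    by (intro cpoly_eqI) (simp add: cpoly_eval_mult)
  then have "Poly_Mapping.single 0 c * linear_poly h dvd 1 \<or> linear_poly h dvd 1"
    using F(2) unfolding irreducible_def by blast
  then show False
    using cpoly_dvd_one_eval[of _ 0] by (fastforce simp: cpoly_eval_mult)
qed

text \<open>Parameters 0 and 1 successively kill the squares and the mixed terms along the four
  edges; the value at all ones leaves one relation between the two diagonal terms. The vectors may
  be dependent: the lemma is also applied to the four coplanar points of Sigma_i.\<close>

lemma quadratic_form_vanishing_on_bilinear_image:
  assumes q: "quadratic_form q"
    and zero: "\<And>s0 s1 u0 u1. q ((\<alpha> * s0 * u0) *s a + (\<beta> * s0 * u1) *s b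
                              + (\<gamma> * s1 * u0) *s c + (\<delta> * s1 * u1) *s d) = 0"
    and nz: "\<alpha> \<noteq> 0" "\<beta> \<noteq> 0" "\<gamma> \<noteq> 0" "\<delta> \<noteq> 0"
  obtains \<kappa> where "\<And>x y z w. q (x *s a + y *s b + z *s c + w *s d) = \<kappa> * (\<beta> * \<gamma> * x * w - \<alpha> * \<delta> * y * z)"
proof -
  obtain B where B: "bilinear_form B" and qB: "\<And>x. q x = B x x"
    using q unfolding quadratic_form_def by blast
  define P where "P x y = B x y + B y x" for x y
  have expand: "q (x *s a + y *s b + z *s c + w *s d)
      = x\<^sup>2 * q a + y\<^sup>2 * q b + z\<^sup>2 * q c + w\<^sup>2 * q d + x * y * P a b + x * z * P a c + x * w * P a d
        + y * z * P b c + y * w * P b d + z * w * P c d" for x y z w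
    using B by (simp add: bilinear_form_def qB P_def algebra_simps power2_eq_square)
  have z: "(\<alpha> * s0 * u0)\<^sup>2 * q a + (\<beta> * s0 * u1)\<^sup>2 * q b + (\<gamma> * s1 * u0)\<^sup>2 * q c + (\<delta> * s1 * u1)\<^sup>2 * q d
        + (\<alpha> * s0 * u0) * (\<beta> * s0 * u1) * P a b + (\<alpha> * s0 * u0) * (\<gamma> * s1 * u0) * P a c
        + (\<alpha> * s0 * u0) * (\<delta> * s1 * u1) * P a d + (\<beta> * s0 * u1) * (\<gamma> * s1 * u0) * P b c
        + (\<beta> * s0 * u1) * (\<delta> * s1 * u1) * P b d + (\<gamma> * s1 * u0) * (\<delta> * s1 * u1) * P c d = 0"
    for s0 s1 u0 u1
    using zero[of s0 u0 u1 s1] unfolding expand .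
  have "q a = 0" "q b = 0" "q c = 0" "q d = 0"
    using z[of 1 1 0 0] z[of 1 0 1 0] z[of 0 1 0 1] z[of 0 0 1 1] nz by auto
  note q0 = this
  have "P a b = 0" "P a c = 0" "P b d = 0" "P c d = 0"
    using z[of 1 1 1 0] z[of 1 1 0 1] z[of 1 0 1 1] z[of 0 1 1 1] nz by (auto simp: q0)
  note P0 = this
  have rel: "\<alpha> * \<delta> * P a d + \<beta> * \<gamma> * P b c = 0"
    using z[of 1 1 1 1] by (simp add: q0 P0)
  define \<kappa> where "\<kappa> = P a d / (\<beta> * \<gamma>)"
  have ad: "P a d = \<kappa> * \<beta> * \<gamma>" using nz by (simp add: \<kappa>_def)
  have bc: "P b c = - \<kappa> * \<alpha> * \<delta>"
  proof -
    have "\<beta> * \<gamma> * (P b c + \<kappa> * \<alpha> * \<delta>) = 0" using rel unfolding ad by algebra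
    then show ?thesis using nz by (simp add: add_eq_0_iff)
  qed
  show ?thesis
    by (rule that[of \<kappa>]) (unfold expand, simp add: q0 P0 ad bc algebra_simps)
qed

section \<open>Transversals of the boundary lines\<close>

lemma two_cases: "(i :: 2) = 0 \<or> i = 1"
  using exhaust_2[of i] by auto

lemma two_induct: "P 0 \<Longrightarrow> P 1 \<Longrightarrow> P (i :: 2)"
  using two_cases[of i] by auto

lemma all_two: "(\<forall>i :: 2. P i) \<longleftrightarrow> P 0 \<and> P 1"
  using two_cases by metis

lemma sum_two: "(\<Sum>i\<in>UNIV. f (i :: 2)) = f 0 + (f 1 :: 'a :: comm_monoid_add)"
proof -
  have UNIV: "(UNIV :: 2 set) = {0, 1}" using two_cases by blast
  show ?thesis unfolding UNIV by simp
qed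

lemma two_eq_zero [simp]: "(2 :: 2) = 0"
  by simp

lemma one_plus_one_two: "(1 :: 2) + 1 = 0"
  by simp

lemma opposite_zero:
  fixes f :: "2 \<Rightarrow> 'a :: monoid_add"
  assumes "f 0 + f 1 = 0" "f k = 0"
  shows "f k' = 0"
  using assms two_cases[of k] two_cases[of k'] by auto

lemma pt_scale:
  assumes "c *s x \<noteq> 0"
  shows "pt (c *s x) = pt x"
proof -
  have "x \<noteq> 0" using assms by auto
  then show ?thesis using pt_eq_iff[of x "c *s x"] assms by auto
qed

lemma indep4_linear_map:
  assumes "indep4 a b c d"
  obtains f where "linear_map f" "f a = a'" "f b = b'" "f c = c'" "f d = d'"
proof -
  obtain ha where ha: "dot ha a = 1" "dot ha b = 0" "dot ha c = 0" "dot ha d = 0"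
    using assms by (rule indep4_dual)
  obtain hb where hb: "dot hb a = 0" "dot hb b = 1" "dot hb c = 0" "dot hb d = 0"
    using assms by (rule indep4_dual)
  obtain hc where hc: "dot hc a = 0" "dot hc b = 0" "dot hc c = 1" "dot hc d = 0"
    using assms by (rule indep4_dual)
  obtain hd where hd: "dot hd a = 0" "dot hd b = 0" "dot hd c = 0" "dot hd d = 1"
    using assms by (rule indep4_dual)
  show ?thesis
    by (rule that[of "\<lambda>x. dot ha x *s a' + dot hb x *s b' + dot hc x *s c' + dot hd x *s d'"])
       (simp_all add: linear_map_def dot_simps ha hb hc hd vec_eq_iff algebra_simps)
qed

lemma linear_mapD:
  assumes "linear_map f"
  shows "f (x + y) = f x + f y" "f (c *s x) = c *s f x" "f (x - y) = f x - f y" "f 0 = 0" "f (- x) = - f x"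
proof -
  have add: "f (x + y) = f x + f y" and scale: "f (c *s x) = c *s f x" for x y c
    using assms by (auto simp: linear_map_def)
  show "f (x + y) = f x + f y" "f (c *s x) = c *s f x" by (fact add scale)+
  show "f (x - y) = f x - f y" using add[of "x - y" y] by simp
  show "f 0 = 0" using scale[of 0 0] by simp
  show "f (- x) = - f x" using scale[of "-1" x] by simp
qed

lemma rank_one_2x2:
  fixes X :: "2 \<Rightarrow> 2 \<Rightarrow> complex"
  assumes "X 0 0 * X 1 1 = X 0 1 * X 1 0"
  obtains t u :: "complex ^ 2" where "\<And>j k. X j k = t $ j * u $ k"
proof -
  have "\<exists>t u :: complex ^ 2. \<forall>j k. X j k = t $ j * u $ k"
  proof (cases "X 0 0 = 0")
    case False
    then show ?thesis
      by (intro exI[of _ "\<chi> j. if j = 0 then 1 else X 1 0 / X 0 0"] exI[of _ "\<chi> k. X 0 k"])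
         (use assms in \<open>simp add: all_two field_simps\<close>)
  next
    case True
    then consider "X 0 1 = 0" | "X 1 0 = 0" using assms by auto
    then show ?thesis
    proof cases
      case 1
      then show ?thesis
        by (intro exI[of _ "\<chi> j. if j = 0 then 0 else 1"] exI[of _ "\<chi> k. X 1 k"])
           (use True in \<open>simp add: all_two\<close>)
    next
      case 2
      then show ?thesis
        by (intro exI[of _ "\<chi> j. X j 1"] exI[of _ "\<chi> k. if k = 0 then 0 else 1"])
           (use True in \<open>simp add: all_two\<close>)
    qed
  qed
  then show ?thesis using that by blast
qed

text \<open>The trilinear map in rescaled control points; weights and points are complex because the
  rescaling constants are.\<close>

definition trisum ::
  "(2 \<Rightarrow> 2 \<Rightarrow> 2 \<Rightarrow> complex) \<Rightarrow> (2 \<Rightarrow> 2 \<Rightarrow> 2 \<Rightarrow> complex ^ 4) \<Rightarrow> complex ^ 2 \<Rightarrow> complex ^ 2 \<Rightarrow> complex ^ 2 \<Rightarrow> complex ^ 4"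
  where "trisum \<omega> p s t u =
     (\<Sum>i\<in>UNIV. \<Sum>j\<in>UNIV. \<Sum>k\<in>UNIV. (\<omega> i j k * s $ i * t $ j * u $ k) *s p i j k)"

lemma axis_two [simp]:
  "(axis 0 1 :: complex ^ 2) $ 0 = 1" "(axis 0 1 :: complex ^ 2) $ 1 = 0"
  "(axis 1 1 :: complex ^ 2) $ 0 = 0" "(axis 1 1 :: complex ^ 2) $ 1 = 1"
  by (simp_all add: axis_def)

text \<open>The control points, rescaled so that the relation between the four points of each planar
  boundary surface has coefficients \<open>1\<close>.\<close>

locale scaffold_points =
  fixes p :: "2 \<Rightarrow> 2 \<Rightarrow> 2 \<Rightarrow> complex ^ 4"
  assumes T_indep: "indep4 (p 0 j 0) (p 0 j 1) (p 1 j 0) (p 1 j 1)"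
    and Y_indep: "indep4 (p 0 0 k) (p 0 1 k) (p 1 0 k) (p 1 1 k)"
    and sum_zero: "p i 0 0 + p i 0 1 + p i 1 0 + p i 1 1 = 0"
    and indep3: "x *s p i 0 0 + y *s p i 0 1 + z *s p i 1 0 = 0 \<Longrightarrow> x = 0 \<and> y = 0 \<and> z = 0"
begin

lemma last_point: "p i 1 1 = - p i 0 0 - p i 0 1 - p i 1 0"
  using sum_zero[of i] by (simp add: algebra_simps eq_neg_iff_add_eq_0)

text \<open>The symmetry between \<open>t\<close> and \<open>u\<close>: it carries statements about
  planes through \<open>y\<close> to planes through \<open>z\<close>.\<close>

lemma transpose_points: "scaffold_points (\<lambda>i j k. p i k j)"
proof
  show "x = 0 \<and> y = 0 \<and> z = 0" if "x *s p i 0 0 + y *s p i 1 0 + z *s p i 0 1 = 0" for x y z i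
    using indep3[of x i z y] that by (simp add: ac_simps)
qed (use T_indep Y_indep sum_zero in \<open>simp_all add: ac_simps\<close>)

text \<open>In the type \<open>2\<close>, \<open>i + 1\<close> is the other index, so either side of
  \<open>T_j\<close> may be listed first.\<close>

lemma T_indep': "indep4 (p i j 0) (p i j 1) (p (i + 1) j 0) (p (i + 1) j 1)"
proof (induction i rule: two_induct)
  show "indep4 (p 1 j 0) (p 1 j 1) (p (1 + 1) j 0) (p (1 + 1) j 1)"
    unfolding indep4_def
  proof (intro allI impI)
    fix x y z w
    assume "x *s p 1 j 0 + y *s p 1 j 1 + z *s p (1 + 1) j 0 + w *s p (1 + 1) j 1 = 0"
    then have "z *s p 0 j 0 + w *s p 0 j 1 + x *s p 1 j 0 + y *s p 1 j 1 = 0"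
      by (simp add: ac_simps)
    then show "x = 0 \<and> y = 0 \<and> z = 0 \<and> w = 0" using T_indep[of j] unfolding indep4_def by blast
  qed
qed (simp add: T_indep)

text \<open>Any three of the four points of Sigma_i contain a full row \<open>p i j 0\<close>,
  \<open>p i j 1\<close>, so these are all the triples. The other triples follow from the first by
  substituting \<open>last_point\<close>.\<close>

lemma indep3':
  assumes "x *s p i j 0 + y *s p i j 1 + z *s p i (j + 1) k = 0"
  shows "x = 0 \<and> y = 0 \<and> z = 0"
proof -
  consider "j = 0" "k = 0" | "j = 0" "k = 1" | "j = 1" "k = 0" | "j = 1" "k = 1"
    using two_cases by metis
  then show ?thesis
  proof cases
    case 1
    then show ?thesis using assms indep3 by simp
  next
    case 2
    then have "(x - z) *s p i 0 0 + (y - z) *s p i 0 1 + (- z) *s p i 1 0 = 0"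
      using assms by (simp add: last_point vec_eq_iff algebra_simps)
    from indep3[OF this] show ?thesis by simp
  next
    case 3
    then have "(z - y) *s p i 0 0 + (- y) *s p i 0 1 + (x - y) *s p i 1 0 = 0"
      using assms by (simp add: last_point vec_eq_iff algebra_simps)
    from indep3[OF this] show ?thesis by simp
  next
    case 4
    then have "(- y) *s p i 0 0 + (z - y) *s p i 0 1 + (x - y) *s p i 1 0 = 0"
      using assms by (simp add: last_point vec_eq_iff algebra_simps)
    from indep3[OF this] show ?thesis by simp
  qed
qed

lemma plane_exists:
  obtains \<sigma> where "\<sigma> \<noteq> 0" "\<And>j k. dot \<sigma> (p i j k) = 0"
proof -
  have "\<not> indep4 (p i 0 0) (p i 0 1) (p i 1 0) (p i 1 1)"
    using sum_zero[of i] unfolding indep4_def by (auto intro!: exI[of _ "1::complex"])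
  then obtain \<sigma> where \<sigma>: "\<sigma> \<noteq> 0" "dot \<sigma> (p i 0 0) = 0" "dot \<sigma> (p i 0 1) = 0"
    "dot \<sigma> (p i 1 0) = 0" "dot \<sigma> (p i 1 1) = 0" by (rule not_indep4_annihilator)
  moreover have "dot \<sigma> (p i j k) = 0" for j k
    using \<sigma> two_cases[of j] two_cases[of k] by auto
  ultimately show ?thesis using that by blast
qed

text \<open>If \<open>\<theta>\<close> vanished at a control point, it would contain a boundary line, and then the transversal
  \<open>L\<close> would be that line; but a boundary line is not met by the opposite lines \<open>s\<^sub>j\<^sub>k\<close>.\<close>

lemma transversal_plane_nonzero:
  assumes L: "vec.subspace L" "vec.dim L = 2"
    and meet: "\<And>j k. \<exists>a b. (a \<noteq> 0 \<or> b \<noteq> 0) \<and> a *s p 0 j k + b *s p 1 j k \<in> L"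
    and \<theta>: "\<theta> \<noteq> 0" "\<And>x. x \<in> L \<Longrightarrow> dot \<theta> x = 0" "\<And>i j. dot \<theta> (p i j 0) + dot \<theta> (p i j 1) = 0"
  shows "dot \<theta> (p i j k) \<noteq> 0"
proof
  assume "dot \<theta> (p i j k) = 0"
  then have z: "dot \<theta> (p i j k) = 0" for k
    using opposite_zero[of "\<lambda>k. dot \<theta> (p i j k)"] \<theta>(3)[of i j] by blast
  have meet': "\<exists>a b. (a \<noteq> 0 \<or> b \<noteq> 0) \<and> a *s p i j k + b *s p (i + 1) j k \<in> L" for j k
    using meet[of j k] two_cases[of i] by (metis add.commute add.right_neutral add.left_neutral one_plus_one_two)
  have nz: "dot \<theta> (p (i + 1) j k) \<noteq> 0" for k
  proof
    assume "dot \<theta> (p (i + 1) j k) = 0"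
    then have "dot \<theta> (p (i + 1) j k) = 0" for k
      using opposite_zero[of "\<lambda>k. dot \<theta> (p (i + 1) j k)"] \<theta>(3)[of "i + 1" j] by blast
    then show False using indep4_annihilator[OF T_indep'[of i j]] z \<theta>(1) by blast
  qed
  have L_mem: "p i j k \<in> L" for k
  proof -
    obtain a b where ab: "a \<noteq> 0 \<or> b \<noteq> 0" "a *s p i j k + b *s p (i + 1) j k \<in> L"
      using meet' by blast
    then have "b = 0" using \<theta>(2)[OF ab(2)] z nz by (simp add: dot_simps)
    with ab have "a \<noteq> 0" "a *s p i j k \<in> L" by auto
    then show ?thesis using vec.subspace_scale[OF L(1), of "a *s p i j k" "1 / a"] by simp
  qed
  \<comment> \<open>\<open>L\<close> is now the line through row \<open>j\<close> of Sigma_i, so it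
    lies in that plane. It meets the lines \<open>s\<close> of the other row at points different
    from \<open>p i (j + 1) k\<close>, which puts all four independent points of \<open>T\<close>
    with index \<open>j + 1\<close> in the plane.\<close>
  obtain \<sigma> where \<sigma>: "\<sigma> \<noteq> 0" "\<And>j k. dot \<sigma> (p i j k) = 0" by (rule plane_exists[of i]) blast
  have "dot \<sigma> (p (i + 1) (j + 1) k) = 0" for k
  proof -
    obtain a b where ab: "a \<noteq> 0 \<or> b \<noteq> 0" "a *s p i (j + 1) k + b *s p (i + 1) (j + 1) k \<in> L"
      using meet' by blast
    have ind: "x = 0 \<and> y = 0" if "x *s p i j 0 + y *s p i j 1 = 0" for x y
      using indep3'[of x i j y 0 0] that by simp
    obtain x y where xy: "a *s p i (j + 1) k + b *s p (i + 1) (j + 1) k = x *s p i j 0 + y *s p i j 1"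
      using dim_2_span[OF L L_mem L_mem ind ab(2)] by blast
    have "b \<noteq> 0"
    proof
      assume "b = 0"
      then have "x *s p i j 0 + y *s p i j 1 + (- a) *s p i (j + 1) k = 0"
        using xy by (simp add: vec_eq_iff)
      from indep3'[OF this] show False using ab(1) \<open>b = 0\<close> by simp
    qed
    moreover have "b * dot \<sigma> (p (i + 1) (j + 1) k) = 0"
      using arg_cong[OF xy, of "dot \<sigma>"] by (simp add: dot_simps \<sigma>)
    ultimately show ?thesis by simp
  qed
  then show False using indep4_annihilator[OF T_indep'[of i "j + 1"]] \<sigma> by blast
qed

text \<open>The opposite values of \<theta> at \<open>p i j 0\<close> and \<open>p i j 1\<close>
  make the ratio independent of \<open>k\<close>; those of \<rho> make it independent of
  \<open>j\<close>.\<close>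

lemma transversal_ratio:
  assumes L: "vec.subspace L" "vec.dim L = 2"
    and meet: "\<And>j k. \<exists>a b. (a \<noteq> 0 \<or> b \<noteq> 0) \<and> a *s p 0 j k + b *s p 1 j k \<in> L"
    and \<theta>: "\<theta> \<noteq> 0" "\<And>x. x \<in> L \<Longrightarrow> dot \<theta> x = 0" "\<And>i j. dot \<theta> (p i j 0) + dot \<theta> (p i j 1) = 0"
    and \<rho>: "\<rho> \<noteq> 0" "\<And>x. x \<in> L \<Longrightarrow> dot \<rho> x = 0" "\<And>i k. dot \<rho> (p i 0 k) + dot \<rho> (p i 1 k) = 0"
  obtains m where "m \<noteq> 0" "\<And>j k. p 0 j k - m *s p 1 j k \<in> L"
    "\<And>j k. dot \<theta> (p 0 j k) = m * dot \<theta> (p 1 j k)" "\<And>j k. dot \<rho> (p 0 j k) = m * dot \<rho> (p 1 j k)"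
proof -
  interpret tr: scaffold_points "\<lambda>i j k. p i k j" by (rule transpose_points)
  have \<theta>nz: "dot \<theta> (p i j k) \<noteq> 0" for i j k
    by (rule transversal_plane_nonzero[OF L meet \<theta>])
  have \<rho>nz: "dot \<rho> (p i j k) \<noteq> 0" for i j k
    by (rule tr.transversal_plane_nonzero[OF L meet \<rho>])
  have "\<exists>c. p 0 j k - c *s p 1 j k \<in> L" for j k
  proof -
    obtain a b where ab: "a \<noteq> 0 \<or> b \<noteq> 0" "a *s p 0 j k + b *s p 1 j k \<in> L"
      using meet by blast
    have "a \<noteq> 0" using \<theta>(2)[OF ab(2)] \<theta>nz ab(1) by (auto simp: dot_simps)
    then have "p 0 j k - (- b / a) *s p 1 j k = (1 / a) *s (a *s p 0 j k + b *s p 1 j k)"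
      by (simp add: vec_eq_iff field_simps)
    then show ?thesis using vec.subspace_scale[OF L(1) ab(2)] by metis
  qed
  then obtain c where c: "\<And>j k. p 0 j k - c j k *s p 1 j k \<in> L" by metis
  have \<theta>c: "dot \<theta> (p 0 j k) = c j k * dot \<theta> (p 1 j k)" for j k
    using \<theta>(2)[OF c, of j k] by (simp add: dot_simps)
  have \<rho>c: "dot \<rho> (p 0 j k) = c j k * dot \<rho> (p 1 j k)" for j k
    using \<rho>(2)[OF c, of j k] by (simp add: dot_simps)
  have "c j 0 * dot \<theta> (p 1 j 0) = c j 1 * dot \<theta> (p 1 j 0)" for j
    using \<theta>(3)[of 0 j] \<theta>(3)[of 1 j] unfolding \<theta>c by algebra
  then have c1: "c j 1 = c j 0" for j using \<theta>nz by (metis mult_right_cancel)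
  have "c 0 k * dot \<rho> (p 1 0 k) = c 1 k * dot \<rho> (p 1 0 k)" for k
    using \<rho>(3)[of 0 k] \<rho>(3)[of 1 k] unfolding \<rho>c by algebra
  then have c2: "c 1 k = c 0 k" for k using \<rho>nz by (metis mult_right_cancel)
  have cc: "c j k = c 0 0" for j k
    using two_cases[of j] two_cases[of k] c1 c2 by metis
  show ?thesis
  proof (rule that[of "c 0 0"])
    show "c 0 0 \<noteq> 0" using \<theta>c[of 0 0] \<theta>nz[of 0 0 0] by auto
  qed (metis c \<theta>c \<rho>c cc)+
qed

text \<open>The transversals are eigenspaces of a linear map that carries the control points of one planar
  boundary surface to those of the other.\<close>

lemma homology_exists:
  assumes L: "\<And>l. vec.subspace (L l)" "\<And>l. vec.dim (L l) = 2" "L 0 \<noteq> L (1 :: 2)"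
    and m: "\<And>l j k. p 0 j k - m l *s p 1 j k \<in> L l"
  obtains \<Phi> where "linear_map \<Phi>" "\<And>j k. \<Phi> (p 1 j k) = p 0 j k"
    "\<And>x. \<Phi> (\<Phi> x) = (m 0 + m 1) *s \<Phi> x - (m 0 * m 1) *s x"
proof -
  have ind: "x = 0 \<and> y = 0"
    if "x *s (p 0 0 0 - m l *s p 1 0 0) + y *s (p 0 0 1 - m l *s p 1 0 1) = 0" for x y l
  proof -
    have "x *s p 0 0 0 + y *s p 0 0 1 + (- x * m l) *s p 1 0 0 + (- y * m l) *s p 1 0 1 = 0"
      using that by (simp add: vec_eq_iff algebra_simps)
    then show ?thesis using T_indep[of 0] unfolding indep4_def by blast
  qed
  have span: "\<exists>x y. v = x *s (p 0 0 0 - m l *s p 1 0 0) + y *s (p 0 0 1 - m l *s p 1 0 1)"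
    if "v \<in> L l" for v l
    by (rule dim_2_span[OF L(1)[of l] L(2)[of l] m[of 0 0 l] m[of 0 1 l] ind[of _ l] that]) blast+
  \<comment> \<open>Each \<open>L l\<close> is spanned by two points that depend only on
    \<open>m l\<close>, so equal parameters would give equal transversals.\<close>
  have mne: "m 0 \<noteq> m 1"
  proof
    assume eq: "m 0 = m 1"
    have "v \<in> L l'" if v: "v \<in> L l" for v l l'
    proof -
      obtain x y where "v = x *s (p 0 0 0 - m l *s p 1 0 0) + y *s (p 0 0 1 - m l *s p 1 0 1)"
        using span[OF v] by blast
      moreover have "m l = m l'" using eq two_cases by metis
      ultimately show ?thesis
        using m[of 0 0 l'] m[of 0 1 l'] by (metis L(1) vec.subspace_add vec.subspace_scale)
    qed
    then show False using L(3) by blast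
  qed
  \<comment> \<open>The frame consists of the four points of \<open>T_0\<close>. The images of
    \<open>p 0 0 0\<close> and \<open>p 0 0 1\<close> are dictated by the quadratic equation with
    roots \<open>m 0\<close> and \<open>m 1\<close>.\<close>
  obtain \<Phi> where lin: "linear_map \<Phi>" and \<Phi>: "\<Phi> (p 1 0 0) = p 0 0 0" "\<Phi> (p 1 0 1) = p 0 0 1"
    "\<Phi> (p 0 0 0) = (m 0 + m 1) *s p 0 0 0 - (m 0 * m 1) *s p 1 0 0"
    "\<Phi> (p 0 0 1) = (m 0 + m 1) *s p 0 0 1 - (m 0 * m 1) *s p 1 0 1"
    using indep4_linear_map[OF T_indep[of 0]] by metis
  note lins = linear_mapD[OF lin]
  have "\<Phi> (\<Phi> x) = (m 0 + m 1) *s \<Phi> x - (m 0 * m 1) *s x" for x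
  proof -
    obtain a b c d where x: "x = a *s p 0 0 0 + b *s p 0 0 1 + c *s p 1 0 0 + d *s p 1 0 1"
      using T_indep[of 0] by (rule indep4_span)
    show ?thesis unfolding x lins \<Phi> by (simp add: vec_eq_iff algebra_simps)
  qed
  moreover have "\<Phi> (p 1 j k) = p 0 j k" for j k
  proof -
    \<comment> \<open>The eigenvalue on \<open>L l\<close> is the parameter of the other
      transversal, written so as to treat both at once.\<close>
    have eig: "\<Phi> v = (m 0 + m 1 - m l) *s v" if v: "v \<in> L l" for v l
    proof -
      obtain x y where x: "v = x *s (p 0 0 0 - m l *s p 1 0 0) + y *s (p 0 0 1 - m l *s p 1 0 1)"
        using span[OF v] by blast
      show ?thesis unfolding x lins \<Phi> using two_cases[of l]
        by (auto simp: vec_eq_iff algebra_simps)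
    qed
    have 0: "\<Phi> (p 0 j k) - m 0 *s \<Phi> (p 1 j k) = m 1 *s (p 0 j k - m 0 *s p 1 j k)"
      using eig[OF m[of j k 0]] by (simp add: lins)
    have 1: "\<Phi> (p 0 j k) - m 1 *s \<Phi> (p 1 j k) = m 0 *s (p 0 j k - m 1 *s p 1 j k)"
      using eig[OF m[of j k 1]] by (simp add: lins)
    \<comment> \<open>Subtracting the two eigenvector equations eliminates the image of
      \<open>p 0 j k\<close>.\<close>
    have "(m 1 - m 0) *s \<Phi> (p 1 j k) = (\<Phi> (p 0 j k) - m 0 *s \<Phi> (p 1 j k)) - (\<Phi> (p 0 j k) - m 1 *s \<Phi> (p 1 j k))"
      by (simp add: vec_eq_iff algebra_simps)
    also have "\<dots> = (m 1 - m 0) *s p 0 j k"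
      unfolding 0 1 by (simp add: vec_eq_iff algebra_simps)
    finally show ?thesis unfolding vec.scale_cancel_left using mne by simp
  qed
  ultimately show ?thesis using that lin by blast
qed

text \<open>If the slice of \<open>\<omega>\<close> had rank two, the boundary map would be generically two-to-one with distinct
  values of \<open>t\<close> on the fibres, while \<open>B\<close> recovers \<open>t\<close>; so \<open>B\<close> would vanish on the whole plane, and
  then identically.\<close>

lemma inverse_imp_slice_rank_one:
  assumes \<omega>: "\<And>i j k. \<omega> i j k \<noteq> 0"
    and B: "\<And>j. homogeneous 2 (B j)"
    and inv: "\<And>s t u. cpoly_eval (B 0) (trisum \<omega> p s t u) * t $ 1
                      = cpoly_eval (B 1) (trisum \<omega> p s t u) * t $ 0"
    and B_nz: "\<exists>x j. cpoly_eval (B (j :: 2)) x \<noteq> 0"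
  shows "\<omega> i 0 0 * \<omega> i 1 1 = \<omega> i 0 1 * \<omega> i 1 0"
proof (rule ccontr)
  assume neq: "\<omega> i 0 0 * \<omega> i 1 1 \<noteq> \<omega> i 0 1 * \<omega> i 1 0"
  \<comment> \<open>\<open>K\<close> spans the ambiguity of coordinates in the plane: its weighted
    sum is the sum of the four points, which is zero. So \<open>X\<close> and
    \<open>X - c * K\<close> have the same image under \<open>G\<close>.\<close>
  define K where "K j k = 1 / \<omega> i j k" for j k
  define G where "G X = (\<Sum>j\<in>UNIV. \<Sum>k\<in>UNIV. (\<omega> i j k * X j k) *s p i j k)" for X :: "2 \<Rightarrow> 2 \<Rightarrow> complex"
  have G: "trisum \<omega> p (axis i 1) t u = G (\<lambda>j k. t $ j * u $ k)" for t u
    using two_cases[of i] by (auto simp: trisum_def G_def sum_two mult.assoc)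
  have K: "\<omega> i j k * K j k = 1" for j k using \<omega> by (simp add: K_def)
  have GK: "G (\<lambda>j k. X j k - c * K j k) = G X" for X c
  proof -
    have slice: "\<omega> i j k * (X j k - c * K j k) = \<omega> i j k * X j k - c" for j k
      using K[of j k] by (simp add: algebra_simps)
    show ?thesis
      unfolding G_def sum_two slice by (simp add: last_point vec_eq_iff algebra_simps)
  qed
  define d where "d = K 0 0 * K 1 1 - K 0 1 * K 1 0"
  have "d \<noteq> 0"
  proof
    assume "d = 0"
    then have "(\<omega> i 0 0 * \<omega> i 1 1) * (\<omega> i 0 1 * \<omega> i 1 0) * (K 0 0 * K 1 1 - K 0 1 * K 1 0) = 0"
      by (simp add: d_def)
    then have "\<omega> i 0 1 * \<omega> i 1 0 - \<omega> i 0 0 * \<omega> i 1 1 = 0"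
      using K[of 0 0] K[of 0 1] K[of 1 0] K[of 1 1] by algebra
    then show False using neq by simp
  qed
  \<comment> \<open>The determinant of \<open>t \<otimes> u - c * K\<close> is
    \<open>c * (c * d - N t u)\<close>. Besides \<open>c = 0\<close> it vanishes at
    \<open>c = N t u / d\<close>, which yields a second parameter pair with the same image.\<close>
  define N where "N t u = t $ 0 * u $ 0 * K 1 1 + t $ 1 * u $ 1 * K 0 0
      - t $ 0 * u $ 1 * K 1 0 - t $ 1 * u $ 0 * K 0 1" for t u :: "complex ^ 2"
  have generic: "cpoly_eval (B j) (trisum \<omega> p (axis i 1) t u) = 0" if "N t u \<noteq> 0" for j t u
  proof -
    define c where "c = N t u / d"
    have c: "c * d = N t u" "c \<noteq> 0" using that \<open>d \<noteq> 0\<close> by (auto simp: c_def)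
    define X where "X j k = t $ j * u $ k - c * K j k" for j k
    have "X 0 0 * X 1 1 - X 0 1 * X 1 0 = c * (c * d) - c * N t u"
      by (simp add: X_def d_def N_def algebra_simps)
    then have "X 0 0 * X 1 1 = X 0 1 * X 1 0" by (simp add: c)
    then obtain t' u' where X': "\<And>j k. X j k = t' $ j * u' $ k" by (rule rank_one_2x2) blast
    have same: "trisum \<omega> p (axis i 1) t' u' = trisum \<omega> p (axis i 1) t u"
      unfolding G X'[symmetric] X_def by (rule GK)
    let ?x = "trisum \<omega> p (axis i 1) t u"
    have eqs: "cpoly_eval (B 0) ?x * t $ 1 = cpoly_eval (B 1) ?x * t $ 0"
      "cpoly_eval (B 0) ?x * t' $ 1 = cpoly_eval (B 1) ?x * t' $ 0"
      using inv[of "axis i 1" t u] inv[of "axis i 1" t' u'] unfolding same by auto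
    \<comment> \<open>For proportional \<open>t\<close> and \<open>t'\<close> the matrix
      \<open>c * K\<close>, a difference of two products with these first factors, would have
      determinant zero.\<close>
    have "t $ 0 * t' $ 1 - t $ 1 * t' $ 0 \<noteq> 0"
    proof
      assume *: "t $ 0 * t' $ 1 - t $ 1 * t' $ 0 = 0"
      have cK: "c * K j k = t $ j * u $ k - t' $ j * u' $ k" for j k
        using X'[of j k] by (simp add: X_def algebra_simps)
      have "c * c * d = (c * K 0 0) * (c * K 1 1) - (c * K 0 1) * (c * K 1 0)"
        by (simp add: d_def algebra_simps)
      also have "\<dots> = 0" unfolding cK using * by algebra
      finally show False using c(2) \<open>d \<noteq> 0\<close> by simp
    qed
    moreover have "cpoly_eval (B 0) ?x * (t $ 0 * t' $ 1 - t $ 1 * t' $ 0) = 0"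
      "cpoly_eval (B 1) ?x * (t $ 0 * t' $ 1 - t $ 1 * t' $ 0) = 0"
      using eqs by algebra+
    ultimately show ?thesis using two_cases[of j] by auto
  qed
  have all: "cpoly_eval (B j) (trisum \<omega> p (axis i 1) t u) = 0" for j t u
  proof -
    let ?t = "\<lambda>z. axis 0 1 + z *s (t - axis 0 1)" and ?u = "\<lambda>z. axis 0 1 + z *s (u - axis 0 1)"
    have "polyfun (\<lambda>z. N (?t z) (?u z))"
      unfolding N_def by (simp add: polyfun_intros)
    moreover have "polyfun (\<lambda>z. cpoly_eval (B j) (trisum \<omega> p (axis i 1) (?t z) (?u z)))"
      unfolding trisum_def by (rule polyfun_cpoly_eval) (simp add: polyfun_intros)
    moreover have "N (?t 0) (?u 0) \<noteq> 0" using \<omega>[of i 1 1] by (simp add: N_def K_def)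
    ultimately have "cpoly_eval (B j) (trisum \<omega> p (axis i 1) (?t 1) (?u 1)) = 0"
      using polyfun_eq_zero[of "\<lambda>z. N (?t z) (?u z)"
          "\<lambda>z. cpoly_eval (B j) (trisum \<omega> p (axis i 1) (?t z) (?u z))" 0 1] generic by blast
    then show ?thesis by simp
  qed
  have "cpoly_eval (B j) x = 0" for j x
  proof -
    let ?q = "cpoly_eval (B j)"
    have q: "quadratic_form ?q" by (rule homogeneous_2_eval[OF B])
    obtain \<kappa> where \<kappa>: "\<And>x y z w. ?q (x *s p i 0 0 + y *s p i 0 1 + z *s p i 1 0 + w *s p i 1 1)
          = \<kappa> * (\<omega> i 0 1 * \<omega> i 1 0 * x * w - \<omega> i 0 0 * \<omega> i 1 1 * y * z)"
    proof (rule quadratic_form_vanishing_on_bilinear_image[OF q _ \<omega> \<omega> \<omega> \<omega>])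
      show "?q ((\<omega> i 0 0 * s0 * u0) *s p i 0 0 + (\<omega> i 0 1 * s0 * u1) *s p i 0 1
          + (\<omega> i 1 0 * s1 * u0) *s p i 1 0 + (\<omega> i 1 1 * s1 * u1) *s p i 1 1) = 0" for s0 s1 u0 u1
        using all[of j "\<chi> j. if j = 0 then s0 else s1" "\<chi> k. if k = 0 then u0 else u1"]
        by (simp add: G G_def sum_two algebra_simps)
    qed blast
    \<comment> \<open>One point with two coordinate vectors: the formula gives zero for the first
      and a nonzero multiple of \<open>\<kappa>\<close> for the second.\<close>
    have "?q ((- 1) *s p i 0 0 + 0 *s p i 0 1 + 0 *s p i 1 0 + 0 *s p i 1 1)
        = ?q (0 *s p i 0 0 + 1 *s p i 0 1 + 1 *s p i 1 0 + 1 *s p i 1 1)"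
      by (simp add: last_point)
    then have "\<kappa> = 0" unfolding \<kappa> using \<omega> by simp
    \<comment> \<open>On the boundary surface with \<open>t = axis j' 1\<close> the identity
      \<open>inv\<close> reduces to the vanishing of \<open>B j\<close>.\<close>
    define j' where "j' = j + 1"
    let ?a = "p i j' 0" and ?b = "p i j' 1" and ?c = "p (i + 1) j' 0" and ?d = "p (i + 1) j' 1"
    obtain \<mu> where \<mu>: "\<And>x y z w. ?q (x *s ?a + y *s ?b + z *s ?c + w *s ?d)
          = \<mu> * (\<omega> i j' 1 * \<omega> (i + 1) j' 0 * x * w - \<omega> i j' 0 * \<omega> (i + 1) j' 1 * y * z)"
    proof (rule quadratic_form_vanishing_on_bilinear_image[OF q _ \<omega> \<omega> \<omega> \<omega>])
      fix s0 s1 u0 u1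
      let ?s = "(\<chi> i'. if i' = i then s0 else s1) :: complex ^ 2"
        and ?u = "(\<chi> k. if k = 0 then u0 else u1) :: complex ^ 2"
      have "?q (trisum \<omega> p ?s (axis j' 1) ?u) = 0"
        using inv[of ?s "axis j' 1" ?u] two_cases[of j] by (auto simp: j'_def)
      moreover have "trisum \<omega> p ?s (axis j' 1) ?u = (\<omega> i j' 0 * s0 * u0) *s ?a
          + (\<omega> i j' 1 * s0 * u1) *s ?b + (\<omega> (i + 1) j' 0 * s1 * u0) *s ?c
          + (\<omega> (i + 1) j' 1 * s1 * u1) *s ?d"
        using two_cases[of i] two_cases[of j']
        by (auto simp: trisum_def sum_two vec_eq_iff algebra_simps)
      ultimately show "?q ((\<omega> i j' 0 * s0 * u0) *s ?a
          + (\<omega> i j' 1 * s0 * u1) *s ?b + (\<omega> (i + 1) j' 0 * s1 * u0) *s ?c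
          + (\<omega> (i + 1) j' 1 * s1 * u1) *s ?d) = 0" by simp
    qed blast
    have plane_zero: "?q (x *s p i j' 0 + y *s p i j' 1 + z *s p i (j' + 1) 0 + w *s p i (j' + 1) 1) = 0"
      for x y z w
    proof (cases "j' = 0")
      case True
      then show ?thesis using \<kappa>[of x y z w] \<open>\<kappa> = 0\<close> by simp
    next
      case False
      then have "j' = 1" using two_cases by blast
      then show ?thesis using \<kappa>[of z w x y] \<open>\<kappa> = 0\<close> by (simp add: ac_simps)
    qed
    \<comment> \<open>The quadric also contains the plane Sigma_i. Moving freely along the row
      \<open>j'\<close> forces the last two coordinates of \<open>p i (j' + 1) 0\<close> to vanish,
      which would make three points of Sigma_i collinear.\<close>
    have "\<mu> = 0"
    proof (rule ccontr)
      assume "\<mu> \<noteq> 0"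
      obtain x y z w where v: "p i (j' + 1) 0 = x *s ?a + y *s ?b + z *s ?c + w *s ?d"
        using T_indep'[of i j'] by (rule indep4_span)
      have "?q (x' *s ?a + y' *s ?b + z *s ?c + w *s ?d) = 0" for x' y'
      proof -
        have "x' *s ?a + y' *s ?b + z *s ?c + w *s ?d
            = (x' - x) *s p i j' 0 + (y' - y) *s p i j' 1 + 1 *s p i (j' + 1) 0 + 0 *s p i (j' + 1) 1"
          unfolding v by (simp add: vec_eq_iff algebra_simps)
        then show ?thesis by (simp only: plane_zero)
      qed
      then have "\<mu> * (\<omega> i j' 1 * \<omega> (i + 1) j' 0 * x' * w - \<omega> i j' 0 * \<omega> (i + 1) j' 1 * y' * z) = 0" for x' y'
        unfolding \<mu> .
      from this[of 1 0] this[of 0 1] have "w = 0" "z = 0" using \<open>\<mu> \<noteq> 0\<close> \<omega> by auto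
      then have "x *s p i j' 0 + y *s p i j' 1 + (- 1) *s p i (j' + 1) 0 = 0"
        using v by (simp add: vec_eq_iff)
      from indep3'[OF this] show False by simp
    qed
    moreover obtain x1 x2 x3 x4 where "x = x1 *s ?a + x2 *s ?b + x3 *s ?c + x4 *s ?d"
      using T_indep'[of i j'] by (rule indep4_span)
    ultimately show ?thesis using \<mu> by simp
  qed
  then show False using B_nz by blast
qed

end

section \<open>The rational inverse\<close>

lemma trisum_transpose: "trisum (\<lambda>i j k. \<omega> i k j) (\<lambda>i j k. p i k j) s u t = trisum \<omega> p s t u"
  unfolding trisum_def by (subst sum.swap) (simp add: sum_two ac_simps)

text \<open>With \<open>T = (1, z)\<close> and \<open>U = (1, z\<^sup>2)\<close> the four products
  are the distinct powers \<open>1, z, z\<^sup>2, z\<^sup>3\<close>, so the sum is a nonzero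
  polynomial in \<open>z\<close>. Avoiding \<open>0\<close>, \<open>1\<close> and \<open>-1\<close>
  gives the other conditions.\<close>

lemma generic_values:
  fixes n :: "2 \<Rightarrow> 2 \<Rightarrow> complex"
  assumes "n j k \<noteq> 0"
  obtains T U :: "2 \<Rightarrow> complex" where "T 0 \<noteq> T 1" "U 0 \<noteq> U 1" "\<And>j. T j \<noteq> 0" "\<And>k. U k \<noteq> 0"
    "(\<Sum>j\<in>UNIV. \<Sum>k\<in>UNIV. T j * U k * n j k) \<noteq> 0"
proof -
  define q where "q = [:n 0 0, n 1 0, n 0 1, n 1 1:]"
  have "q \<noteq> 0" using assms two_cases[of j] two_cases[of k] by (auto simp: q_def)
  then have "finite ({z. poly q z = 0} \<union> {0, 1, -1})" by (simp add: poly_roots_finite)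
  then obtain z where z: "z \<notin> {z. poly q z = 0} \<union> {0, 1, -1}"
    using infinite_UNIV_char_0 ex_new_if_finite by blast
  then have "z\<^sup>2 \<noteq> 1" by (simp add: power2_eq_1_iff)
  show ?thesis
  proof (rule that[of "\<lambda>j. if j = 0 then 1 else z" "\<lambda>k. if k = 0 then 1 else z\<^sup>2"])
    have "poly q z \<noteq> 0" using z by simp
    then show "(\<Sum>j\<in>UNIV. \<Sum>k\<in>UNIV. (if j = 0 then 1 else z) * (if k = 0 then 1 else z\<^sup>2) * n j k) \<noteq> 0"
      by (simp add: sum_two q_def algebra_simps power2_eq_square)
  qed (use z \<open>z\<^sup>2 \<noteq> 1\<close> in auto)
qed

text \<open>The homology \<open>\<Phi>\<close> with eigenvalues \<open>a\<close> and \<open>b\<close> has conjugate \<open>a + b - \<Phi>\<close>, and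
  \<open>(s\<^sub>0 \<Phi> + s\<^sub>1) (s\<^sub>0 (a + b - \<Phi>) + s\<^sub>1)\<close> is the scalar \<open>(a s\<^sub>0 + s\<^sub>1) (b s\<^sub>0 + s\<^sub>1)\<close>.
  So \<open>plane_part\<close> inverts \<open>v \<mapsto> s\<^sub>0 \<Phi> v + s\<^sub>1 v\<close> on the plane \<open>\<sigma>\<close> up to a scalar.\<close>

definition conjugate :: "(complex ^ 4 \<Rightarrow> complex ^ 4) \<Rightarrow> complex \<Rightarrow> complex \<Rightarrow> complex ^ 4 \<Rightarrow> complex ^ 4" where
  "conjugate \<Phi> a b x = (a + b) *s x - \<Phi> x"

definition plane_part ::
  "(complex ^ 4 \<Rightarrow> complex ^ 4) \<Rightarrow> complex \<Rightarrow> complex \<Rightarrow> complex ^ 4 \<Rightarrow> complex ^ 4 \<Rightarrow> complex ^ 4" where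
  "plane_part \<Phi> a b \<sigma> x = dot \<sigma> x *s conjugate \<Phi> a b x - dot \<sigma> (conjugate \<Phi> a b x) *s x"

locale scaffold_homology = scaffold_points +
  fixes \<Phi> :: "complex ^ 4 \<Rightarrow> complex ^ 4" and a b :: complex
  assumes lin: "linear_map \<Phi>" and \<Phi>_p: "\<Phi> (p 1 j k) = p 0 j k"
    and \<Phi>_quad: "\<Phi> (\<Phi> x) = (a + b) *s \<Phi> x - (a * b) *s x"
    and nz: "a \<noteq> 0" "b \<noteq> 0"
begin

abbreviation "\<Psi> \<equiv> conjugate \<Phi> a b"
abbreviation "Z \<equiv> plane_part \<Phi> a b"

lemma transpose_homology: "scaffold_homology (\<lambda>i j k. p i k j) \<Phi> a b"
  using transpose_points lin \<Phi>_p \<Phi>_quad nz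
  by (simp add: scaffold_homology_def scaffold_homology_axioms_def)

lemmas \<Phi>_lin = linear_mapD[OF lin]

lemma lin_\<Psi>: "linear_map \<Psi>"
  unfolding linear_map_def conjugate_def by (simp add: \<Phi>_lin vec_eq_iff algebra_simps)

lemmas \<Psi>_lin = linear_mapD[OF lin_\<Psi>]

lemma \<Psi>_\<Phi>: "\<Psi> (\<Phi> x) = (a * b) *s x"
  unfolding conjugate_def \<Phi>_quad by (simp add: vec_eq_iff)

lemma \<Phi>_\<Psi>: "\<Phi> (\<Psi> x) = (a * b) *s x"
  unfolding conjugate_def \<Phi>_lin \<Phi>_quad by (simp add: vec_eq_iff)

lemma plane_coordinates:
  assumes \<sigma>: "\<sigma> \<noteq> 0" "\<And>j k. dot \<sigma> (p 1 j k) = 0"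
  obtains d where "dot \<sigma> d = 1" "indep4 (p 1 0 0) (p 1 0 1) (p 1 1 0) d"
proof -
  obtain d' where "dot \<sigma> d' \<noteq> 0" using \<sigma>(1) dot_eq_zero by blast
  define d where "d = (1 / dot \<sigma> d') *s d'"
  have d: "dot \<sigma> d = 1" using \<open>dot \<sigma> d' \<noteq> 0\<close> by (simp add: d_def dot_simps)
  moreover have "indep4 (p 1 0 0) (p 1 0 1) (p 1 1 0) d"
    unfolding indep4_def
  proof (intro allI impI)
    fix x y z w assume 0: "x *s p 1 0 0 + y *s p 1 0 1 + z *s p 1 1 0 + w *s d = 0"
    have "w = 0" using arg_cong[OF 0, of "dot \<sigma>"] by (simp add: dot_simps \<sigma> d)
    then show "x = 0 \<and> y = 0 \<and> z = 0 \<and> w = 0" using indep3[of x 1 y z] 0 by simp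
  qed
  ultimately show ?thesis using that by blast
qed

text \<open>Three values can be prescribed freely; the fourth is forced because the four points sum
  to zero.\<close>

lemma plane_form:
  assumes \<sigma>: "\<sigma> \<noteq> 0" "\<And>j k. dot \<sigma> (p 1 j k) = 0" and sum: "(\<Sum>j\<in>UNIV. \<Sum>k\<in>UNIV. c j k) = 0"
  obtains h where "\<And>j k. dot h (p 1 j k) = c j k"
proof -
  obtain d where d: "indep4 (p 1 0 0) (p 1 0 1) (p 1 1 0) d"
    using plane_coordinates[OF \<sigma>] by blast
  obtain h where h: "dot h (p 1 0 0) = c 0 0" "dot h (p 1 0 1) = c 0 1" "dot h (p 1 1 0) = c 1 0"
    using d by (rule indep4_dual)
  moreover have "dot h (p 1 1 1) = c 1 1"
    using sum unfolding last_point dot_simps h sum_two by algebra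
  ultimately have "dot h (p 1 j k) = c j k" for j k
    using two_cases[of j] two_cases[of k] by auto
  then show ?thesis using that by blast
qed

lemma plane_span:
  assumes \<sigma>: "\<sigma> \<noteq> 0" "\<And>j k. dot \<sigma> (p 1 j k) = 0" and z: "dot \<sigma> z = 0"
  obtains x y w where "z = x *s p 1 0 0 + y *s p 1 0 1 + w *s p 1 1 0"
proof -
  obtain d where d: "dot \<sigma> d = 1" "indep4 (p 1 0 0) (p 1 0 1) (p 1 1 0) d"
    using plane_coordinates[OF \<sigma>] by blast
  obtain x y w v where v: "z = x *s p 1 0 0 + y *s p 1 0 1 + w *s p 1 1 0 + v *s d"
    using d(2) by (rule indep4_span)
  have "v = 0" using z unfolding v by (simp add: dot_simps \<sigma> d)
  then show ?thesis using that v by simp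
qed

lemma p0_off_plane:
  assumes \<sigma>: "\<sigma> \<noteq> 0" "\<And>j k. dot \<sigma> (p 1 j k) = 0"
  shows "dot \<sigma> (p 0 j 0) \<noteq> 0 \<or> dot \<sigma> (p 0 j 1) \<noteq> 0"
  using indep4_annihilator[OF T_indep[of j], of \<sigma>] \<sigma> by auto

text \<open>On the plane \<sigma> the forms \<open>\<sigma> \<circ> \<Psi>\<close> and
  \<open>\<sigma> \<circ> \<Phi>\<close> are opposite, as \<open>\<Psi> + \<Phi>\<close> is scalar.
  Hence two linear forms recover \<open>c : d\<close>, and then \<open>Z\<close> recovers
  \<open>v\<close>, each up to a factor.\<close>

lemma Z_image:
  fixes c d :: complex
  assumes "dot \<sigma> v = 0"
  defines "x \<equiv> c *s \<Phi> v + d *s v"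
  shows "dot \<sigma> x = dot \<sigma> (\<Phi> v) * c" "- dot \<sigma> (\<Psi> x) = dot \<sigma> (\<Phi> v) * d"
    "Z \<sigma> x = (dot \<sigma> (\<Phi> v) * ((a * c + d) * (b * c + d))) *s v"
proof -
  have \<Psi>v: "dot \<sigma> (\<Psi> v) = - dot \<sigma> (\<Phi> v)" using assms(1) by (simp add: conjugate_def dot_simps)
  show 0: "dot \<sigma> x = dot \<sigma> (\<Phi> v) * c" unfolding x_def using assms(1) by (simp add: dot_simps)
  show 1: "- dot \<sigma> (\<Psi> x) = dot \<sigma> (\<Phi> v) * d"
    unfolding x_def \<Psi>_lin \<Psi>_\<Phi> using assms(1) \<Psi>v by (simp add: dot_simps)
  have "Z \<sigma> x = (dot \<sigma> (\<Phi> v) * c) *s \<Psi> x + (dot \<sigma> (\<Phi> v) * d) *s x"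
    unfolding plane_part_def 0 1[symmetric] by (simp add: vec_eq_iff)
  also have "\<dots> = (dot \<sigma> (\<Phi> v) * ((a * c + d) * (b * c + d))) *s v"
    unfolding x_def \<Psi>_lin \<Psi>_\<Phi> by (simp add: conjugate_def vec_eq_iff algebra_simps)
  finally show "Z \<sigma> x = (dot \<sigma> (\<Phi> v) * ((a * c + d) * (b * c + d))) *s v" .
qed

lemma trisum_rank_one:
  assumes "\<And>i j k. \<omega> i j k = \<alpha> i * \<beta> j * \<gamma> k"
  defines "V t u \<equiv> \<Sum>j\<in>UNIV. \<Sum>k\<in>UNIV. ((\<beta> j * t $ j) * (\<gamma> k * u $ k)) *s p 1 j k"
  shows "trisum \<omega> p s t u = (\<alpha> 0 * s $ 0) *s \<Phi> (V t u) + (\<alpha> 1 * s $ 1) *s V t u"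
  unfolding trisum_def V_def sum_two \<Phi>_lin \<Phi>_p assms(1) by (simp add: vec_eq_iff algebra_simps)

lemma quadratic_form_Z: "quadratic_form (\<lambda>x. dot h (Z \<sigma> x))"
proof -
  define B where "B x y = dot \<sigma> x * dot h (\<Psi> y) - dot \<sigma> (\<Psi> x) * dot h y" for x y
  have "bilinear_form B"
    unfolding bilinear_form_def B_def by (simp add: \<Psi>_lin dot_simps algebra_simps)
  moreover have "dot h (Z \<sigma> x) = B x x" for x
    by (simp add: B_def plane_part_def dot_simps)
  ultimately show ?thesis unfolding quadratic_form_def by blast
qed

text \<open>The two quadrics are the boundary quadrics \<open>F 1\<close> and \<open>F 0\<close> up to scaling: a quadric containing the
  image of a nondegenerate bilinear patch is unique.\<close>

lemma inverse_quadrics: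
  assumes \<sigma>: "\<sigma> \<noteq> 0" "\<And>j k. dot \<sigma> (p 1 j k) = 0"
    and \<omega>: "\<And>i j k. \<omega> i j k = \<alpha> i * \<beta> j * \<gamma> k"
    and nz': "\<And>i. \<alpha> i \<noteq> 0" "\<And>j. \<beta> j \<noteq> 0" "\<And>k. \<gamma> k \<noteq> 0"
    and F: "\<And>j. homogeneous 2 (F j)" "\<And>j. irreducible (F j)" "zeros (F 0) \<noteq> zeros (F (1 :: 2))"
    and van: "\<And>s j u. cpoly_eval (F j) (trisum \<omega> p s (axis j 1) u) = 0"
  obtains B g where "\<And>j. homogeneous 2 (B j)" "no_common_factor (B 0) (B (1 :: 2))"
    "\<And>j x. cpoly_eval (B j) x = dot (g j) (Z \<sigma> x) / \<beta> j"
    "\<And>j j' k. dot (g j) (p 1 j' k) = (if j' = j then (if k = 0 then 1 else -1) else 0)"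
proof -
  \<comment> \<open>The sign alternates along row \<open>j\<close>, so the values sum to zero. On
    \<open>V t u\<close> both forms then share the factor
    \<open>\<gamma> 0 * u $ 0 - \<gamma> 1 * u $ 1\<close>, and their quotient gives
    \<open>t\<close>.\<close>
  have "\<exists>h. \<forall>j' k. dot h (p 1 j' k) = (if j' = j then (if k = 0 then 1 else -1) else 0)" for j :: 2
  proof (rule plane_form[OF \<sigma>])
    show "(\<Sum>j'\<in>UNIV. \<Sum>k\<in>(UNIV :: 2 set). if j' = j then (if k = 0 then 1 else -1) else 0) = (0 :: complex)"
      using two_cases[of j] by (auto simp: sum_two)
  qed blast
  then obtain g where g: "\<And>j j' k. dot (g j) (p 1 j' k) = (if j' = j then (if k = 0 then 1 else -1) else 0)"
    by metis
  define V where "V t u = (\<Sum>j\<in>UNIV. \<Sum>k\<in>UNIV. ((\<beta> j * t $ j) * (\<gamma> k * u $ k)) *s p 1 j k)"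
    for t u :: "complex ^ 2"
  have tri: "trisum \<omega> p s t u = (\<alpha> 0 * s $ 0) *s \<Phi> (V t u) + (\<alpha> 1 * s $ 1) *s V t u" for s t u
    unfolding V_def by (rule trisum_rank_one[OF \<omega>])
  have \<sigma>V: "dot \<sigma> (V t u) = 0" for t u by (simp add: V_def sum_two dot_simps \<sigma>)
  have gV: "dot (g j) (V t u) = \<beta> j * t $ j * (\<gamma> 0 * u $ 0 - \<gamma> 1 * u $ 1)" for j t u
    using two_cases[of j] by (auto simp: V_def sum_two dot_simps g algebra_simps)
  have "\<exists>c. c \<noteq> 0 \<and> (\<forall>x. dot (g j) (Z \<sigma> x) = c * cpoly_eval (F (j + 1)) x)" for j
  proof -
    let ?q = "\<lambda>x. dot (g j) (Z \<sigma> x)" and ?F = "cpoly_eval (F (j + 1))"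
    let ?j = "j + 1"
    have \<omega>nz: "\<omega> i j k \<noteq> 0" for i j k using nz' by (simp add: \<omega>)
    have patch: "trisum \<omega> p (\<chi> i. if i = 0 then s0 else s1) (axis ?j 1) (\<chi> k. if k = 0 then u0 else u1)
        = (\<omega> 0 ?j 0 * s0 * u0) *s p 0 ?j 0 + (\<omega> 0 ?j 1 * s0 * u1) *s p 0 ?j 1
          + (\<omega> 1 ?j 0 * s1 * u0) *s p 1 ?j 0 + (\<omega> 1 ?j 1 * s1 * u1) *s p 1 ?j 1" for s0 s1 u0 u1
      using two_cases[of ?j] by (auto simp: trisum_def sum_two vec_eq_iff algebra_simps)
    have jne: "axis ?j 1 $ j = (0 :: complex)" using two_cases[of j] by auto
    have Fvan: "?F ((\<omega> 0 ?j 0 * s0 * u0) *s p 0 ?j 0 + (\<omega> 0 ?j 1 * s0 * u1) *s p 0 ?j 1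
          + (\<omega> 1 ?j 0 * s1 * u0) *s p 1 ?j 0 + (\<omega> 1 ?j 1 * s1 * u1) *s p 1 ?j 1) = 0" for s0 s1 u0 u1
      unfolding patch[symmetric] by (rule van)
    \<comment> \<open>On this surface \<open>t $ j = 0\<close>, and \<open>t $ j\<close> is a factor
      of \<open>dot (g j) (V t u)\<close>.\<close>
    have qvan: "?q ((\<omega> 0 ?j 0 * s0 * u0) *s p 0 ?j 0 + (\<omega> 0 ?j 1 * s0 * u1) *s p 0 ?j 1
          + (\<omega> 1 ?j 0 * s1 * u0) *s p 1 ?j 0 + (\<omega> 1 ?j 1 * s1 * u1) *s p 1 ?j 1) = 0" for s0 s1 u0 u1
      unfolding patch[symmetric] tri Z_image(3)[OF \<sigma>V] dot_simps gV jne by simp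
    obtain \<kappa> where \<kappa>: "\<And>x y z w. ?F (x *s p 0 ?j 0 + y *s p 0 ?j 1 + z *s p 1 ?j 0 + w *s p 1 ?j 1)
          = \<kappa> * (\<omega> 0 ?j 1 * \<omega> 1 ?j 0 * x * w - \<omega> 0 ?j 0 * \<omega> 1 ?j 1 * y * z)"
      by (rule quadratic_form_vanishing_on_bilinear_image[OF homogeneous_2_eval[OF F(1)] Fvan \<omega>nz \<omega>nz \<omega>nz \<omega>nz])
         blast
    obtain \<mu> where \<mu>: "\<And>x y z w. ?q (x *s p 0 ?j 0 + y *s p 0 ?j 1 + z *s p 1 ?j 0 + w *s p 1 ?j 1)
          = \<mu> * (\<omega> 0 ?j 1 * \<omega> 1 ?j 0 * x * w - \<omega> 0 ?j 0 * \<omega> 1 ?j 1 * y * z)"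
      by (rule quadratic_form_vanishing_on_bilinear_image[OF quadratic_form_Z qvan \<omega>nz \<omega>nz \<omega>nz \<omega>nz])
         blast
    have "\<kappa> \<noteq> 0"
    proof
      assume "\<kappa> = 0"
      have "?F x = 0" for x
      proof -
        obtain x1 x2 x3 x4 where "x = x1 *s p 0 ?j 0 + x2 *s p 0 ?j 1 + x3 *s p 1 ?j 0 + x4 *s p 1 ?j 1"
          using T_indep[of ?j] by (rule indep4_span)
        then show ?thesis using \<kappa> \<open>\<kappa> = 0\<close> by simp
      qed
      then have "F ?j = 0" by (rule cpoly_eq_zero)
      then show False using F(2)[of ?j] by (simp add: irreducible_def)
    qed
    \<comment> \<open>Otherwise the quadric would vanish at every image point, against a generic
      choice of \<open>t\<close> and \<open>u\<close> with \<open>s = (0, 1)\<close>.\<close>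
    have "\<mu> \<noteq> 0"
    proof
      assume "\<mu> = 0"
      have q0: "?q x = 0" for x
      proof -
        obtain x1 x2 x3 x4 where "x = x1 *s p 0 ?j 0 + x2 *s p 0 ?j 1 + x3 *s p 1 ?j 0 + x4 *s p 1 ?j 1"
          using T_indep[of ?j] by (rule indep4_span)
        then show ?thesis using \<mu> \<open>\<mu> = 0\<close> by simp
      qed
      obtain k where k: "dot \<sigma> (p 0 0 k) \<noteq> 0" using p0_off_plane[OF \<sigma>, of 0] by blast
      obtain T U :: "2 \<Rightarrow> complex" where TU: "U 0 \<noteq> U 1" "\<And>j. T j \<noteq> 0"
        "(\<Sum>j\<in>UNIV. \<Sum>k\<in>UNIV. T j * U k * dot \<sigma> (p 0 j k)) \<noteq> 0"
        by (rule generic_values[of "\<lambda>j k. dot \<sigma> (p 0 j k)", OF k]) blast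
      define t u where "t = (\<chi> j. T j / \<beta> j)" and "u = (\<chi> k. U k / \<gamma> k)"
      have "?q (trisum \<omega> p (axis 1 1) t u) = 0" by (rule q0)
      then have "dot \<sigma> (\<Phi> (V t u)) * (\<alpha> 1 * \<alpha> 1) * (T j * (U 0 - U 1)) = 0"
        unfolding tri Z_image(3)[OF \<sigma>V] dot_simps gV using nz' by (simp add: t_def u_def)
      moreover have "dot \<sigma> (\<Phi> (V t u)) = (\<Sum>j\<in>UNIV. \<Sum>k\<in>UNIV. T j * U k * dot \<sigma> (p 0 j k))"
        using nz' by (simp add: V_def sum_two \<Phi>_lin \<Phi>_p dot_simps t_def u_def)
      ultimately show False using TU nz' by simp
    qed
    have "?q x = \<mu> / \<kappa> * ?F x" for x
    proof -
      obtain x1 x2 x3 x4 where x: "x = x1 *s p 0 ?j 0 + x2 *s p 0 ?j 1 + x3 *s p 1 ?j 0 + x4 *s p 1 ?j 1"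
        using T_indep[of ?j] by (rule indep4_span)
      show ?thesis unfolding x \<kappa> \<mu> using \<open>\<kappa> \<noteq> 0\<close> by simp
    qed
    then show ?thesis using \<open>\<mu> \<noteq> 0\<close> \<open>\<kappa> \<noteq> 0\<close> by (intro exI[of _ "\<mu> / \<kappa>"]) auto
  qed
  then obtain c where c: "\<And>j. c j \<noteq> 0" "\<And>j x. dot (g j) (Z \<sigma> x) = c j * cpoly_eval (F (j + 1)) x"
    by metis
  define B where "B j = Poly_Mapping.single 0 (c j / \<beta> j) * F (j + 1)" for j
  show ?thesis
  proof (rule that[of B g])
    show "homogeneous 2 (B j)" for j unfolding B_def by (intro homogeneous_const_mult F)
    show "no_common_factor (B 0) (B 1)"
      unfolding B_def using F(2,3) c(1) nz' by (intro no_common_factor_irreducible) auto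
    show "cpoly_eval (B j) x = dot (g j) (Z \<sigma> x) / \<beta> j" for j x
      by (simp add: B_def cpoly_eval_mult c(2))
  qed (rule g)
qed

text \<open>The inverse of the quadratic Cremona map \<open>v \<mapsto> (g v, h v)\<close> of the plane \<open>\<sigma>\<close>.\<close>

lemma plane_inverse:
  assumes \<sigma>: "\<sigma> \<noteq> 0" "\<And>j k. dot \<sigma> (p 1 j k) = 0" and z: "dot \<sigma> z = 0"
    and g: "\<And>j j' k. dot (g j) (p 1 j' k) = (if j' = j then (if k = 0 then 1 else -1) else 0)"
    and h: "\<And>k j k'. dot (h k) (p 1 j k') = (if k' = k then (if j = 0 then 1 else -1) else 0)"
  obtains c where "(\<Sum>j\<in>UNIV. \<Sum>k\<in>UNIV. (dot (g j) z * dot (h k) z) *s p 1 j k) = c *s z"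
proof -
  obtain x y w where v: "z = x *s p 1 0 0 + y *s p 1 0 1 + w *s p 1 1 0"
    using plane_span[OF \<sigma> z] by blast
  have gz: "dot (g 0) z = x - y" "dot (g 1) z = w" "dot (h 0) z = x - w" "dot (h 1) z = y"
    by (simp_all add: v dot_simps g h)
  have "(\<Sum>j\<in>UNIV. \<Sum>k\<in>UNIV. (dot (g j) z * dot (h k) z) *s p 1 j k) = (x - y - w) *s z"
    unfolding sum_two gz last_point unfolding v by (simp add: vec_eq_iff algebra_simps)
  then show ?thesis using that by blast
qed

text \<open>\<open>F\<close> and \<open>G\<close> are the equations of the boundary quadrics;
  rescaled, they become the quadratic components of the inverse, and their irreducibility gives
  coprimality.\<close>

lemma rank_one_imp_birational:
  assumes \<omega>: "\<And>i j k. \<omega> i j k = \<alpha> i * \<beta> j * \<gamma> k"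
    and nz': "\<And>i. \<alpha> i \<noteq> 0" "\<And>j. \<beta> j \<noteq> 0" "\<And>k. \<gamma> k \<noteq> 0"
    and F: "\<And>j. homogeneous 2 (F j)" "\<And>j. irreducible (F j)" "zeros (F 0) \<noteq> zeros (F (1 :: 2))"
      "\<And>s j u. cpoly_eval (F j) (trisum \<omega> p s (axis j 1) u) = 0"
    and G: "\<And>k. homogeneous 2 (G k)" "\<And>k. irreducible (G k)" "zeros (G 0) \<noteq> zeros (G (1 :: 2))"
      "\<And>s t k. cpoly_eval (G k) (trisum \<omega> p s t (axis k 1)) = 0"
    and w: "\<And>s t u. trilin w P s t u = trisum \<omega> p s t u"
  shows "birational_of_type w P (1, 2, 2)"
proof -
  interpret tr: scaffold_homology "\<lambda>i j k. p i k j" \<Phi> a b by (rule transpose_homology)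
  obtain \<sigma> where \<sigma>: "\<sigma> \<noteq> 0" "\<And>j k. dot \<sigma> (p 1 j k) = 0" using plane_exists[of 1] by blast
  obtain B g where B: "\<And>j. homogeneous 2 (B j)" "no_common_factor (B 0) (B (1 :: 2))"
    "\<And>j x. cpoly_eval (B j) x = dot (g j) (Z \<sigma> x) / \<beta> j"
    and g: "\<And>j j' k. dot (g j) (p 1 j' k) = (if j' = j then (if k = 0 then 1 else -1) else 0)"
    using inverse_quadrics[OF \<sigma> \<omega> nz' F] by blast
  have \<omega>': "\<omega> i k j = \<alpha> i * \<gamma> j * \<beta> k" for i j k by (simp add: \<omega>)
  have G4: "cpoly_eval (G k) (trisum (\<lambda>i j k. \<omega> i k j) (\<lambda>i j k. p i k j) s (axis k 1) u) = 0" for s k u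
    using G(4)[of k s u] trisum_transpose[of \<omega> p s "axis k 1" u] by simp
  obtain C h where C: "\<And>k. homogeneous 2 (C k)" "no_common_factor (C 0) (C (1 :: 2))"
    "\<And>k x. cpoly_eval (C k) x = dot (h k) (Z \<sigma> x) / \<gamma> k"
    and h: "\<And>k k' j. dot (h k) (p 1 j k') = (if k' = k then (if j = 0 then 1 else -1) else 0)"
    using tr.inverse_quadrics[OF \<sigma> \<omega>' nz'(1,3,2) G(1-3) G4] by blast
  obtain \<tau> where \<tau>: "\<And>x. dot \<sigma> (\<Psi> x) = dot \<tau> x" by (rule linear_map_dot[OF lin_\<Psi>]) blast
  \<comment> \<open>By \<open>Z_image\<close> the two forms stand in the ratio
    \<open>\<alpha> 0 * s $ 0 : \<alpha> 1 * s $ 1\<close>; the divisions leave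
    \<open>s\<close>.\<close>
  define A where "A i = linear_poly (if i = 0 then (1 / \<alpha> 0) *s \<sigma> else (- 1 / \<alpha> 1) *s \<tau>)" for i :: 2
  have A: "cpoly_eval (A 0) x = dot \<sigma> x / \<alpha> 0" "cpoly_eval (A 1) x = - dot \<sigma> (\<Psi> x) / \<alpha> 1" for x
    by (simp_all add: A_def dot_simps \<tau>)
  obtain k where k: "dot \<sigma> (p 0 0 k) \<noteq> 0" using p0_off_plane[OF \<sigma>, of 0] by blast
  have "no_common_factor (A 0) (A 1)"
  proof -
    let ?n = "dot \<sigma> (p 0 0 k)"
    have 0: "dot \<tau> (p 0 0 k) = 0"
      unfolding \<tau>[symmetric] \<Phi>_p[symmetric] \<Psi>_\<Phi> by (simp add: dot_simps \<sigma>)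
    have 1: "dot \<tau> (p 1 0 k) = - ?n"
      unfolding \<tau>[symmetric] conjugate_def by (simp add: dot_simps \<sigma> \<Phi>_p)
    have "no_common_factor (linear_poly ((1 / \<alpha> 0) *s \<sigma>)) (linear_poly ((- 1 / \<alpha> 1) *s \<tau>))"
      by (rule no_common_factor_linear[of _ "(\<alpha> 0 / ?n) *s p 0 0 k" _ "(\<alpha> 1 / ?n) *s p 1 0 k"])
         (use k nz' in \<open>simp_all add: dot_simps 0 1 \<sigma>\<close>)
    then show ?thesis by (simp add: A_def)
  qed
  moreover have "homogeneous 1 (A i)" for i unfolding A_def by (rule homogeneous_linear_poly)
  moreover have "rational_inverse w P A B C"
  proof -
    define V where "V t u = (\<Sum>j\<in>UNIV. \<Sum>k\<in>UNIV. ((\<beta> j * t $ j) * (\<gamma> k * u $ k)) *s p 1 j k)"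
      for t u :: "complex ^ 2"
    have tri: "trilin w P s t u = (\<alpha> 0 * s $ 0) *s \<Phi> (V t u) + (\<alpha> 1 * s $ 1) *s V t u" for s t u
      unfolding V_def w by (rule trisum_rank_one[OF \<omega>])
    have \<sigma>V: "dot \<sigma> (V t u) = 0" for t u by (simp add: V_def sum_two dot_simps \<sigma>)
    have gV: "dot (g j) (V t u) = \<beta> j * t $ j * (\<gamma> 0 * u $ 0 - \<gamma> 1 * u $ 1)" for j t u
      using two_cases[of j] by (auto simp: V_def sum_two dot_simps g algebra_simps)
    have hV: "dot (h k) (V t u) = \<gamma> k * u $ k * (\<beta> 0 * t $ 0 - \<beta> 1 * t $ 1)" for k t u
      using two_cases[of k] by (auto simp: V_def sum_two dot_simps h algebra_simps)
    define N where "N t u = dot \<sigma> (\<Phi> (V t u))" for t u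
    define M where "M s t u = N t u * ((a * (\<alpha> 0 * s $ 0) + \<alpha> 1 * s $ 1) * (b * (\<alpha> 0 * s $ 0) + \<alpha> 1 * s $ 1))"
      for s :: "complex ^ 2" and t u
    have ZT: "Z \<sigma> (trilin w P s t u) = M s t u *s V t u" for s t u
      unfolding tri M_def N_def by (rule Z_image(3)[OF \<sigma>V])
    have evA: "eval_pair A (trilin w P s t u) = N t u *s s" for s t u
    proof -
      have "cpoly_eval (A i) (trilin w P s t u) = N t u * s $ i" for i
      proof (induction i rule: two_induct)
        case 1
        show ?case unfolding A(1) tri Z_image(1)[OF \<sigma>V] N_def using nz' by simp
      next
        case 2
        show ?case unfolding A(2) tri Z_image(2)[OF \<sigma>V] N_def using nz' by simp
      qed
      then show ?thesis by (simp add: eval_pair_def vec_eq_iff)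
    qed
    have evB: "eval_pair B (trilin w P s t u) = (M s t u * (\<gamma> 0 * u $ 0 - \<gamma> 1 * u $ 1)) *s t" for s t u
      using nz' by (simp add: eval_pair_def B ZT dot_simps gV vec_eq_iff)
    have evC: "eval_pair C (trilin w P s t u) = (M s t u * (\<beta> 0 * t $ 0 - \<beta> 1 * t $ 1)) *s u" for s t u
      using nz' by (simp add: eval_pair_def C ZT dot_simps hV vec_eq_iff)
    have composite: "\<exists>c. trilin w P (eval_pair A x) (eval_pair B x) (eval_pair C x) = c *s x" for x
    proof -
      let ?z = "Z \<sigma> x" and ?A0 = "dot \<sigma> x" and ?A1 = "- dot \<sigma> (\<Psi> x)"
      have "dot \<sigma> ?z = 0" by (simp add: plane_part_def dot_simps)
      then obtain c where c: "(\<Sum>j\<in>UNIV. \<Sum>k\<in>UNIV. (dot (g j) ?z * dot (h k) ?z) *s p 1 j k) = c *s ?z"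
        by (rule plane_inverse[OF \<sigma> _ g h])
      have V: "V (eval_pair B x) (eval_pair C x) = c *s ?z"
        unfolding c[symmetric] V_def using nz' by (simp add: eval_pair_def B C)
      have "trilin w P (eval_pair A x) (eval_pair B x) (eval_pair C x)
          = ?A0 *s \<Phi> (c *s ?z) + ?A1 *s (c *s ?z)"
        unfolding tri V using nz' by (simp add: eval_pair_def A)
      \<comment> \<open>\<open>?z\<close> is \<open>?A0 *s \<Psi> x + ?A1 *s x\<close>, so applying
        \<open>?A0 \<Phi> + ?A1\<close> gives a product of conjugates, a scalar.\<close>
      also have "\<dots> = (c * ((a * ?A0 + ?A1) * (b * ?A0 + ?A1))) *s x"
        unfolding plane_part_def \<Phi>_lin \<Phi>_\<Psi> by (simp add: conjugate_def vec_eq_iff algebra_simps)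
      finally show ?thesis by blast
    qed
    obtain T U :: "2 \<Rightarrow> complex" where TU: "T 0 \<noteq> T 1" "U 0 \<noteq> U 1" "\<And>j. T j \<noteq> 0" "\<And>k. U k \<noteq> 0"
      "(\<Sum>j\<in>UNIV. \<Sum>k\<in>UNIV. T j * U k * dot \<sigma> (p 0 j k)) \<noteq> 0"
      by (rule generic_values[of "\<lambda>j k. dot \<sigma> (p 0 j k)", OF k]) blast
    \<comment> \<open>At \<open>s = (0, 1)\<close> the two linear factors in \<open>M\<close> are
      just \<open>\<alpha> 1\<close>, so only \<open>N t u\<close> must be made nonzero.\<close>
    define s t u :: "complex ^ 2"
      where "s = axis 1 1" and "t = (\<chi> j. T j / \<beta> j)" and "u = (\<chi> k. U k / \<gamma> k)"
    have "N t u = (\<Sum>j\<in>UNIV. \<Sum>k\<in>UNIV. T j * U k * dot \<sigma> (p 0 j k))"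
      using nz' by (simp add: N_def V_def sum_two \<Phi>_lin \<Phi>_p dot_simps t_def u_def)
    then have Nnz: "N t u \<noteq> 0" using TU by simp
    then have Mnz: "M s t u \<noteq> 0" using nz' by (simp add: M_def s_def)
    have stu: "s \<noteq> 0" "t \<noteq> 0" "u \<noteq> 0"
      using TU(3,4)[of 0] nz' by (auto simp: s_def t_def u_def vec_eq_iff all_two)
    have diff: "\<gamma> 0 * u $ 0 - \<gamma> 1 * u $ 1 \<noteq> 0" "\<beta> 0 * t $ 0 - \<beta> 1 * t $ 1 \<noteq> 0"
      using TU(1,2) nz' by (simp_all add: t_def u_def)
    define x where "x = trilin w P s t u"
    have ev: "eval_pair A x \<noteq> 0" "eval_pair B x \<noteq> 0" "eval_pair C x \<noteq> 0"
      unfolding x_def evA evB evC using Nnz Mnz stu diff by auto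
    have "x \<noteq> 0"
    proof
      assume "x = 0"
      have "cpoly_eval (A i) 0 = 0" for i using two_cases[of i] by (auto simp: A \<Psi>_lin)
      then show False using ev(1) \<open>x = 0\<close> by (simp add: eval_pair_def vec_eq_iff)
    qed
    have image_nz: "trilin w P (eval_pair A x) (eval_pair B x) (eval_pair C x) \<noteq> 0"
    proof -
      have lin3: "trilin w P (c1 *s s) (c2 *s t) (c3 *s u) = (c1 * c2 * c3) *s trilin w P s t u" for c1 c2 c3
        unfolding trilin_def sum_two by (simp add: vec_eq_iff algebra_simps)
      show ?thesis
        unfolding x_def evA evB evC lin3 using Nnz Mnz diff \<open>x \<noteq> 0\<close> by (simp add: x_def)
    qed
    show ?thesis
      unfolding rational_inverse_def Let_def
    proof (intro conjI)
      show "{(s, t, u). s \<noteq> 0 \<and> t \<noteq> 0 \<and> u \<noteq> 0 \<and> trilin w P s t u \<noteq> 0 \<and>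
                 eval_pair A (trilin w P s t u) \<noteq> 0 \<and> eval_pair B (trilin w P s t u) \<noteq> 0 \<and>
                 eval_pair C (trilin w P s t u) \<noteq> 0} \<noteq> {}"
        using stu ev \<open>x \<noteq> 0\<close> unfolding x_def by blast
      show "{x. x \<noteq> 0 \<and> eval_pair A x \<noteq> 0 \<and> eval_pair B x \<noteq> 0 \<and> eval_pair C x \<noteq> 0 \<and>
                 trilin w P (eval_pair A x) (eval_pair B x) (eval_pair C x) \<noteq> 0} \<noteq> {}"
        using image_nz ev \<open>x \<noteq> 0\<close> by blast
      show "\<forall>(s, t, u)\<in>{(s, t, u). s \<noteq> 0 \<and> t \<noteq> 0 \<and> u \<noteq> 0 \<and> trilin w P s t u \<noteq> 0 \<and>
                 eval_pair A (trilin w P s t u) \<noteq> 0 \<and> eval_pair B (trilin w P s t u) \<noteq> 0 \<and>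
                 eval_pair C (trilin w P s t u) \<noteq> 0}.
          pt (eval_pair A (trilin w P s t u)) = pt s \<and> pt (eval_pair B (trilin w P s t u)) = pt t \<and>
          pt (eval_pair C (trilin w P s t u)) = pt u"
        unfolding evA evB evC by (auto intro!: pt_scale)
      show "\<forall>x\<in>{x. x \<noteq> 0 \<and> eval_pair A x \<noteq> 0 \<and> eval_pair B x \<noteq> 0 \<and> eval_pair C x \<noteq> 0 \<and>
                 trilin w P (eval_pair A x) (eval_pair B x) (eval_pair C x) \<noteq> 0}.
          pt (trilin w P (eval_pair A x) (eval_pair B x) (eval_pair C x)) = pt x"
        using composite pt_scale by (metis (mono_tags, lifting) mem_Collect_eq)
    qed
  qed
  ultimately show ?thesis
    unfolding birational_of_type_def using B(1,2) C(1,2) by blast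
qed

end

section \<open>Rank one from the rational inverse\<close>

lemma trisum_axis: "trisum \<omega> p (axis i 1) (axis j 1) (axis k 1) = \<omega> i j k *s p i j k"
  using two_cases[of i] two_cases[of j] two_cases[of k] by (auto simp: trisum_def sum_two)

lemma pt_eq_cross:
  fixes x y :: "complex ^ 2"
  assumes "pt x = pt y" "x \<noteq> 0" "y \<noteq> 0"
  shows "x $ 0 * y $ 1 = x $ 1 * y $ 0"
  using assms pt_eq_iff[of x y] by auto

text \<open>On every line through a point where both maps are defined the cross products vanish outside a
  finite set, hence identically.\<close>

lemma rational_inverse_cross:
  assumes "rational_inverse w P A B C"
  shows "cpoly_eval (A 0) (trilin w P s t u) * s $ 1 = cpoly_eval (A 1) (trilin w P s t u) * s $ 0"
    and "cpoly_eval (B 0) (trilin w P s t u) * t $ 1 = cpoly_eval (B 1) (trilin w P s t u) * t $ 0"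
    and "\<exists>x i. cpoly_eval (A i) x \<noteq> 0" and "\<exists>x j. cpoly_eval (B j) x \<noteq> 0"
proof -
  define D where "D s t u \<longleftrightarrow> s \<noteq> 0 \<and> t \<noteq> 0 \<and> u \<noteq> 0 \<and> trilin w P s t u \<noteq> 0 \<and>
      eval_pair A (trilin w P s t u) \<noteq> 0 \<and> eval_pair B (trilin w P s t u) \<noteq> 0 \<and>
      eval_pair C (trilin w P s t u) \<noteq> 0" for s t u
  have inv: "pt (eval_pair A (trilin w P s t u)) = pt s" "pt (eval_pair B (trilin w P s t u)) = pt t"
    if "D s t u" for s t u
    using assms that unfolding rational_inverse_def Let_def D_def by auto
  obtain s0 t0 u0 where D0: "D s0 t0 u0"
    using assms unfolding rational_inverse_def Let_def D_def by auto
  have nz: "\<exists>i. x $ i \<noteq> 0" if "x \<noteq> 0" for x :: "complex ^ 'n"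
    using that by (simp add: vec_eq_iff)
  obtain i1 i2 i3 i4 i5 i6 i7 where nzs: "s0 $ i1 \<noteq> 0" "t0 $ i2 \<noteq> 0" "u0 $ i3 \<noteq> 0"
    "trilin w P s0 t0 u0 $ i4 \<noteq> 0" "eval_pair A (trilin w P s0 t0 u0) $ i5 \<noteq> 0"
    "eval_pair B (trilin w P s0 t0 u0) $ i6 \<noteq> 0" "eval_pair C (trilin w P s0 t0 u0) $ i7 \<noteq> 0"
    using D0 nz unfolding D_def by meson
  show "\<exists>x i. cpoly_eval (A i) x \<noteq> 0" "\<exists>x j. cpoly_eval (B j) x \<noteq> 0"
    using nzs(5,6) by (auto simp: eval_pair_def)
  define line where "line x0 x z = x0 + z *s (x - x0)" for x0 x :: "complex ^ 2" and z
  have line: "line x0 x 0 = x0" "line x0 x 1 = x" "polyfun (\<lambda>z. line x0 x z $ i)" for x0 x i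
    by (simp_all add: line_def polyfun_intros)
  define f where "f z = trilin w P (line s0 s z) (line t0 t z) (line u0 u z)" for z
  have pf: "polyfun (\<lambda>z. f z $ i)" for i
    unfolding f_def trilin_def by (simp add: polyfun_intros line)
  \<comment> \<open>One nonvanishing coordinate of each vector that must be nonzero: where this
    polynomial is nonzero, all maps are defined.\<close>
  define pr where "pr z = line s0 s z $ i1 * line t0 t z $ i2 * line u0 u z $ i3 * f z $ i4 *
      eval_pair A (f z) $ i5 * eval_pair B (f z) $ i6 * eval_pair C (f z) $ i7" for z
  have pr: "polyfun pr"
    unfolding pr_def eval_pair_def by (simp add: polyfun_intros line pf)
  have pr0: "pr 0 \<noteq> 0" using nzs by (simp add: pr_def f_def line)
  have D: "D (line s0 s z) (line t0 t z) (line u0 u z)" if "pr z \<noteq> 0" for z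
    using that unfolding D_def pr_def f_def by auto
  define IA where "IA z = cpoly_eval (A 0) (f z) * line s0 s z $ 1 - cpoly_eval (A 1) (f z) * line s0 s z $ 0" for z
  define IB where "IB z = cpoly_eval (B 0) (f z) * line t0 t z $ 1 - cpoly_eval (B 1) (f z) * line t0 t z $ 0" for z
  have "polyfun IA" unfolding IA_def by (intro polyfun_intros pf line)
  moreover have "IA z = 0" if "pr z \<noteq> 0" for z
    using pt_eq_cross[OF inv(1)[OF D[OF that]]] D[OF that]
    by (auto simp: IA_def f_def D_def eval_pair_def)
  ultimately have "IA 1 = 0" using polyfun_eq_zero[OF pr _ _ pr0] by blast
  then show "cpoly_eval (A 0) (trilin w P s t u) * s $ 1 = cpoly_eval (A 1) (trilin w P s t u) * s $ 0"
    by (simp add: IA_def f_def line)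
  have "polyfun IB" unfolding IB_def by (intro polyfun_intros pf line)
  moreover have "IB z = 0" if "pr z \<noteq> 0" for z
    using pt_eq_cross[OF inv(2)[OF D[OF that]]] D[OF that]
    by (auto simp: IB_def f_def D_def eval_pair_def)
  ultimately have "IB 1 = 0" using polyfun_eq_zero[OF pr _ _ pr0] by blast
  then show "cpoly_eval (B 0) (trilin w P s t u) * t $ 1 = cpoly_eval (B 1) (trilin w P s t u) * t $ 0"
    by (simp add: IB_def f_def line)
qed

text \<open>For \<open>X 0 0 0 \<noteq> 0\<close> this is rank one cleared of denominators: the
  three edges at the corner \<open>0 0 0\<close> determine the tensor.\<close>

definition minors_vanish :: "(2 \<Rightarrow> 2 \<Rightarrow> 2 \<Rightarrow> 'a :: field) \<Rightarrow> bool" where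
  "minors_vanish X \<longleftrightarrow> (\<forall>i j k. X i j k * (X 0 0 0)\<^sup>2 = X i 0 0 * X 0 j 0 * X 0 0 k)"

lemma span_pair: "v \<in> vec.span {x, y} \<longleftrightarrow> (\<exists>a b. v = a *s x + b *s (y :: complex ^ 'n))"
  by (auto simp: vec.span_breakdown_eq algebra_simps)

context scaffold_homology
begin

text \<open>The forms \<open>A 0\<close> and \<open>A 1\<close> are the equations of the planar boundary surfaces, which fixes the ratio
  \<open>\<omega> 0 j k / \<omega> 1 j k\<close> whenever the line \<open>s\<^sub>j\<^sub>k\<close> differs from the intersection of the two planes. At most
  one index is exceptional, and there the ratio follows from the rank-one slices.\<close>

lemma birational_imp_minors_vanish:
  assumes \<omega>: "\<And>i j k. \<omega> i j k \<noteq> 0"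
    and w: "\<And>s t u. trilin w P s t u = trisum \<omega> p s t u"
    and bir: "birational_of_type w P (1, 2, 2)"
    and lines: "\<And>j k j' k'. vec.span {p 0 j k, p 1 j k} = vec.span {p 0 j' k', p 1 j' k'} \<Longrightarrow> j = j' \<and> k = k'"
  shows "minors_vanish \<omega>"
proof -
  obtain A B C where hom: "\<And>i. homogeneous 1 (A i)" "\<And>j. homogeneous 2 (B j)"
    and inv: "rational_inverse w P A B C"
    using bir unfolding birational_of_type_def by auto
  note cross = rational_inverse_cross[OF inv, unfolded w]
  have slice: "\<omega> i 0 0 * \<omega> i 1 1 = \<omega> i 0 1 * \<omega> i 1 0" for i
    by (rule inverse_imp_slice_rank_one[OF \<omega> hom(2) cross(2,4)])
  obtain h0 where h0: "\<And>x. cpoly_eval (A 0) x = dot h0 x" using homogeneous_1_eval[OF hom(1)[of 0]] by blast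
  obtain h1 where h1: "\<And>x. cpoly_eval (A 1) x = dot h1 x" using homogeneous_1_eval[OF hom(1)[of 1]] by blast
  note crossA = cross(1)[unfolded h0 h1]
  \<comment> \<open>At corners with \<open>s = (1, 0)\<close> the cross identity says that
    \<open>A 1\<close> vanishes, and with \<open>s = (0, 1)\<close> that \<open>A 0\<close>
    does.\<close>
  have h1p: "dot h1 (p 0 j k) = 0" for j k
    using crossA[of "axis 0 1" "axis j 1" "axis k 1"] \<omega>[of 0 j k] unfolding trisum_axis
    by (simp add: dot_simps)
  have h0p: "dot h0 (p 1 j k) = 0" for j k
    using crossA[of "axis 1 1" "axis j 1" "axis k 1"] \<omega>[of 1 j k] unfolding trisum_axis
    by (simp add: dot_simps)
  have rel: "\<omega> 0 j k * dot h0 (p 0 j k) = \<omega> 1 j k * dot h1 (p 1 j k)" for j k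
  proof -
    have "trisum \<omega> p (axis 0 1 + axis 1 1) (axis j 1) (axis k 1)
        = trisum \<omega> p (axis 0 1) (axis j 1) (axis k 1) + trisum \<omega> p (axis 1 1) (axis j 1) (axis k 1)"
      by (simp add: trisum_def sum_two vec_eq_iff algebra_simps)
    then show ?thesis
      using crossA[of "axis 0 1 + axis 1 1" "axis j 1" "axis k 1"]
      unfolding trisum_axis by (simp add: dot_simps h0p h1p)
  qed
  have "h0 \<noteq> 0"
  proof
    assume "h0 = 0"
    then have "dot h1 (p 1 j k) = 0" for j k using rel[of j k] \<omega> by simp
    then have "h1 = 0" using indep4_annihilator[OF T_indep[of 0]] h1p by blast
    then have "cpoly_eval (A i) x = 0" for i x
      using two_cases[of i] \<open>h0 = 0\<close> by (auto simp: h0 h1)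
    then show False using cross(3) by blast
  qed
  obtain d where d: "dot h0 d = 1" "indep4 (p 1 0 0) (p 1 0 1) (p 1 1 0) d"
    using plane_coordinates[OF \<open>h0 \<noteq> 0\<close> h0p] by blast
  \<comment> \<open>\<open>h1\<close> vanishes on Sigma_0, which is the image of Sigma_1 under
    \<Phi>; so \<open>h1 \<circ> \<Phi>\<close> vanishes on Sigma_1 and is a multiple of
    \<open>h0\<close>.\<close>
  have proportional: "dot h1 (\<Phi> x) = dot h1 (\<Phi> d) * dot h0 x" for x
  proof -
    obtain x1 x2 x3 x4 where x: "x = x1 *s p 1 0 0 + x2 *s p 1 0 1 + x3 *s p 1 1 0 + x4 *s d"
      using d(2) by (rule indep4_span)
    show ?thesis unfolding x by (simp add: \<Phi>_lin \<Phi>_p dot_simps h1p h0p d(1))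
  qed
  define \<kappa> where "\<kappa> = - dot h1 (\<Phi> d) / (a * b)"
  have \<kappa>: "dot h1 (p 1 j k) = \<kappa> * dot h0 (p 0 j k)" for j k
  proof -
    have "- (a * b) * dot h1 (p 1 j k) = dot h1 (\<Phi> d) * dot h0 (p 0 j k)"
      using proportional[of "p 0 j k"] unfolding \<Phi>_p[symmetric] \<Phi>_quad
      by (simp add: dot_simps \<Phi>_p h1p)
    then have "a * b * dot h1 (p 1 j k) = - dot h1 (\<Phi> d) * dot h0 (p 0 j k)" by algebra
    then show ?thesis using nz by (simp add: \<kappa>_def field_simps)
  qed
  have "\<kappa> \<noteq> 0"
  proof
    assume "\<kappa> = 0"
    then have "dot h0 (p 0 j k) = 0" for j k using rel[of j k] \<kappa> \<omega> by simp
    then show False using p0_off_plane[OF \<open>h0 \<noteq> 0\<close> h0p] by blast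
  qed
  have axis_line: "vec.span {p 0 j k, p 1 j k} = {v. dot h0 v = 0 \<and> dot h1 v = 0}"
    if n: "dot h0 (p 0 j k) = 0" for j k
  proof (intro set_eqI iffI)
    fix v assume "v \<in> vec.span {p 0 j k, p 1 j k}"
    then show "v \<in> {v. dot h0 v = 0 \<and> dot h1 v = 0}"
      using n by (auto simp: span_pair dot_simps h0p h1p \<kappa>)
  next
    fix v assume v0: "v \<in> {v. dot h0 v = 0 \<and> dot h1 v = 0}"
    obtain x y z w where v: "v = x *s p 0 j 0 + y *s p 0 j 1 + z *s p 1 j 0 + w *s p 1 j 1"
      using T_indep[of j] by (rule indep4_span)
    consider "k = 0" | "k = 1" using two_cases by blast
    then show "v \<in> vec.span {p 0 j k, p 1 j k}"
    proof cases
      case 1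
      then have "dot h0 (p 0 j 1) \<noteq> 0" using n p0_off_plane[OF \<open>h0 \<noteq> 0\<close> h0p, of j] by auto
      then have "y = 0" "w = 0"
        using v0 n 1 \<open>\<kappa> \<noteq> 0\<close> unfolding v by (auto simp: dot_simps h0p h1p \<kappa>)
      then show ?thesis using v 1 by (auto simp: span_pair)
    next
      case 2
      then have "dot h0 (p 0 j 0) \<noteq> 0" using n p0_off_plane[OF \<open>h0 \<noteq> 0\<close> h0p, of j] by auto
      then have "x = 0" "z = 0"
        using v0 n 2 \<open>\<kappa> \<noteq> 0\<close> unfolding v by (auto simp: dot_simps h0p h1p \<kappa>)
      then show ?thesis using v 2 by (auto simp: span_pair)
    qed
  qed
  have ratio': "\<omega> 0 j k = \<kappa> * \<omega> 1 j k" if "dot h0 (p 0 j k) \<noteq> 0" for j k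
    using rel[of j k] that unfolding \<kappa> by simp
  have slice': "\<omega> i j k * \<omega> i (j + 1) (k + 1) = \<omega> i j (k + 1) * \<omega> i (j + 1) k" for i j k
    using slice[of i] two_cases[of j] two_cases[of k] by (auto simp: mult.commute)
  have ratio: "\<omega> 0 j k = \<kappa> * \<omega> 1 j k" for j k
  proof (cases "dot h0 (p 0 j k) = 0")
    case True
    have "dot h0 (p 0 j' k') \<noteq> 0" if "j' \<noteq> j \<or> k' \<noteq> k" for j' k'
    proof
      assume "dot h0 (p 0 j' k') = 0"
      then have "vec.span {p 0 j k, p 1 j k} = vec.span {p 0 j' k', p 1 j' k'}"
        using axis_line[OF True] axis_line[of j' k'] by (simp only:)
      from lines[OF this] show False using that by blast
    qed
    then have r: "\<omega> 0 j (k + 1) = \<kappa> * \<omega> 1 j (k + 1)" "\<omega> 0 (j + 1) k = \<kappa> * \<omega> 1 (j + 1) k"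
      "\<omega> 0 (j + 1) (k + 1) = \<kappa> * \<omega> 1 (j + 1) (k + 1)"
      by (auto intro!: ratio')
    \<comment> \<open>Each slice has determinant zero, so its fourth entry is determined by the
      three whose ratio is known.\<close>
    have "\<kappa> * \<omega> 1 (j + 1) (k + 1) * \<omega> 0 j k = \<kappa> * \<omega> 1 (j + 1) (k + 1) * (\<kappa> * \<omega> 1 j k)"
      using slice'[of 0 j k] slice'[of 1 j k] unfolding r by algebra
    then show ?thesis using \<open>\<kappa> \<noteq> 0\<close> \<omega> by simp
  qed (rule ratio')
  show ?thesis
    unfolding minors_vanish_def
  proof (intro allI)
    fix i j k
    show "\<omega> i j k * (\<omega> 0 0 0)\<^sup>2 = \<omega> i 0 0 * \<omega> 0 j 0 * \<omega> 0 0 k"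
    proof (induction i rule: two_induct)
      case 1
      show ?case using two_cases[of j] two_cases[of k] slice[of 0]
        by (auto simp: power2_eq_square mult.commute mult.left_commute)
    next
      case 2
      show ?case unfolding ratio using two_cases[of j] two_cases[of k] slice[of 1]
        by (auto simp: power2_eq_square mult.commute mult.left_commute)
    qed
  qed
qed

end

section \<open>Rank-one tensors over the reals and over the complex numbers\<close>

lemma minors_vanish_factor:
  assumes "minors_vanish X" "X 0 0 0 \<noteq> 0"
  shows "X i j k = X i 0 0 * (X 0 j 0 / X 0 0 0) * (X 0 0 k / X 0 0 0)"
proof -
  have "X i 0 0 * (X 0 j 0 / X 0 0 0) * (X 0 0 k / X 0 0 0) = (X i 0 0 * X 0 j 0 * X 0 0 k) / (X 0 0 0)\<^sup>2"
    by (simp add: power2_eq_square)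
  also have "X i 0 0 * X 0 j 0 * X 0 0 k = X i j k * (X 0 0 0)\<^sup>2"
    using assms(1) unfolding minors_vanish_def by metis
  finally show ?thesis using assms(2) by simp
qed

lemma rank_one_iff_minors_vanish:
  fixes W :: tensor
  assumes "\<And>i j k. W i j k \<noteq> 0"
  shows "rank_one W \<longleftrightarrow> minors_vanish W"
proof
  assume "rank_one W"
  then obtain \<alpha> \<beta> \<gamma> :: "real ^ 2" where "\<And>i j k. W i j k = \<alpha> $ i * \<beta> $ j * \<gamma> $ k"
    unfolding rank_one_def by blast
  then show "minors_vanish W" by (simp add: minors_vanish_def power2_eq_square)
next
  assume "minors_vanish W"
  note factor = minors_vanish_factor[OF this assms]
  show "rank_one W"
    unfolding rank_one_def
  proof (intro exI conjI allI)
    show "W i j k = (\<chi> i. W i 0 0) $ i * (\<chi> j. W 0 j 0 / W 0 0 0) $ j * (\<chi> k. W 0 0 k / W 0 0 0) $ k" for i j k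
      using factor[of i j k] by simp
  qed (use assms in \<open>simp_all add: vec_eq_iff\<close>)
qed

text \<open>A tensor \<open>Y\<close> of rank one multiplies both sides of each identity by the same
  nonzero number.\<close>

lemma minors_vanish_scale:
  fixes X Y :: "2 \<Rightarrow> 2 \<Rightarrow> 2 \<Rightarrow> 'a :: field"
  assumes "\<And>i j k. Y i j k = \<epsilon> i * \<tau> j * \<delta> k" "\<And>i j k. Y i j k \<noteq> 0"
  shows "minors_vanish (\<lambda>i j k. X i j k * Y i j k) \<longleftrightarrow> minors_vanish X"
proof -
  have Y: "Y i j k * (Y 0 0 0)\<^sup>2 = Y i 0 0 * Y 0 j 0 * Y 0 0 k" for i j k
    by (simp add: assms(1) power2_eq_square)
  have "X i j k * Y i j k * (X 0 0 0 * Y 0 0 0)\<^sup>2 = X i 0 0 * Y i 0 0 * (X 0 j 0 * Y 0 j 0) * (X 0 0 k * Y 0 0 k)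
      \<longleftrightarrow> X i j k * (X 0 0 0)\<^sup>2 = X i 0 0 * X 0 j 0 * X 0 0 k" for i j k
  proof -
    have L: "X i j k * Y i j k * (X 0 0 0 * Y 0 0 0)\<^sup>2 = (Y i j k * (Y 0 0 0)\<^sup>2) * (X i j k * (X 0 0 0)\<^sup>2)"
      by (simp add: power2_eq_square)
    have R: "X i 0 0 * Y i 0 0 * (X 0 j 0 * Y 0 j 0) * (X 0 0 k * Y 0 0 k)
        = (Y i j k * (Y 0 0 0)\<^sup>2) * (X i 0 0 * X 0 j 0 * X 0 0 k)"
      unfolding Y by simp
    show ?thesis unfolding L R using assms(2) by simp
  qed
  then show ?thesis by (simp add: minors_vanish_def)
qed

lemma minors_vanish_of_real:
  "minors_vanish (\<lambda>i j k. complex_of_real (W i j k)) \<longleftrightarrow> minors_vanish W"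
  unfolding minors_vanish_def by (simp flip: of_real_mult of_real_power)

lemma dot_cvec: "dot (cvec a) (cvec x) = complex_of_real (a \<bullet> x)"
  by (simp add: dot_def cvec_def inner_vec_def)

lemma cvec_eq_zero_iff: "cvec a = 0 \<longleftrightarrow> a = 0"
  by (simp add: cvec_def vec_eq_iff)

section \<open>Lines joining points and closures of bilinear patches\<close>

lemma pt_in_proj_hull:
  assumes "x \<noteq> 0" "pt x \<in> S"
  shows "pt x \<in> proj_hull S"
  unfolding proj_hull_def projectivize_def using assms by (auto intro: vec.span_base)

lemma proj_hull_pair:
  assumes "a \<noteq> 0" "b \<noteq> 0"
  shows "proj_hull {pt a, pt b} = projectivize (vec.span {a, b})"
proof -
  have "vec.span {x. x \<noteq> 0 \<and> pt x \<in> {pt a, pt b}} = vec.span {a, b}"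
  proof (rule vec.span_eq[THEN iffD2], intro conjI subsetI)
    fix x assume "x \<in> {x. x \<noteq> 0 \<and> pt x \<in> {pt a, pt b}}"
    then have "(\<exists>c. x = c *s a) \<or> (\<exists>c. x = c *s b)"
      using pt_eq_iff[of a x] pt_eq_iff[of b x] assms by auto
    then show "x \<in> vec.span {a, b}" by (auto intro: vec.span_scale vec.span_base)
  next
    fix x assume "x \<in> {a, b}"
    then show "x \<in> vec.span {x. x \<noteq> 0 \<and> pt x \<in> {pt a, pt b}}"
      using assms by (auto intro: vec.span_base)
  qed
  then show ?thesis by (simp add: proj_hull_def)
qed

lemma span_pair_exchange:
  fixes u v w :: "complex ^ 'n"
  assumes "x *s u + y *s v + z *s w = 0" "y \<noteq> 0" "z \<noteq> 0"
  shows "vec.span {u, v} = vec.span {u, w}"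
proof -
  have e: "x * u $ i + y * v $ i + z * w $ i = 0" for i
    using arg_cong[OF assms(1), of "\<lambda>a. a $ i"] by simp
  have "y * v $ i = - x * u $ i - z * w $ i" for i using e[of i] by algebra
  then have v: "v = (- x / y) *s u + (- z / y) *s w"
    using assms(2) by (simp add: vec_eq_iff field_simps)
  have "z * w $ i = - x * u $ i - y * v $ i" for i using e[of i] by algebra
  then have w: "w = (- x / z) *s u + (- y / z) *s v"
    using assms(3) by (simp add: vec_eq_iff field_simps)
  have "v \<in> vec.span {u, w}" "w \<in> vec.span {u, v}"
    unfolding span_pair using v w by blast+
  then show ?thesis
    by (simp add: vec.span_eq vec.span_base)
qed

text \<open>If the four points were coplanar, the patch and with it its closure, an irreducible
  quadric, would lie in a plane. Applied to weighted control points, independence also shows that no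
  weight is zero.\<close>

lemma quadric_patch:
  fixes q :: "2 \<Rightarrow> 2 \<Rightarrow> complex ^ 4"
  defines "g s u \<equiv> \<Sum>i\<in>UNIV. \<Sum>k\<in>UNIV. ((s :: complex ^ 2) $ i * (u :: complex ^ 2) $ k) *s q i k"
  assumes S: "S = zariski_closure (projectivize {g s u | s u. s \<noteq> 0 \<and> u \<noteq> 0})" and "is_quadric S"
  obtains F where "homogeneous 2 F" "irreducible F" "zeros F = S" "\<And>s u. cpoly_eval F (g s u) = 0"
    "indep4 (q 0 0) (q 0 1) (q 1 0) (q 1 1)"
proof -
  obtain F where F: "homogeneous 2 F" "irreducible F" "S = zeros F"
    using assms(3) unfolding is_quadric_def by blast
  have "cpoly_eval F 0 = 0" using homogeneous_eval_scale[OF F(1), of 0 0] by simp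
  have "cpoly_eval F (g s u) = 0" for s u
  proof (cases "g s u = 0")
    case False
    then have "s \<noteq> 0" "u \<noteq> 0" by (auto simp: g_def)
    with False have "pt (g s u) \<in> projectivize {g s u | s u. s \<noteq> 0 \<and> u \<noteq> 0}"
      unfolding projectivize_def by blast
    then have "pt (g s u) \<in> zeros F" using zariski_closure_superset S F(3) by blast
    then show ?thesis using pt_in_zeros[OF F(1) False] by simp
  qed (simp add: \<open>cpoly_eval F 0 = 0\<close>)
  moreover have "indep4 (q 0 0) (q 0 1) (q 1 0) (q 1 1)"
  proof (rule ccontr)
    assume "\<not> ?thesis"
    then obtain h where h: "h \<noteq> 0" "dot h (q 0 0) = 0" "dot h (q 0 1) = 0" "dot h (q 1 0) = 0" "dot h (q 1 1) = 0"
      by (rule not_indep4_annihilator)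
    have hg: "dot h (g s u) = 0" for s u by (simp add: g_def sum_two dot_simps h)
    have "projectivize {g s u | s u. s \<noteq> 0 \<and> u \<noteq> 0} \<subseteq> zeros (linear_poly h)"
      unfolding zeros_def projectivize_def using hg by auto
    then have sub: "zeros F \<subseteq> zeros (linear_poly h)"
      using zariski_closure_subset_zeros[OF homogeneous_linear_poly] S F(3) by blast
    have "dot h x = 0" if "cpoly_eval F x = 0" for x
      using that sub pt_in_zeros[OF F(1), of x] pt_in_zeros[OF homogeneous_linear_poly, of x h]
      by (cases "x = 0") auto
    then show False using irreducible_quadric_not_in_plane[OF F(1,2) h(1)] by blast
  qed
  ultimately show ?thesis using that F by blast
qed

lemma plane_patch:
  fixes q :: "2 \<Rightarrow> 2 \<Rightarrow> complex ^ 4"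
  defines "g t u \<equiv> \<Sum>j\<in>UNIV. \<Sum>k\<in>UNIV. ((t :: complex ^ 2) $ j * (u :: complex ^ 2) $ k) *s q j k"
  assumes "is_plane (zariski_closure (projectivize {g t u | t u. t \<noteq> 0 \<and> u \<noteq> 0}))"
    and nz: "\<And>j k. q j k \<noteq> 0"
  shows "\<not> indep4 (q 0 0) (q 0 1) (q 1 0) (q 1 1)"
proof -
  obtain V where V: "vec.subspace V" "vec.dim V = 3"
    "zariski_closure (projectivize {g t u | t u. t \<noteq> 0 \<and> u \<noteq> 0}) = projectivize V"
    using assms(2) unfolding is_plane_def by blast
  have "q j k \<in> V" for j k
  proof -
    have "g (axis j 1) (axis k 1) = q j k"
      using two_cases[of j] two_cases[of k] by (auto simp: g_def sum_two)
    moreover have "axis j 1 \<noteq> (0 :: complex ^ 2)" "axis k 1 \<noteq> (0 :: complex ^ 2)"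
      by (simp_all add: axis_eq_0_iff)
    ultimately have "pt (q j k) \<in> projectivize {g t u | t u. t \<noteq> 0 \<and> u \<noteq> 0}"
      unfolding projectivize_def using nz[of j k] by (metis (mono_tags, lifting) mem_Collect_eq)
    then have "pt (q j k) \<in> projectivize V" using zariski_closure_superset V(3) by blast
    then show ?thesis using pt_in_subspace[OF V(1) nz] by simp
  qed
  then show ?thesis by (intro dim_3_not_indep4[OF V(1,2)])
qed

section \<open>Scaffold maps\<close>

lemma boundary_line_spans:
  assumes "\<And>i j k. cvec (P i j k) \<noteq> 0"
  shows "s_line P j k = projectivize (vec.span {cvec (P 0 j k), cvec (P 1 j k)})"
    "t_line P i k = projectivize (vec.span {cvec (P i 0 k), cvec (P i 1 k)})"
    "u_line P i j = projectivize (vec.span {cvec (P i j 0), cvec (P i j 1)})"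
  by (simp_all add: s_line_def t_line_def u_line_def proj_hull_pair assms)

lemma nondegenerate_distinct:
  assumes "nondegenerate w P"
  shows "s_line P j k = s_line P j' k' \<Longrightarrow> j = j' \<and> k = k'" "u_line P i j \<noteq> t_line P i k"
    "T_surf w P 0 \<noteq> T_surf w P 1" "Y_surf w P 0 \<noteq> Y_surf w P 1"
proof -
  have d: "distinct [s_line P 0 0, s_line P 0 1, s_line P 1 0, s_line P 1 1,
               t_line P 0 0, t_line P 0 1, t_line P 1 0, t_line P 1 1,
               u_line P 0 0, u_line P 0 1, u_line P 1 0, u_line P 1 1]"
    "distinct [Sigma_surf w P 0, Sigma_surf w P 1, T_surf w P 0, T_surf w P 1,
               Y_surf w P 0, Y_surf w P 1]"
    using assms by (simp_all only: nondegenerate_def)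
  show "T_surf w P 0 \<noteq> T_surf w P 1" "Y_surf w P 0 \<noteq> Y_surf w P 1" using d(2) by simp_all
  have "\<forall>i j k. u_line P i j \<noteq> t_line P i k" using d(1) by (simp add: all_two eq_commute)
  then show "u_line P i j \<noteq> t_line P i k" by blast
  have "\<forall>j k j' k'. s_line P j k = s_line P j' k' \<longrightarrow> j = j' \<and> k = k'"
    using d(1) by (simp add: all_two eq_commute)
  then show "s_line P j k = s_line P j' k' \<Longrightarrow> j = j' \<and> k = k'" by blast
qed

lemma indep3_of_distinct_spans:
  fixes u v w :: "complex ^ 'n"
  assumes ne: "vec.span {u, v} \<noteq> vec.span {u, w}"
    and uv: "\<And>x y. x *s u + y *s v = 0 \<Longrightarrow> x = 0 \<and> y = 0"
    and uw: "\<And>x y. x *s u + y *s w = 0 \<Longrightarrow> x = 0 \<and> y = 0"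
    and 0: "x *s u + y *s v + z *s w = 0"
  shows "x = 0 \<and> y = 0 \<and> z = 0"
proof (cases "y = 0 \<or> z = 0")
  case True
  then show ?thesis using uv[of x y] uw[of x z] 0 by auto
next
  case False
  then show ?thesis using span_pair_exchange[OF 0] ne by blast
qed

text \<open>A vanishing coefficient would leave a relation among three points, and any three of the
  four are a corner with its two neighbours.\<close>

lemma four_point_relation:
  fixes q :: "2 \<Rightarrow> 2 \<Rightarrow> complex ^ 4"
  assumes dep: "\<not> indep4 (q 0 0) (q 0 1) (q 1 0) (q 1 1)"
    and tri: "\<And>j k x y z. x *s q j k + y *s q j (k + 1) + z *s q (j + 1) k = 0 \<Longrightarrow> x = 0 \<and> y = 0 \<and> z = 0"
  shows "\<exists>c :: 2 \<Rightarrow> 2 \<Rightarrow> complex. (\<forall>j k. c j k \<noteq> 0) \<and>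
    c 0 0 *s q 0 0 + c 0 1 *s q 0 1 + c 1 0 *s q 1 0 + c 1 1 *s q 1 1 = 0"
proof -
  obtain x y z w where rel: "x *s q 0 0 + y *s q 0 1 + z *s q 1 0 + w *s q 1 1 = 0"
    and nz: "\<not> (x = 0 \<and> y = 0 \<and> z = 0 \<and> w = 0)"
    using dep unfolding indep4_def by blast
  have "w \<noteq> 0"
  proof
    assume "w = 0"
    then show False using tri[of x 0 0 y z] rel nz by simp
  qed
  moreover have "z \<noteq> 0"
  proof
    assume "z = 0"
    then show False using tri[of y 0 1 x w] rel nz by (simp add: ac_simps)
  qed
  moreover have "y \<noteq> 0"
  proof
    assume "y = 0"
    then show False using tri[of z 1 0 w x] rel nz by (simp add: ac_simps)
  qed
  moreover have "x \<noteq> 0"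
  proof
    assume "x = 0"
    then show False using tri[of w 1 1 z y] rel nz by (simp add: ac_simps)
  qed
  ultimately show ?thesis
    using rel by (intro exI[of _ "\<lambda>j k. if j = 0 then (if k = 0 then x else y) else (if k = 0 then z else w)"]) auto
qed

theorem theorem5p6:
  fixes w :: tensor and P :: points
    and r :: "2 \<Rightarrow> 4 proj set" and \<theta> \<rho> :: "2 \<Rightarrow> real ^ 4"
  assumes "\<And>i j k. P i j k $ 0 = 1"
    and "nondegenerate w P"
    and "scaffold w P r"
    and "\<And>l. \<theta> l \<noteq> 0" and "\<And>l. y_line P \<subseteq> plane_of (\<theta> l)" and "\<And>l. r l \<subseteq> plane_of (\<theta> l)"
    and "\<And>l. \<rho> l \<noteq> 0" and "\<And>l. z_line P \<subseteq> plane_of (\<rho> l)" and "\<And>l. r l \<subseteq> plane_of (\<rho> l)"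
  shows "(birational_of_type w P (1, 2, 2) \<longleftrightarrow>
            (\<exists>l. rank_one (W_tensor w P (\<theta> l)) \<or> rank_one (W_tensor w P (\<rho> l)))) \<and>
         ((\<exists>l. rank_one (W_tensor w P (\<theta> l)) \<or> rank_one (W_tensor w P (\<rho> l))) \<longleftrightarrow>
            (\<forall>l. rank_one (W_tensor w P (\<theta> l)) \<and> rank_one (W_tensor w P (\<rho> l))))"
proof -
  define x where "x i j k = cvec (P i j k)" for i j k
  define v where "v i j k = complex_of_real (w i j k)" for i j k
  have xnz: "x i j k \<noteq> 0" for i j k
    using assms(1)[of i j k] by (auto simp: x_def cvec_eq_zero_iff)
  note lines = boundary_line_spans[of P, folded x_def, OF xnz]
  have sc: "\<And>j. is_quadric (T_surf w P j)" "\<And>k. is_quadric (Y_surf w P k)"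
    "\<And>i. is_plane (Sigma_surf w P i)" "\<And>l. is_line (r l)" "r 0 \<noteq> r 1"
    "\<And>l j k. r l \<inter> s_line P j k \<noteq> {}"
    using assms(3) by (simp_all add: scaffold_def)
  have Tp: "trilin w P s (axis j 1) u = (\<Sum>i\<in>UNIV. \<Sum>k\<in>UNIV. (s $ i * u $ k) *s (v i j k *s x i j k))" for s j u
    using two_cases[of j] by (auto simp: trilin_def sum_two v_def x_def vec_eq_iff algebra_simps)
  have Yp: "trilin w P s t (axis k 1) = (\<Sum>i\<in>UNIV. \<Sum>j\<in>UNIV. (s $ i * t $ j) *s (v i j k *s x i j k))" for s t k
    using two_cases[of k] by (auto simp: trilin_def sum_two v_def x_def vec_eq_iff algebra_simps)
  have Sp: "trilin w P (axis i 1) t u = (\<Sum>j\<in>UNIV. \<Sum>k\<in>UNIV. (t $ j * u $ k) *s (v i j k *s x i j k))" for i t u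
    using two_cases[of i] by (auto simp: trilin_def sum_two v_def x_def vec_eq_iff algebra_simps)
  have "\<exists>F. homogeneous 2 F \<and> irreducible F \<and> zeros F = T_surf w P j \<and>
      (\<forall>s u. cpoly_eval F (trilin w P s (axis j 1) u) = 0) \<and>
      indep4 (v 0 j 0 *s x 0 j 0) (v 0 j 1 *s x 0 j 1) (v 1 j 0 *s x 1 j 0) (v 1 j 1 *s x 1 j 1)" for j
    unfolding Tp
    by (rule quadric_patch[where q = "\<lambda>i k. v i j k *s x i j k",
        OF T_surf_def[of w P j, unfolded Tp] sc(1)[of j]]) blast
  then obtain F where F: "\<And>j. homogeneous 2 (F j)" "\<And>j. irreducible (F j)" "\<And>j. zeros (F j) = T_surf w P j"
    "\<And>j s u. cpoly_eval (F j) (trilin w P s (axis j 1) u) = 0"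
    and Ti: "\<And>j. indep4 (v 0 j 0 *s x 0 j 0) (v 0 j 1 *s x 0 j 1) (v 1 j 0 *s x 1 j 0) (v 1 j 1 *s x 1 j 1)"
    by metis
  have "\<exists>F. homogeneous 2 F \<and> irreducible F \<and> zeros F = Y_surf w P k \<and>
      (\<forall>s t. cpoly_eval F (trilin w P s t (axis k 1)) = 0) \<and>
      indep4 (v 0 0 k *s x 0 0 k) (v 0 1 k *s x 0 1 k) (v 1 0 k *s x 1 0 k) (v 1 1 k *s x 1 1 k)" for k
    unfolding Yp
    by (rule quadric_patch[where q = "\<lambda>i j. v i j k *s x i j k",
        OF Y_surf_def[of w P k, unfolded Yp] sc(2)[of k]]) blast
  then obtain G where G: "\<And>k. homogeneous 2 (G k)" "\<And>k. irreducible (G k)" "\<And>k. zeros (G k) = Y_surf w P k"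
    "\<And>k s t. cpoly_eval (G k) (trilin w P s t (axis k 1)) = 0"
    and Yi: "\<And>k. indep4 (v 0 0 k *s x 0 0 k) (v 0 1 k *s x 0 1 k) (v 1 0 k *s x 1 0 k) (v 1 1 k *s x 1 1 k)"
    by metis
  note Tx = indep4_scale(5)[OF Ti] and Yx = indep4_scale(5)[OF Yi]
  have vnz: "v i j k \<noteq> 0" for i j k
    using indep4_scale(1-4)[OF Ti[of j]] two_cases[of i] two_cases[of k] by auto
  have u_indep: "y = 0 \<and> z = 0" if "y *s x i j k + z *s x i j (k + 1) = 0" for y z i j k
    using Tx[of j, unfolded indep4_def, rule_format, of y z 0 0] Tx[of j, unfolded indep4_def, rule_format, of 0 0 y z]
      Tx[of j, unfolded indep4_def, rule_format, of z y 0 0] Tx[of j, unfolded indep4_def, rule_format, of 0 0 z y]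
      that two_cases[of i] two_cases[of k] by (auto simp: add.commute)
  have t_indep: "y = 0 \<and> z = 0" if "y *s x i j k + z *s x i (j + 1) k = 0" for y z i j k
    using Yx[of k, unfolded indep4_def, rule_format, of y z 0 0] Yx[of k, unfolded indep4_def, rule_format, of 0 0 y z]
      Yx[of k, unfolded indep4_def, rule_format, of z y 0 0] Yx[of k, unfolded indep4_def, rule_format, of 0 0 z y]
      that two_cases[of i] two_cases[of j] by (auto simp: add.commute)
  \<comment> \<open>A corner is joined to its neighbours by a \<open>u\<close> line and a
    \<open>t\<close> line. These are distinct, so the three points are not collinear.\<close>
  have tri: "y1 = 0 \<and> y2 = 0 \<and> y3 = 0"
    if 0: "y1 *s x i j k + y2 *s x i j (k + 1) + y3 *s x i (j + 1) k = 0" for i j k y1 y2 y3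
  proof (rule indep3_of_distinct_spans[OF _ u_indep t_indep 0])
    have "{x i j k, x i j (k + 1)} = {x i j 0, x i j 1}" "{x i j k, x i (j + 1) k} = {x i 0 k, x i 1 k}"
      using two_cases[of j] two_cases[of k] by auto
    then show "vec.span {x i j k, x i j (k + 1)} \<noteq> vec.span {x i j k, x i (j + 1) k}"
      using nondegenerate_distinct(2)[OF assms(2), of i j k] lines(2,3) by metis
  qed
  have dep: "\<not> indep4 (x i 0 0) (x i 0 1) (x i 1 0) (x i 1 1)" for i
    using plane_patch[where q = "\<lambda>j k. v i j k *s x i j k", OF sc(3)[of i, unfolded Sigma_surf_def Sp]]
      vnz xnz indep4_scaleI by auto
  have "\<forall>i. \<exists>c :: 2 \<Rightarrow> 2 \<Rightarrow> complex. (\<forall>j k. c j k \<noteq> 0) \<and>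
    c 0 0 *s x i 0 0 + c 0 1 *s x i 0 1 + c 1 0 *s x i 1 0 + c 1 1 *s x i 1 1 = 0"
    by (intro allI four_point_relation[OF dep tri])
  from choice[OF this] obtain c :: "2 \<Rightarrow> 2 \<Rightarrow> 2 \<Rightarrow> complex" where cnz: "\<And>i j k. c i j k \<noteq> 0"
    and rel: "\<And>i. c i 0 0 *s x i 0 0 + c i 0 1 *s x i 0 1 + c i 1 0 *s x i 1 0 + c i 1 1 *s x i 1 1 = 0"
    by blast
  define p where "p i j k = c i j k *s x i j k" for i j k
  define \<omega> where "\<omega> i j k = v i j k / c i j k" for i j k
  have \<omega>nz: "\<omega> i j k \<noteq> 0" for i j k using vnz cnz by (simp add: \<omega>_def)
  have \<omega>p: "\<omega> i j k *s p i j k = v i j k *s x i j k" for i j k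
    using cnz by (simp add: \<omega>_def p_def vector_smult_assoc)
  interpret scaffold_points p
  proof
    show "indep4 (p 0 j 0) (p 0 j 1) (p 1 j 0) (p 1 j 1)" for j
      unfolding p_def by (intro indep4_scaleI Tx cnz)
    show "indep4 (p 0 0 k) (p 0 1 k) (p 1 0 k) (p 1 1 k)" for k
      unfolding p_def by (intro indep4_scaleI Yx cnz)
    show "p i 0 0 + p i 0 1 + p i 1 0 + p i 1 1 = 0" for i
      unfolding p_def by (rule rel)
    show "y1 = 0 \<and> y2 = 0 \<and> y3 = 0" if "y1 *s p i 0 0 + y2 *s p i 0 1 + y3 *s p i 1 0 = 0" for i y1 y2 y3
      using tri[of "y1 * c i 0 0" i 0 0 "y2 * c i 0 1" "y3 * c i 1 0"] that cnz
      by (simp add: p_def vector_smult_assoc)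
  qed
  have w: "trilin w P s t u = trisum \<omega> p s t u" for s t u
  proof -
    have "(\<omega> i j k * s $ i * t $ j * u $ k) *s p i j k
        = (complex_of_real (w i j k) * s $ i * t $ j * u $ k) *s cvec (P i j k)" for i j k
      using cnz[of i j k] by (simp add: \<omega>_def p_def v_def x_def vec_eq_iff)
    then show ?thesis by (simp add: trilin_def trisum_def)
  qed
  have span_p: "vec.span {p i j k, p i' j' k'} = vec.span {x i j k, x i' j' k'}" for i j k i' j' k'
  proof (rule vec.span_eq[THEN iffD2], intro conjI subsetI)
    fix y assume "y \<in> {p i j k, p i' j' k'}"
    then show "y \<in> vec.span {x i j k, x i' j' k'}"
      by (auto simp: p_def intro: vec.span_scale vec.span_base)
  next
    fix y assume "y \<in> {x i j k, x i' j' k'}"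
    moreover have "x i j k \<in> vec.span S" if "p i j k \<in> S" for i j k S
    proof -
      have "x i j k = (1 / c i j k) *s p i j k"
        using cnz[of i j k] by (simp add: p_def vector_smult_assoc)
      then show ?thesis using that by (metis vec.span_scale vec.span_base)
    qed
    ultimately show "y \<in> vec.span {p i j k, p i' j' k'}" by blast
  qed
  note lines_p = lines[folded span_p]
  have "\<exists>L. \<forall>l. vec.subspace (L l) \<and> vec.dim (L l) = 2 \<and> r l = projectivize (L l)"
    using sc(4) unfolding is_line_def by metis
  then obtain L where L: "\<And>l. vec.subspace (L l)" "\<And>l. vec.dim (L l) = 2" "\<And>l. r l = projectivize (L l)"
    by blast
  have "L 0 \<noteq> L 1" using sc(5) L(3) by metis
  have meet: "\<exists>a b. (a \<noteq> 0 \<or> b \<noteq> 0) \<and> a *s p 0 j k + b *s p 1 j k \<in> L l" for l j k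
  proof -
    obtain Q where Q: "Q \<in> projectivize (L l)" "Q \<in> projectivize (vec.span {p 0 j k, p 1 j k})"
      using sc(6)[of l j k] unfolding L(3) lines_p(1) by blast
    from Q(2) obtain y where y: "Q = pt y" "y \<in> vec.span {p 0 j k, p 1 j k}" "y \<noteq> 0"
      unfolding projectivize_def by blast
    then have "y \<in> L l" using Q(1) pt_in_subspace[OF L(1)] by simp
    moreover obtain a b where "y = a *s p 0 j k + b *s p 1 j k" using y(2) span_pair by blast
    moreover from this have "a \<noteq> 0 \<or> b \<noteq> 0" using y(3) by auto
    ultimately show ?thesis by blast
  qed
  have \<theta>: "cvec (\<theta> l) \<noteq> 0" "y \<in> L l \<Longrightarrow> dot (cvec (\<theta> l)) y = 0" for l y
    using assms(4,6)[of l] pt_in_plane_of[of y "\<theta> l"] pt_in_subspace[OF L(1)] L(3)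
    by (auto simp: cvec_eq_zero_iff) (cases "y = 0"; force)
  have \<rho>: "cvec (\<rho> l) \<noteq> 0" "y \<in> L l \<Longrightarrow> dot (cvec (\<rho> l)) y = 0" for l y
    using assms(7,9)[of l] pt_in_plane_of[of y "\<rho> l"] pt_in_subspace[OF L(1)] L(3)
    by (auto simp: cvec_eq_zero_iff) (cases "y = 0"; force)
  \<comment> \<open>\<open>p i 0 0 + p i 0 1\<close> is the intersection point of the two
    \<open>u\<close> lines in Sigma_i, since by \<open>last_point\<close> it is also a combination
    of the other two points.\<close>
  have \<theta>0: "dot (cvec (\<theta> l)) (p i j 0) + dot (cvec (\<theta> l)) (p i j 1) = 0" for l i j
  proof -
    have q: "p i 0 0 + p i 0 1 \<noteq> 0"
      using indep3[of 1 i 1 0] by auto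
    have "p i 0 0 + p i 0 1 = 1 *s p i 0 0 + 1 *s p i 0 1"
      "p i 0 0 + p i 0 1 = (- 1) *s p i 1 0 + (- 1) *s p i 1 1" by (simp_all add: last_point)
    then have "p i 0 0 + p i 0 1 \<in> vec.span {p i 0 0, p i 0 1} \<inter> vec.span {p i 1 0, p i 1 1}"
      unfolding Int_iff span_pair by blast
    then have "pt (p i 0 0 + p i 0 1) \<in> u_line P i 0 \<inter> u_line P i 1"
      unfolding lines_p using q
      by (simp add: pt_in_subspace vec.subspace_span)
    then have "pt (p i 0 0 + p i 0 1) \<in> y_line P"
      unfolding y_line_def using q two_cases[of i] by (intro pt_in_proj_hull) auto
    then have "dot (cvec (\<theta> l)) (p i 0 0 + p i 0 1) = 0"
      using assms(5)[of l] pt_in_plane_of[OF q] by blast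
    then show ?thesis using two_cases[of j] by (auto simp: last_point dot_simps algebra_simps)
  qed
  have \<rho>0: "dot (cvec (\<rho> l)) (p i 0 k) + dot (cvec (\<rho> l)) (p i 1 k) = 0" for l i k
  proof -
    have q: "p i 0 0 + p i 1 0 \<noteq> 0"
      using indep3[of 1 i 0 1] by auto
    have "p i 0 0 + p i 1 0 = 1 *s p i 0 0 + 1 *s p i 1 0"
      "p i 0 0 + p i 1 0 = (- 1) *s p i 0 1 + (- 1) *s p i 1 1" by (simp_all add: last_point)
    then have "p i 0 0 + p i 1 0 \<in> vec.span {p i 0 0, p i 1 0} \<inter> vec.span {p i 0 1, p i 1 1}"
      unfolding Int_iff span_pair by blast
    then have "pt (p i 0 0 + p i 1 0) \<in> t_line P i 0 \<inter> t_line P i 1"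
      unfolding lines_p using q
      by (simp add: pt_in_subspace vec.subspace_span)
    then have "pt (p i 0 0 + p i 1 0) \<in> z_line P"
      unfolding z_line_def using q two_cases[of i] by (intro pt_in_proj_hull) auto
    then have "dot (cvec (\<rho> l)) (p i 0 0 + p i 1 0) = 0"
      using assms(8)[of l] pt_in_plane_of[OF q] by blast
    then show ?thesis using two_cases[of k]
      by (auto simp: last_point dot_simps algebra_simps neg_eq_iff_add_eq_0)
  qed
  interpret tr: scaffold_points "\<lambda>i j k. p i k j" by (rule transpose_points)
  have \<theta>nz: "dot (cvec (\<theta> l)) (p i j k) \<noteq> 0" for l i j k
    by (rule transversal_plane_nonzero[OF L(1,2) meet \<theta> \<theta>0])
  have \<rho>nz: "dot (cvec (\<rho> l)) (p i j k) \<noteq> 0" for l i j k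
    by (rule tr.transversal_plane_nonzero[OF L(1,2) meet \<rho> \<rho>0])
  have "\<forall>l. \<exists>m. m \<noteq> 0 \<and> (\<forall>j k. p 0 j k - m *s p 1 j k \<in> L l) \<and>
      (\<forall>j k. dot (cvec (\<theta> l)) (p 0 j k) = m * dot (cvec (\<theta> l)) (p 1 j k)) \<and>
      (\<forall>j k. dot (cvec (\<rho> l)) (p 0 j k) = m * dot (cvec (\<rho> l)) (p 1 j k))"
  proof
    fix l
    show "\<exists>m. m \<noteq> 0 \<and> (\<forall>j k. p 0 j k - m *s p 1 j k \<in> L l) \<and>
      (\<forall>j k. dot (cvec (\<theta> l)) (p 0 j k) = m * dot (cvec (\<theta> l)) (p 1 j k)) \<and>
      (\<forall>j k. dot (cvec (\<rho> l)) (p 0 j k) = m * dot (cvec (\<rho> l)) (p 1 j k))"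
    proof (rule transversal_ratio[OF L(1,2) meet \<theta> \<theta>0 \<rho> \<rho>0, of l])
      fix m
      assume m: "m \<noteq> 0" "\<And>j k. p 0 j k - m *s p 1 j k \<in> L l"
        "\<And>j k. dot (cvec (\<theta> l)) (p 0 j k) = m * dot (cvec (\<theta> l)) (p 1 j k)"
        "\<And>j k. dot (cvec (\<rho> l)) (p 0 j k) = m * dot (cvec (\<rho> l)) (p 1 j k)"
      show ?thesis by (intro exI[of _ m] conjI allI) (fact m)+
    qed
  qed
  from choice[OF this] obtain m where m: "\<And>l. m l \<noteq> 0" "\<And>l j k. p 0 j k - m l *s p 1 j k \<in> L l"
    "\<And>l j k. dot (cvec (\<theta> l)) (p 0 j k) = m l * dot (cvec (\<theta> l)) (p 1 j k)"
    "\<And>l j k. dot (cvec (\<rho> l)) (p 0 j k) = m l * dot (cvec (\<rho> l)) (p 1 j k)"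
    by blast
  obtain \<Phi> where \<Phi>: "linear_map \<Phi>" "\<And>j k. \<Phi> (p 1 j k) = p 0 j k"
    "\<And>x. \<Phi> (\<Phi> x) = (m 0 + m 1) *s \<Phi> x - (m 0 * m 1) *s x"
    using homology_exists[of L m, OF L(1,2) \<open>L 0 \<noteq> L 1\<close> m(2)] by blast
  interpret scaffold_homology p \<Phi> "m 0" "m 1"
    by unfold_locales (use \<Phi> m(1) in auto)
  have W: "complex_of_real (W_tensor w P a i j k) = \<omega> i j k * dot (cvec a) (p i j k)" for a i j k
    using cnz[of i j k]
    by (simp add: W_tensor_def Delta_def p_def \<omega>_def dot_simps x_def dot_cvec v_def)
  have W_iff: "rank_one (W_tensor w P a) \<longleftrightarrow> minors_vanish \<omega>"
    if "\<And>i j k. dot (cvec a) (p i j k) \<noteq> 0"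
      and "\<And>i j k. dot (cvec a) (p i j k) = \<epsilon> i * \<tau> j * \<delta> k" for a \<epsilon> \<tau> \<delta>
  proof -
    have "W_tensor w P a i j k \<noteq> 0" for i j k
      using W[of a i j k] that(1)[of i j k] \<omega>nz[of i j k] by auto
    then have "rank_one (W_tensor w P a) \<longleftrightarrow> minors_vanish (\<lambda>i j k. \<omega> i j k * dot (cvec a) (p i j k))"
      by (simp add: rank_one_iff_minors_vanish minors_vanish_of_real[symmetric] W)
    also have "\<dots> \<longleftrightarrow> minors_vanish \<omega>"
      by (rule minors_vanish_scale[OF that(2,1)])
    finally show ?thesis .
  qed
  have \<theta>_iff: "rank_one (W_tensor w P (\<theta> l)) \<longleftrightarrow> minors_vanish \<omega>" for l
  proof (rule W_iff[OF \<theta>nz])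
    fix i j k
    have "dot (cvec (\<theta> l)) (p 1 j 1) = - dot (cvec (\<theta> l)) (p 1 j 0)"
      using \<theta>0[of l 1 j] by (simp add: eq_neg_iff_add_eq_0 add.commute)
    \<comment> \<open>The ratio \<open>m l\<close> accounts for \<open>i\<close>, a sign for
      \<open>k\<close>, and the value at \<open>p 1 j 0\<close> for \<open>j\<close>.\<close>
    then show "dot (cvec (\<theta> l)) (p i j k)
        = (if i = 0 then m l else 1) * dot (cvec (\<theta> l)) (p 1 j 0) * (if k = 0 then 1 else - 1)"
      using two_cases[of i] two_cases[of k] by (auto simp: m(3))
  qed
  have \<rho>_iff: "rank_one (W_tensor w P (\<rho> l)) \<longleftrightarrow> minors_vanish \<omega>" for l
  proof (rule W_iff[OF \<rho>nz])
    fix i j k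
    have "dot (cvec (\<rho> l)) (p 1 1 k) = - dot (cvec (\<rho> l)) (p 1 0 k)"
      using \<rho>0[of l 1 k] by (simp add: eq_neg_iff_add_eq_0 add.commute)
    then show "dot (cvec (\<rho> l)) (p i j k)
        = (if i = 0 then m l else 1) * (if j = 0 then 1 else - 1) * dot (cvec (\<rho> l)) (p 1 0 k)"
      using two_cases[of i] two_cases[of j] by (auto simp: m(4))
  qed
  have "birational_of_type w P (1, 2, 2) \<longleftrightarrow> minors_vanish \<omega>"
  proof
    assume "birational_of_type w P (1, 2, 2)"
    then show "minors_vanish \<omega>"
    proof (rule birational_imp_minors_vanish[OF \<omega>nz w])
      show "j = j' \<and> k = k'" if "vec.span {p 0 j k, p 1 j k} = vec.span {p 0 j' k', p 1 j' k'}" for j k j' k'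
        using nondegenerate_distinct(1)[OF assms(2)] that lines_p(1) by metis
    qed
  next
    assume "minors_vanish \<omega>"
    from minors_vanish_factor[OF this \<omega>nz] show "birational_of_type w P (1, 2, 2)"
    proof (rule rank_one_imp_birational[where F = F and G = G])
      show "zeros (F 0) \<noteq> zeros (F 1)" "zeros (G 0) \<noteq> zeros (G 1)"
        unfolding F(3) G(3) by (fact nondegenerate_distinct(3,4)[OF assms(2)])+
    qed (use \<omega>nz F(1,2,4) G(1,2,4) w in auto)
  qed
  then show ?thesis by (simp add: \<theta>_iff \<rho>_iff)
qed

end
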